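(* Let $\mu$ be a shift-invariant Markov random field on $\mathbb Z^d$ with topological support $X\subseteq A^{\mathbb Z^d}$. Suppose that $\mu$ satisfies exponential strong spatial mixing, and let $v\in C(X)$ be Hölder continuous (with respect to the metric $\rho$) with $\mathbb E_\mu[v]=0$. Then the series $\sigma_v^2=\sum_{i\in\mathbb Z^d}\mathbb E_\mu[v\,(v\circ T^i)]$ converges and is non-negative. Moreover, if $\sigma_v^2>0$, then for any $\epsilon\in(0,d/2)$ there is $C>0$ such that for any $n\ge1$ and $\Gamma_n=[0,n-1]^d\cap\mathbb Z^d$, $$\sup_{t\in\mathbb R}\bigg|\mu\bigg(\frac{\sum_{i\in\Gamma_n}v\circ T^i}{n^{d/2}}\le t\bigg)-\Phi(t/\sigma_v)\bigg|\le C\max\{n^{-d/2+\epsilon},n^{-1}\},$$ where $\sigma_v=\sqrt{\sigma_v^2}$ and $\Phi$ is the cumulative distribution function of a standard Gaussian.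
   Context: $A$ is a finite alphabet, $d$ a positive integer, $A^{\mathbb Z^d}$ carries the prodiscrete topology, and $(T^ix)_j=x_{i+j}$ for $i,j\in\mathbb Z^d$ are the shifts. $C(X)$ is the space of continuous functions $X\to\mathbb R$ and $\mathbb E_\mu$ is expectation with respect to $\mu$. With $B_k=[-k,k]^d\cap\mathbb Z^d$, the metric on $X$ is $\rho(x,x')=2^{-s(x,x')}$, where $s(x,x')=\inf\{k\ge0:x|_{B_k}\ne x'|_{B_k}\}$, with $\inf\emptyset=+\infty$ and $2^{-\infty}=0$. For finite $V,W\subseteq\mathbb Z^d$, $\operatorname{dist}(V,W)$ is the graph distance in the canonical Cayley graph of $\mathbb Z^d$ (nearest-neighbour graph), with $\operatorname{dist}(U,\varnothing)=+\infty$; $\partial V$ is the set of points at distance $1$ from $V$. $\mu$ is a Markov random field if, for every finite $V$, conditionally on the configuration on $\partial V$, the configuration on $V$ is independent of the configuration on $\mathbb Z^d\setminus(V\cup\partial V)$. Let $X_{\partial V}=\{x|_{\partial V}:x\in X\}$. For $\tau\in X_{\partial V}$ and $\eta\in A^V$, $P_V^\tau(\eta)=\mu(\{x\in X:x|_V=\eta\}\mid\{x\in X:x|_{\partial V}=\tau\})$; for $U\subseteq V$, $P^\tau_{V,U}$ is the marginal of $P_V^\tau$ on $A^U$. For $\tau,\tau'\in X_{\partial V}$ let $\Sigma_V(\tau,\tau')=\{i\in\partial V:\tau_i\ne\tau'_i\}$. $\mu$ satisfies exponential strong spatial mixing if there are constants $C,c>0$ such that $$\|P^{\tau}_{V,U}-P^{\tau'}_{V,U}\|_{\rm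 TV}\le C|U|\exp\big(-c\operatorname{dist}(U,\Sigma_V(\tau,\tau'))\big)$$ for every finite $V\subseteq\mathbb Z^d$, every $U\subseteq V$, and every $\tau,\tau'\in X_{\partial V}$, where $\|\cdot\|_{\rm TV}$ is total variation. *)

theory Defs
  imports "HOL-Probability.Probability"
begin

text \<open>
  The lattice is \<open>int ^ 'd\<close>, with \<open>CARD('d)\<close> in the role of the dimension.  The alphabet is a type
  of class \<open>{finite, discrete_topology}\<close>, so the topology of the function type
  \<open>int ^ 'd \<Rightarrow> 'a\<close> is the prodiscrete one.  The configuration of \<open>x\<close> on \<open>V\<close> is \<open>restrict x V\<close>, an
  element of \<open>V \<rightarrow>\<^sub>E UNIV\<close>.
\<close>

type_synonym ('d, 'a) config = "(int, 'd) vec \<Rightarrow> 'a"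

definition shift :: "int ^ 'd \<Rightarrow> ('d::finite, 'a) config \<Rightarrow> ('d, 'a) config" where
  "shift i x = (\<lambda>j. x (i + j))"

definition shift_invariant :: "('d::finite, 'a::topological_space) config measure \<Rightarrow> bool" where
  "shift_invariant M \<longleftrightarrow> (\<forall>i. distr M M (shift i) = M)"

definition topological_support :: "'b::topological_space measure \<Rightarrow> 'b set" where
  "topological_support M = {x. \<forall>U. open U \<longrightarrow> x \<in> U \<longrightarrow> emeasure M U > 0}"


subsection \<open>Nearest-neighbour graph\<close>

definition lattice_adj :: "int ^ 'd::finite \<Rightarrow> int ^ 'd \<Rightarrow> bool" where
  "lattice_adj i j \<longleftrightarrow> (\<exists>k. j = i + axis k 1 \<or> j = i - axis k 1)"

definition graph_dist :: "int ^ 'd::finite \<Rightarrow> int ^ 'd \<Rightarrow> nat" where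
  "graph_dist i j = (LEAST n. (lattice_adj ^^ n) i j)"

text \<open>The infimum over the empty set is \<open>\<infinity>\<close>.\<close>

definition set_dist :: "(int ^ 'd::finite) set \<Rightarrow> (int ^ 'd) set \<Rightarrow> enat" where
  "set_dist V W = (INF (i, j) \<in> V \<times> W. enat (graph_dist i j))"

definition boundary :: "(int ^ 'd::finite) set \<Rightarrow> (int ^ 'd) set" where
  "boundary V = {i. set_dist {i} V = 1}"


subsection \<open>Markov random fields\<close>

text \<open>
  For finite \<open>V\<close> the boundary is finite, so conditioning on the configuration there amounts to
  conditioning on each of the finitely many cylinder events of positive probability.
\<close>

definition markov_random_field ::
    "('d::finite, 'a::topological_space) config measure \<Rightarrow> bool" where
  "markov_random_field M \<longleftrightarrow>
    (\<forall>V \<tau>. finite V \<longrightarrow>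
      (let C = {x \<in> space M. restrict x (boundary V) = \<tau>}; W = - (V \<union> boundary V) in
        measure M C > 0 \<longrightarrow>
        prob_space.indep_var (uniform_measure M C)
          (Pi\<^sub>M V (\<lambda>_. borel)) (\<lambda>x. restrict x V)
          (Pi\<^sub>M W (\<lambda>_. borel)) (\<lambda>x. restrict x W)))"


subsection \<open>Exponential strong spatial mixing\<close>

definition boundary_configs ::
    "('d::finite, 'a::topological_space) config measure \<Rightarrow> (int ^ 'd) set \<Rightarrow> ('d, 'a) config set" where
  "boundary_configs M V = (\<lambda>x. restrict x (boundary V)) ` topological_support M"

definition local_spec ::
    "('d::finite, 'a::topological_space) config measure \<Rightarrow> (int ^ 'd) set \<Rightarrow>
      ('d, 'a) config \<Rightarrow> ('d, 'a) config \<Rightarrow> real" where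
  "local_spec M V \<tau> \<eta> =
    cond_prob M (\<lambda>x. x \<in> topological_support M \<and> restrict x V = \<eta>)
      (\<lambda>x. x \<in> topological_support M \<and> restrict x (boundary V) = \<tau>)"

definition local_spec_marginal ::
    "('d::finite, 'a::topological_space) config measure \<Rightarrow> (int ^ 'd) set \<Rightarrow> (int ^ 'd) set \<Rightarrow>
      ('d, 'a) config \<Rightarrow> ('d, 'a) config \<Rightarrow> real" where
  "local_spec_marginal M V U \<tau> \<xi> =
    (\<Sum>\<eta> | \<eta> \<in> V \<rightarrow>\<^sub>E UNIV \<and> restrict \<eta> U = \<xi>. local_spec M V \<tau> \<eta>)"

text \<open>Total variation distance between two mass functions on a finite set.\<close>

definition tv_dist :: "'b set \<Rightarrow> ('b \<Rightarrow> real) \<Rightarrow> ('b \<Rightarrow> real) \<Rightarrow> real" where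
  "tv_dist S p q = (1 / 2) * (\<Sum>\<xi>\<in>S. \<bar>p \<xi> - q \<xi>\<bar>)"

definition disagreement ::
    "(int ^ 'd::finite) set \<Rightarrow> ('d, 'a) config \<Rightarrow> ('d, 'a) config \<Rightarrow> (int ^ 'd) set" where
  "disagreement V \<tau> \<tau>' = {i \<in> boundary V. \<tau> i \<noteq> \<tau>' i}"

definition exp_decay :: "real \<Rightarrow> enat \<Rightarrow> real" where
  "exp_decay c r = (case r of enat k \<Rightarrow> exp (- c * real k) | \<infinity> \<Rightarrow> 0)"

definition exp_strong_spatial_mixing ::
    "('d::finite, 'a::{finite,topological_space}) config measure \<Rightarrow> bool" where
  "exp_strong_spatial_mixing M \<longleftrightarrow>
    (\<exists>C c. C > 0 \<and> c > 0 \<and>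
      (\<forall>V U. finite V \<longrightarrow> U \<subseteq> V \<longrightarrow>
        (\<forall>\<tau> \<in> boundary_configs M V. \<forall>\<tau>' \<in> boundary_configs M V.
          tv_dist (U \<rightarrow>\<^sub>E UNIV) (local_spec_marginal M V U \<tau>) (local_spec_marginal M V U \<tau>')
            \<le> C * real (card U) * exp_decay c (set_dist U (disagreement V \<tau> \<tau>')))))"


subsection \<open>Hoelder observables and correlations\<close>

definition centred_box :: "nat \<Rightarrow> (int ^ 'd::finite) set" where
  "centred_box k = {i. \<forall>l. - int k \<le> i $ l \<and> i $ l \<le> int k}"

definition first_difference :: "('d::finite, 'a) config \<Rightarrow> ('d, 'a) config \<Rightarrow> enat" where
  "first_difference x y =
    Inf (enat ` {k. restrict x (centred_box k) \<noteq> restrict y (centred_box k)})"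

definition config_dist :: "('d::finite, 'a) config \<Rightarrow> ('d, 'a) config \<Rightarrow> real" where
  "config_dist x y = (case first_difference x y of enat k \<Rightarrow> (1 / 2) ^ k | \<infinity> \<Rightarrow> 0)"

text \<open>
  Since \<open>config_dist\<close> is bounded by 1, allowing exponents above 1 does not enlarge the class.
\<close>

definition holder_on :: "('d::finite, 'a) config set \<Rightarrow> (('d, 'a) config \<Rightarrow> real) \<Rightarrow> bool" where
  "holder_on X v \<longleftrightarrow>
    (\<exists>\<alpha> K. \<alpha> > 0 \<and> K \<ge> 0 \<and> (\<forall>x\<in>X. \<forall>y\<in>X. \<bar>v x - v y\<bar> \<le> K * config_dist x y powr \<alpha>))"

definition Gamma_box :: "nat \<Rightarrow> (int ^ 'd::finite) set" where
  "Gamma_box n = {i. \<forall>l. 0 \<le> i $ l \<and> i $ l \<le> int n - 1}"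

text \<open>Only the values of \<open>v\<close> on the support enter, since expectations are taken over the support.\<close>

definition correlation ::
    "('d::finite, 'a::topological_space) config measure \<Rightarrow> (('d, 'a) config \<Rightarrow> real) \<Rightarrow>
      int ^ 'd \<Rightarrow> real" where
  "correlation M v i = (LINT x:topological_support M|M. v x * v (shift i x))"

end

theory Submission
  imports Defs
begin

text \<open>
  Strong spatial mixing and the Markov property, applied to the sites within distance \<open>r\<close> of a finite
  set \<open>U\<close>, bound the covariance of a function of the spins in \<open>U\<close> and a function of spins further than
  \<open>r + 1\<close> away by a multiple of \<open>card U\<close> times \<open>exp (- c * r)\<close>.  Replacing \<open>v\<close> by functions \<open>a l\<close> of the
  spins in a box of radius \<open>l\<close> costs only an error exponentially small in \<open>l\<close>, so correlations of \<open>v\<close>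
  decay exponentially, their series converges, and the variance over the box is
  \<open>n ^ d * \<sigma>2 + O(n ^ (d - 1))\<close>; this is the origin of the term \<open>1 / n\<close>.

  The rate comes from Stein's method.  For \<open>W = (\<Sum>i. \<xi> i)\<close> with bounded \<open>\<xi> i\<close> and neighbourhood sums
  \<open>\<eta> i\<close>, expand \<open>E (W * f W) = (\<Sum>i. E (\<xi> i * f W))\<close> around \<open>W - \<eta> i\<close>, where \<open>f\<close> solves the Stein equation of
  a ramp of width \<open>\<alpha>\<close>.  The remainder involves the probability that \<open>W\<close> lies in an interval of length about
  \<open>\<alpha>\<close>, which is again at most \<open>O(\<alpha>)\<close> plus twice the Kolmogorov distance \<open>\<delta>\<close>.  When \<open>\<alpha>\<close> is a large multiple of
  the third-moment sum, the resulting \<open>\<delta>\<close> has coefficient at most one half and can be absorbed.  With \<open>l\<close> a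
  large multiple of \<open>ln n\<close> all mixing errors are polynomially small and the neighbourhoods have
  polylogarithmic size, which accounts for the loss \<open>n powr \<epsilon>\<close>.
\<close>

section \<open>Stein equation for the normal distribution\<close>

text \<open>Stein's method tolerates this, since the error is the expectation of one local variable
  times a bounded function of everything far away. The covariance estimate sees that function only
  through its supremum, so it may involve the rest of the box nonlinearly.

  The observable depends on infinitely many spins, so the estimates are made for the local functions
  \<open>a l\<close>. These need not be centred; their bias is at most \<open>K * q ^ l\<close>.
  Errors are summed over all pairs of the N sites of a box, whence the requirement that
  \<open>N ^ 2 * q ^ l\<close> be at most 1.

  The sum is normalised by the limiting variance, not by its own. The Stein argument then asks that
  a sum of local products be close to 1 in mean, and the boundary effect of relative size 1 / n
  enters there.

  Mixing is formulated with the graph distance, but neighbourhoods are sup-norm balls: these are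
  boxes, easy to count, and sites far apart in the sup norm are far apart in the graph.\<close>

lemma std_normal_density_has_derivative:
  "(std_normal_density has_real_derivative - x * std_normal_density x) (at x)"
  unfolding std_normal_density_def [abs_def]
  by (auto intro!: derivative_eq_intros simp: field_simps power2_eq_square)

lemma std_normal_density_tendsto_0: "(std_normal_density \<longlongrightarrow> 0) at_top"
  unfolding std_normal_density_def [abs_def] by real_asymp

lemma continuous_on_std_normal_density: "continuous_on A std_normal_density"
  by (rule DERIV_continuous_on, rule has_field_derivative_at_within, rule std_normal_density_has_derivative)

lemma std_normal_density_le_1: "std_normal_density x \<le> 1"
proof -
  have "1 \<le> sqrt (2 * pi)" using pi_gt3 by (simp add: real_le_rsqrt)
  moreover have "exp (- x\<^sup>2 / 2) \<le> 1" by simp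
  ultimately show ?thesis unfolding std_normal_density_def
    using mult_mono[of "1 / sqrt (2 * pi)" 1 "exp (- x\<^sup>2 / 2)" 1] by simp
qed

lemma std_normal_density_antimono: "0 \<le> w \<Longrightarrow> w \<le> x \<Longrightarrow> std_normal_density x \<le> std_normal_density w"
  unfolding std_normal_density_def by (intro mult_left_mono) (auto intro: power_mono)

section \<open>Gaussian tail integrals\<close>

lemma integrable_std_normal: "integrable lborel std_normal_density"
  by (rule integrable_normal_density) simp

lemma integral_std_normal: "(\<integral>x. std_normal_density x \<partial>lborel) = 1"
  by (rule integral_normal_density) simp

text \<open>The integrand is minus the derivative of the density, so this tail is known exactly; the
  tail of the density itself is compared with it below.\<close>

lemma std_normal_first_moment_tail:
  assumes "0 \<le> w"
  shows "set_integrable lborel {w..} (\<lambda>x. x * std_normal_density x)"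
    and "(LINT x:{w..}|lborel. x * std_normal_density x) = std_normal_density w"
proof -
  have "(\<integral>\<^sup>+x. ennreal (x * std_normal_density x) * indicator {w ..} x \<partial>lborel) = 0 - (- std_normal_density w)"
  proof (rule nn_integral_FTC_atLeast)
    show "(\<lambda>x. x * std_normal_density x) \<in> borel_measurable borel" by measurable
    show "((\<lambda>x. - std_normal_density x) has_real_derivative x * std_normal_density x) (at x)" for x
      by (rule derivative_eq_intros std_normal_density_has_derivative refl)+ simp
    show "0 \<le> x * std_normal_density x" if "w \<le> x" for x using that assms by simp
    show "((\<lambda>x. - std_normal_density x) \<longlongrightarrow> 0) at_top"
      using tendsto_minus[OF std_normal_density_tendsto_0] by simp
  qed
  moreover have "ennreal y * indicator {w ..} x = ennreal (indicator {w ..} x * y)" for x y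
    by (simp add: indicator_def)
  ultimately have eq: "(\<integral>\<^sup>+x. ennreal (indicator {w ..} x * (x * std_normal_density x)) \<partial>lborel) = ennreal (std_normal_density w)"
    by simp
  have "has_bochner_integral lborel (\<lambda>x. indicator {w ..} x * (x * std_normal_density x)) (std_normal_density w)"
    by (rule has_bochner_integral_nn_integral) (use eq assms in \<open>auto simp: indicator_def\<close>)
  thus "set_integrable lborel {w..} (\<lambda>x. x * std_normal_density x)"
    and "(LINT x:{w..}|lborel. x * std_normal_density x) = std_normal_density w"
    by (auto simp: set_integrable_def set_lebesgue_integral_def has_bochner_integral_iff)
qed

lemma set_integrable_std_normal:
  "A \<in> sets borel \<Longrightarrow> set_integrable lborel A std_normal_density"
  unfolding set_integrable_def by (rule integrable_mult_indicator) (auto simp: integrable_std_normal)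

lemma std_normal_tail_le:
  assumes "0 \<le> w"
  shows "w * (LINT x:{w..}|lborel. std_normal_density x) \<le> std_normal_density w"
    and "(LINT x:{w..}|lborel. std_normal_density x) \<le> 2 * std_normal_density w"
proof -
  note m = std_normal_first_moment_tail[OF assms]
  have "w * (LINT x:{w..}|lborel. std_normal_density x) = (LINT x:{w..}|lborel. w * std_normal_density x)"
    by (rule set_integral_mult_right [symmetric])
  also have "\<dots> \<le> (LINT x:{w..}|lborel. x * std_normal_density x)"
    by (rule set_integral_mono[OF _ m(1)]) (auto intro!: set_integrable_std_normal set_integrable_mult_right mult_right_mono)
  finally show "w * (LINT x:{w..}|lborel. std_normal_density x) \<le> std_normal_density w" using m by simp
  \<comment> \<open>Up to \<open>w + 1\<close> the density is at most its value at \<open>w\<close>;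
    beyond, \<open>1 \<le> x\<close> and the first moment dominates. Each range contributes one
    \<open>std_normal_density w\<close>, hence the factor 2.\<close>
  define g where "g x = indicator {w..w+1} x * std_normal_density w" for x
  have gi: "integrable lborel g" unfolding g_def by simp
  have gs: "set_integrable lborel {w..} g"
    unfolding set_integrable_def by (rule integrable_mult_indicator) (auto simp: gi)
  have "(LINT x:{w..}|lborel. std_normal_density x) \<le> (LINT x:{w..}|lborel. g x + x * std_normal_density x)"
  proof (rule set_integral_mono)
    show "set_integrable lborel {w..} (\<lambda>x. g x + x * std_normal_density x)"
      using gs m(1) by (rule set_integral_add)
    fix x assume "x \<in> {w..}"
    show "std_normal_density x \<le> g x + x * std_normal_density x"
    proof (cases "x \<le> w + 1")
      case True
      then show ?thesis using std_normal_density_antimono[of w x] assms \<open>x \<in> {w..}\<close>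
        by (simp add: g_def add_increasing2)
    next
      case False
      hence "1 \<le> x" using assms by simp
      hence "1 * std_normal_density x \<le> x * std_normal_density x" by (intro mult_right_mono) auto
      then show ?thesis by (simp add: g_def False)
    qed
  qed (auto intro: set_integrable_std_normal)
  also have "\<dots> = (LINT x:{w..}|lborel. g x) + std_normal_density w"
    using set_integral_add(2)[OF gs m(1)] m(2) by simp
  also have "(LINT x:{w..}|lborel. g x) = (\<integral>x. indicator {w..w+1} x * std_normal_density w \<partial>lborel)"
    unfolding set_lebesgue_integral_def by (rule Bochner_Integration.integral_cong) (auto simp: g_def indicator_def)
  also have "\<dots> = std_normal_density w" by simp
  finally show "(LINT x:{w..}|lborel. std_normal_density x) \<le> 2 * std_normal_density w" by simp
qed

lemma std_normal_lower_tail: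
  "(LINT x:{..w}|lborel. std_normal_density x) = (LINT x:{-w..}|lborel. std_normal_density x)"
proof -
  have "{x. - x \<in> {..w}} = {-w..}" by auto
  thus ?thesis by (subst set_integral_reflect) (simp del: mem_Collect_eq add: normal_density_def [abs_def] set_lebesgue_integral_def)
qed

text \<open>Splitting off the half-line below \<open>w - 1\<close> leaves a compact interval with
  \<open>w\<close> in its interior, where the usual fundamental theorem of calculus applies.\<close>

lemma lower_integral_has_derivative:
  fixes g :: "real \<Rightarrow> real"
  assumes "integrable lborel g" and "continuous_on UNIV g"
  shows "((\<lambda>w. LINT x:{..w}|lborel. g x) has_real_derivative g w) (at w)"
proof -
  have si: "set_integrable lborel A g" if "A \<in> sets borel" for A
    unfolding set_integrable_def by (rule integrable_mult_indicator) (use assms that in auto)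
  let ?a = "w - 1"
  let ?b = "w + 1"
  have "((\<lambda>u. (LINT x:{..<?a}|lborel. g x) + integral {?a..u} g) has_real_derivative 0 + g w) (at w within {?a..?b})"
    by (intro DERIV_add DERIV_const integral_has_real_derivative continuous_on_subset[OF assms(2)]) auto
  hence 1: "((\<lambda>u. (LINT x:{..<?a}|lborel. g x) + integral {?a..u} g) has_real_derivative g w) (at w)"
    using at_within_interior[of w "{?a..?b}"] by simp
  show ?thesis
  proof (rule has_field_derivative_transform_within[OF 1, of 1])
    fix u assume "dist u w < 1"
    hence u: "?a \<le> u" by (simp add: dist_real_def)
    hence "{..u} = {..<?a} \<union> {?a..u}" by auto
    hence "(LINT x:{..u}|lborel. g x) = (LINT x:{..<?a}|lborel. g x) + (LINT x:{?a..u}|lborel. g x)"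
      using set_integral_Un[of "{..<?a}" "{?a..u}" lborel g] si by (auto simp: ivl_disj_int)
    thus "(LINT x:{..<?a}|lborel. g x) + integral {?a..u} g = (LINT x:{..u}|lborel. g x)"
      using set_borel_integral_eq_integral(2)[OF si[of "{?a..u}"]] by simp
  qed auto
qed

section \<open>The Stein equation and its bounded solution\<close>

definition normal_mean :: "(real \<Rightarrow> real) \<Rightarrow> real" where
  "normal_mean h = (\<integral>x. std_normal_density x * h x \<partial>lborel)"

text \<open>Solves \<open>f' w - w * f w = h w - normal_mean h\<close>. Other solutions differ by
  multiples of the reciprocal density and are unbounded.\<close>

definition stein_solution :: "(real \<Rightarrow> real) \<Rightarrow> real \<Rightarrow> real" where
  "stein_solution h w =
    (LINT x:{..w}|lborel. std_normal_density x * (h x - normal_mean h)) / std_normal_density w"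

text \<open>Continuity of \<open>h\<close> makes the solution differentiable at every point, which
  the indicator of a half-line would not allow.\<close>

locale stein_test =
  fixes h :: "real \<Rightarrow> real"
  assumes cont: "continuous_on UNIV h" and range01: "0 \<le> h x" "h x \<le> 1"
begin

lemma integrable_test: "integrable lborel (\<lambda>x. std_normal_density x * h x)"
proof (rule Bochner_Integration.integrable_bound[OF integrable_std_normal])
  show "(\<lambda>x. std_normal_density x * h x) \<in> borel_measurable lborel"
    using borel_measurable_continuous_onI[OF cont] by auto
  show "AE x in lborel. norm (std_normal_density x * h x) \<le> norm (std_normal_density x)"
    using range01 by (simp add: abs_mult mult_left_le)
qed

lemma normal_mean_range: "0 \<le> normal_mean h" "normal_mean h \<le> 1"
proof -
  show "0 \<le> normal_mean h" unfolding normal_mean_def by (rule Bochner_Integration.integral_nonneg) (simp add: range01)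
  have "normal_mean h \<le> (\<integral>x. std_normal_density x \<partial>lborel)" unfolding normal_mean_def
    by (rule integral_mono[OF integrable_test integrable_std_normal]) (simp add: mult_left_le range01)
  thus "normal_mean h \<le> 1" by (simp add: integral_std_normal)
qed

lemma centred_le_1: "\<bar>h x - normal_mean h\<bar> \<le> 1"
  using range01[of x] normal_mean_range by linarith

definition weight :: "real \<Rightarrow> real" where
  "weight x = std_normal_density x * (h x - normal_mean h)"

lemma integrable_weight: "integrable lborel weight"
  unfolding weight_def [abs_def] right_diff_distrib
  by (intro Bochner_Integration.integrable_diff integrable_test integrable_mult_left integrable_std_normal)

lemma integral_weight: "(\<integral>x. weight x \<partial>lborel) = 0"
proof -
  have "(\<integral>x. weight x \<partial>lborel) = (\<integral>x. std_normal_density x * h x \<partial>lborel)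
      - (\<integral>x. std_normal_density x * normal_mean h \<partial>lborel)"
    unfolding weight_def [abs_def] right_diff_distrib
    by (intro Bochner_Integration.integral_diff integrable_test integrable_mult_left integrable_std_normal)
  thus ?thesis by (simp add: integral_std_normal normal_mean_def)
qed

lemma set_integrable_weight: "A \<in> sets borel \<Longrightarrow> set_integrable lborel A weight"
  unfolding set_integrable_def by (rule integrable_mult_indicator) (auto simp: integrable_weight)

lemma abs_set_integral_weight:
  assumes "A \<in> sets borel"
  shows "\<bar>LINT x:A|lborel. weight x\<bar> \<le> (LINT x:A|lborel. std_normal_density x)"
proof -
  have "\<bar>LINT x:A|lborel. weight x\<bar> \<le> (LINT x:A|lborel. \<bar>weight x\<bar>)"
    using set_integral_norm_bound[OF set_integrable_weight[OF assms]] by simp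
  also have "\<dots> \<le> (LINT x:A|lborel. std_normal_density x)"
    using set_integrable_abs[OF set_integrable_weight[OF assms]] set_integrable_std_normal[OF assms]
    by (rule set_integral_mono) (simp add: weight_def abs_mult mult_left_le centred_le_1)
  finally show ?thesis .
qed

text \<open>The weight has total integral zero, so for positive \<open>w\<close> the lower integral
  is minus the upper one. On either side of 0 a Gaussian tail beyond \<open>\<bar>w\<bar>\<close>
  remains.\<close>

lemma abs_lower_integral_weight:
  "\<bar>LINT x:{..w}|lborel. weight x\<bar> \<le> (LINT x:{\<bar>w\<bar>..}|lborel. std_normal_density x)"
proof (cases "w \<le> 0")
  case True
  thus ?thesis using abs_set_integral_weight[of "{..w}"] by (simp add: std_normal_lower_tail)
next
  case False
  have "(LINT x:UNIV|lborel. weight x) = (LINT x:{..<w}|lborel. weight x) + (LINT x:{w..}|lborel. weight x)"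
    using set_integral_Un[of "{..<w}" "{w..}" lborel weight] set_integrable_weight
    by (simp add: ivl_disj_int Un_commute flip: Compl_atLeast)
  moreover have "(LINT x:{..<w}|lborel. weight x) = (LINT x:{..w}|lborel. weight x)"
  proof (rule set_integral_null_delta)
    have "sym_diff {..<w} {..w} = {w}" by auto
    thus "sym_diff {..<w} {..w} \<in> null_sets lborel" by (simp add: finite_imp_null_set_lborel)
  qed (auto simp: integrable_weight)
  ultimately have "(LINT x:{..w}|lborel. weight x) = - (LINT x:{w..}|lborel. weight x)"
    using integral_weight by (simp add: set_lebesgue_integral_def)
  thus ?thesis using abs_set_integral_weight[of "{w..}"] False by simp
qed

text \<open>The constants 2 and 1 are those of the two Gaussian tail bounds, divided by the density
  at \<open>w\<close>.\<close>

lemma stein_solution_bounds: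
  "\<bar>stein_solution h w\<bar> \<le> 2" "\<bar>w * stein_solution h w\<bar> \<le> 1"
proof -
  have p: "std_normal_density w > 0" by (rule normal_density_pos) simp
  have s: "std_normal_density \<bar>w\<bar> = std_normal_density w" by (simp add: std_normal_density_def)
  have eq: "\<bar>stein_solution h w\<bar> * std_normal_density w = \<bar>LINT x:{..w}|lborel. weight x\<bar>"
    by (simp add: stein_solution_def weight_def [abs_def] abs_mult abs_divide p[THEN less_imp_neq, symmetric])
  have "\<bar>stein_solution h w\<bar> * std_normal_density w \<le> 2 * std_normal_density w"
    using eq abs_lower_integral_weight[of w] std_normal_tail_le(2)[of "\<bar>w\<bar>"] s by simp
  thus "\<bar>stein_solution h w\<bar> \<le> 2" using p by (meson mult_le_cancel_right_pos)
  have "\<bar>w\<bar> * (\<bar>stein_solution h w\<bar> * std_normal_density w) \<le> \<bar>w\<bar> * (LINT x:{\<bar>w\<bar>..}|lborel. std_normal_density x)"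
    using eq abs_lower_integral_weight[of w] by (intro mult_left_mono) auto
  also have "\<dots> \<le> 1 * std_normal_density w"
    using std_normal_tail_le(1)[of "\<bar>w\<bar>"] s by simp
  finally show "\<bar>w * stein_solution h w\<bar> \<le> 1" using p
    by (metis abs_mult mult.assoc mult_le_cancel_right_pos)
qed

text \<open>The value that the Stein equation prescribes for the derivative.\<close>

definition stein_deriv :: "real \<Rightarrow> real" where
  "stein_deriv w = w * stein_solution h w + h w - normal_mean h"

lemma stein_solution_has_derivative:
  "(stein_solution h has_real_derivative stein_deriv w) (at w)"
proof -
  have c: "continuous_on UNIV weight" unfolding weight_def [abs_def]
    by (intro continuous_intros cont continuous_on_std_normal_density)
  have p: "std_normal_density w \<noteq> 0" using normal_density_pos[of 1 0 w] by linarith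
  have "((\<lambda>w. (LINT x:{..w}|lborel. weight x) / std_normal_density w) has_real_derivative
     (weight w * std_normal_density w - (LINT x:{..w}|lborel. weight x) * (- w * std_normal_density w)) /
       (std_normal_density w * std_normal_density w)) (at w)"
    by (intro DERIV_divide lower_integral_has_derivative integrable_weight c
        std_normal_density_has_derivative p)
  moreover have "(\<lambda>w. (LINT x:{..w}|lborel. weight x) / std_normal_density w) = stein_solution h"
    by (simp add: fun_eq_iff stein_solution_def weight_def [abs_def])
  moreover have "(weight w * std_normal_density w - (LINT x:{..w}|lborel. weight x) * (- w * std_normal_density w)) /
       (std_normal_density w * std_normal_density w) = stein_deriv w"
    using p by (simp add: stein_deriv_def stein_solution_def weight_def [abs_def] field_simps)
  ultimately show ?thesis by simp
qed

lemma abs_stein_deriv_le: "\<bar>stein_deriv w\<bar> \<le> 2"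
  using stein_solution_bounds(2)[of w] centred_le_1[of w] unfolding stein_deriv_def by linarith

lemma stein_solution_diff: "\<bar>stein_solution h x - stein_solution h y\<bar> \<le> 2 * \<bar>x - y\<bar>"
  by (rule field_differentiable_bound[of UNIV "stein_solution h" stein_deriv 2 x y, simplified])
    (use stein_solution_has_derivative abs_stein_deriv_le in auto)

text \<open>The factor growing with \<open>\<bar>y\<bar>\<close> comes from the product
  \<open>w * stein_solution h w\<close>; it is why the normal approximation needs a bound on the
  first absolute moment of the sum. The oscillation of \<open>h\<close> is kept apart because for a
  ramp it vanishes away from the slope.\<close>

lemma stein_deriv_diff:
  "\<bar>stein_deriv x - stein_deriv y\<bar> \<le> \<bar>x - y\<bar> * (2 + 2 * \<bar>y\<bar>) + \<bar>h x - h y\<bar>"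
proof -
  have "stein_deriv x - stein_deriv y = (x - y) * stein_solution h x
      + y * (stein_solution h x - stein_solution h y) + (h x - h y)"
    by (simp add: stein_deriv_def algebra_simps)
  moreover have "\<bar>(x - y) * stein_solution h x\<bar> \<le> \<bar>x - y\<bar> * 2"
    unfolding abs_mult by (intro mult_left_mono stein_solution_bounds) auto
  moreover have "\<bar>y * (stein_solution h x - stein_solution h y)\<bar> \<le> \<bar>y\<bar> * (2 * \<bar>x - y\<bar>)"
    unfolding abs_mult by (intro mult_left_mono stein_solution_diff) auto
  moreover have "\<bar>x - y\<bar> * (2 + 2 * \<bar>y\<bar>) = \<bar>x - y\<bar> * 2 + \<bar>y\<bar> * (2 * \<bar>x - y\<bar>)"
    by (simp add: algebra_simps)
  ultimately show ?thesis by linarith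
qed

text \<open>Mean value inequality for the solution minus its linear part at \<open>w\<close>. Since
  \<open>h\<close> need not be differentiable, a second-order expansion is replaced by the
  oscillation of the first derivative.\<close>

lemma stein_taylor:
  assumes osc: "\<And>u. \<bar>u - w\<bar> \<le> \<bar>t\<bar> \<Longrightarrow> \<bar>h u - h w\<bar> \<le> q"
  shows "\<bar>stein_solution h w - stein_solution h (w - t) - t * stein_deriv w\<bar>
     \<le> \<bar>t\<bar> * (\<bar>t\<bar> * (2 + 2 * \<bar>w\<bar>) + q)"
proof -
  have "\<bar>(\<lambda>u. stein_solution h u - u * stein_deriv w) w - (\<lambda>u. stein_solution h u - u * stein_deriv w) (w - t)\<bar>
      \<le> (\<bar>t\<bar> * (2 + 2 * \<bar>w\<bar>) + q) * \<bar>w - (w - t)\<bar>"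
  proof (rule field_differentiable_bound[where S="cball w \<bar>t\<bar>" and f'="\<lambda>u. stein_deriv u - stein_deriv w", unfolded real_norm_def])
    fix u assume "u \<in> cball w \<bar>t\<bar>"
    hence u: "\<bar>u - w\<bar> \<le> \<bar>t\<bar>" by (simp add: dist_real_def)
    show "((\<lambda>u. stein_solution h u - u * stein_deriv w) has_real_derivative stein_deriv u - stein_deriv w) (at u within cball w \<bar>t\<bar>)"
      by (rule derivative_eq_intros has_field_derivative_at_within[OF stein_solution_has_derivative] refl)+ simp
    show "\<bar>stein_deriv u - stein_deriv w\<bar> \<le> \<bar>t\<bar> * (2 + 2 * \<bar>w\<bar>) + q"
      using stein_deriv_diff[of u w] osc[OF u] mult_right_mono[OF u, of "2 + 2 * \<bar>w\<bar>"] by simp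
  qed (auto simp: dist_real_def)
  thus ?thesis by (simp add: algebra_simps)
qed

end

section \<open>Ramps as continuous substitutes for half-lines\<close>

definition ramp :: "real \<Rightarrow> real \<Rightarrow> real \<Rightarrow> real" where
  "ramp z \<alpha> w = max 0 (min 1 ((z + \<alpha> - w) / \<alpha>))"

lemma stein_test_ramp: "\<alpha> > 0 \<Longrightarrow> stein_test (ramp z \<alpha>)"
  by standard (auto simp: ramp_def [abs_def] intro!: continuous_intros)

lemma ramp_left: "\<alpha> > 0 \<Longrightarrow> w \<le> z \<Longrightarrow> ramp z \<alpha> w = 1"
  by (simp add: ramp_def)

lemma ramp_right: "\<alpha> > 0 \<Longrightarrow> z + \<alpha> \<le> w \<Longrightarrow> ramp z \<alpha> w = 0"
  by (simp add: ramp_def divide_nonpos_pos)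

text \<open>If \<open>w\<close> lies outside the slope widened by \<open>a\<close>, then
  \<open>u\<close> and \<open>w\<close> lie on the same flat side. Otherwise the slope
  \<open>1 / \<alpha>\<close> gives the bound.\<close>

lemma ramp_oscillation:
  assumes "\<alpha> > 0" "\<bar>u - w\<bar> \<le> s" "s \<le> a"
  shows "\<bar>ramp z \<alpha> u - ramp z \<alpha> w\<bar> \<le> s / \<alpha> * indicator {z - a .. z + \<alpha> + a} w"
proof (cases "w \<in> {z - a .. z + \<alpha> + a}")
  case True
  have "\<bar>ramp z \<alpha> u - ramp z \<alpha> w\<bar> \<le> \<bar>(z + \<alpha> - u) / \<alpha> - (z + \<alpha> - w) / \<alpha>\<bar>"
    unfolding ramp_def by (simp add: max_def min_def)
  also have "\<dots> = \<bar>u - w\<bar> / \<alpha>" using assms(1) by (simp add: abs_minus_commute flip: diff_divide_distrib)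
  also have "\<dots> \<le> s / \<alpha>" using assms by (intro divide_right_mono) auto
  finally show ?thesis using True by simp
next
  case False
  hence "w < z - a \<or> w > z + \<alpha> + a" by auto
  thus ?thesis using assms ramp_left[of \<alpha> _ z] ramp_right[of \<alpha> z] by (cases "w < z - a") auto
qed

lemma cdf_std_normal: "cdf std_normal_distribution z = (LINT x:{..z}|lborel. std_normal_density x)"
proof -
  have "emeasure std_normal_distribution {..z} = (\<integral>\<^sup>+x. ennreal (indicator {..z} x * std_normal_density x) \<partial>lborel)"
    by (simp add: emeasure_density) (auto intro!: nn_integral_cong simp: indicator_def)
  also have "\<dots> = ennreal (LINT x:{..z}|lborel. std_normal_density x)"
    unfolding set_lebesgue_integral_def using set_integrable_std_normal[of "{..z}"]
    by (subst nn_integral_eq_integral) (auto simp: set_integrable_def)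
  finally show ?thesis
    by (simp add: cdf_def measure_def set_lebesgue_integral_def integral_nonneg)
qed

lemma cdf_std_normal_lipschitz:
  assumes "z \<le> w"
  shows "cdf std_normal_distribution w \<le> cdf std_normal_distribution z + (w - z)"
proof -
  have "cdf std_normal_distribution w - cdf std_normal_distribution z = (LINT x:{z<..w}|lborel. std_normal_density x)"
    using set_integral_Un[of "{..z}" "{z<..w}" lborel std_normal_density] set_integrable_std_normal assms
    by (simp add: cdf_std_normal ivl_disj_un ivl_disj_int)
  also have "\<dots> \<le> (LINT x:{z<..w}|lborel. 1)"
    by (rule set_integral_mono[OF set_integrable_std_normal])
      (use assms in \<open>auto simp: std_normal_density_le_1 set_integrable_def\<close>)
  also have "\<dots> = w - z" using assms by (simp add: set_lebesgue_integral_def)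
  finally show ?thesis by simp
qed

text \<open>The ramp lies between the indicators of \<open>{..z}\<close> and
  \<open>{..z + \<alpha>}\<close>.\<close>

lemma normal_mean_ramp:
  assumes "\<alpha> > 0"
  shows "cdf std_normal_distribution z \<le> normal_mean (ramp z \<alpha>)"
    and "normal_mean (ramp z \<alpha>) \<le> cdf std_normal_distribution (z + \<alpha>)"
proof -
  interpret stein_test "ramp z \<alpha>" by (rule stein_test_ramp[OF assms])
  have i: "integrable lborel (\<lambda>x. indicator {..w} x * std_normal_density x)" for w :: real
    using set_integrable_std_normal[of "{..w}"] by (simp add: set_integrable_def)
  show "cdf std_normal_distribution z \<le> normal_mean (ramp z \<alpha>)"
    unfolding cdf_std_normal normal_mean_def set_lebesgue_integral_def
    using i integrable_test
    by (simp, intro integral_mono) (auto simp: indicator_def range01 ramp_left[OF assms])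
  show "normal_mean (ramp z \<alpha>) \<le> cdf std_normal_distribution (z + \<alpha>)"
    unfolding cdf_std_normal normal_mean_def set_lebesgue_integral_def
    using i integrable_test
    by (simp, intro integral_mono) (auto simp: indicator_def range01 ramp_right[OF assms] mult_left_le)
qed

section \<open>Normal approximation under local dependence\<close>

context prob_space
begin

text \<open>Here \<open>e1\<close> measures how far \<open>\<xi> i\<close> is from being centred and
  independent of \<open>W - \<eta> i\<close>, while \<open>e2\<close> combines the error of the
  variance normalisation with the fluctuation of the quadratic sum. The last summand is the Taylor
  remainder, with \<open>\<kappa>\<close> in the role of the third-moment sum.\<close>

lemma stein_one_step:
  fixes \<xi> :: "'i \<Rightarrow> 'a \<Rightarrow> real" and N :: "'i \<Rightarrow> 'i set" and I :: "'i set" and b :: real and D :: nat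
  defines "W \<equiv> (\<lambda>x. \<Sum>i\<in>I. \<xi> i x)" and "\<eta> \<equiv> (\<lambda>i x. \<Sum>j\<in>N i. \<xi> j x)"
  defines "\<kappa> \<equiv> real (card I) * (b * (b * real D)\<^sup>2)"
  assumes fin: "finite I" and N: "\<And>i. i \<in> I \<Longrightarrow> N i \<subseteq> I" and card: "\<And>i. i \<in> I \<Longrightarrow> card (N i) \<le> D"
    and meas: "\<And>i. i \<in> I \<Longrightarrow> \<xi> i \<in> borel_measurable M"
    and bnd: "\<And>i x. i \<in> I \<Longrightarrow> \<bar>\<xi> i x\<bar> \<le> b" and b: "0 \<le> b"
    and dec: "\<And>i g. i \<in> I \<Longrightarrow> g \<in> borel_measurable borel \<Longrightarrow> (\<And>w. \<bar>g w\<bar> \<le> 1) \<Longrightarrow>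
        \<bar>expectation (\<lambda>x. \<xi> i x * g (W x - \<eta> i x))\<bar> \<le> e1"
    and var: "expectation (\<lambda>x. \<bar>1 - (\<Sum>i\<in>I. \<xi> i x * \<eta> i x)\<bar>) \<le> e2"
    and mom: "expectation (\<lambda>x. \<bar>W x\<bar>) \<le> w" and \<alpha>: "\<alpha> > 0"
  shows "\<bar>expectation (\<lambda>x. ramp z \<alpha> (W x)) - normal_mean (ramp z \<alpha>)\<bar>
    \<le> 2 * real (card I) * e1 + 2 * e2
      + \<kappa> * (2 + 2 * w + prob {x \<in> space M. W x \<in> {z - b * real D .. z + \<alpha> + b * real D}} / \<alpha>)"
proof -
  interpret stein_test "ramp z \<alpha>" by (rule stein_test_ramp[OF \<alpha>])
  let ?h = "ramp z \<alpha>" and ?f = "stein_solution (ramp z \<alpha>)" and ?a = "b * real D"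
  let ?J = "{z - ?a .. z + \<alpha> + ?a}"
  define V where "V x = (\<Sum>i\<in>I. \<xi> i x * \<eta> i x)" for x
  define G where "G x = (\<Sum>i\<in>I. \<xi> i x * ?f (W x - \<eta> i x))" for x
  have finN: "finite (N i)" if "i \<in> I" for i using N[OF that] fin finite_subset by blast
  have mW [measurable]: "W \<in> borel_measurable M" unfolding W_def using meas by measurable
  have m\<eta>: "\<eta> i \<in> borel_measurable M" if "i \<in> I" for i
    unfolding \<eta>_def using meas N[OF that] by (intro borel_measurable_sum) auto
  have mV [measurable]: "V \<in> borel_measurable M"
    unfolding V_def using meas m\<eta> by (intro borel_measurable_sum borel_measurable_times) auto
  have mf [measurable]: "?f \<in> borel_measurable borel"
    by (rule borel_measurable_continuous_onI, rule DERIV_continuous_on, rule has_field_derivative_at_within,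
        rule stein_solution_has_derivative)
  have mh [measurable]: "?h \<in> borel_measurable borel"
    by (rule borel_measurable_continuous_onI[OF cont])
  have md [measurable]: "stein_deriv \<in> borel_measurable borel"
    unfolding stein_deriv_def [abs_def] by measurable
  have mG [measurable]: "G \<in> borel_measurable M"
    unfolding G_def using meas m\<eta>
    by (intro borel_measurable_sum borel_measurable_times measurable_compose[OF _ mf] borel_measurable_diff mW) auto
  have b\<eta>: "\<bar>\<eta> i x\<bar> \<le> ?a" if "i \<in> I" for i x
  proof -
    have "\<bar>\<eta> i x\<bar> \<le> (\<Sum>j\<in>N i. \<bar>\<xi> j x\<bar>)" unfolding \<eta>_def by (rule sum_abs)
    also have "\<dots> \<le> real (card (N i)) * b" using bnd N[OF that] by (intro sum_bounded_above) auto
    also have "\<dots> \<le> real D * b" using card[OF that] b by (intro mult_right_mono) auto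
    finally show ?thesis by (simp add: mult.commute)
  qed
  have bW: "\<bar>W x\<bar> \<le> real (card I) * b" for x
  proof -
    have "\<bar>W x\<bar> \<le> (\<Sum>j\<in>I. \<bar>\<xi> j x\<bar>)" unfolding W_def by (rule sum_abs)
    also have "\<dots> \<le> real (card I) * b" using bnd by (intro sum_bounded_above) auto
    finally show ?thesis .
  qed
  have bV: "\<bar>V x\<bar> \<le> real (card I) * (b * ?a)" for x
  proof -
    have "\<bar>V x\<bar> \<le> (\<Sum>i\<in>I. \<bar>\<xi> i x * \<eta> i x\<bar>)" unfolding V_def by (rule sum_abs)
    also have "\<dots> \<le> real (card I) * (b * ?a)" using bnd b b\<eta>
      by (intro sum_bounded_above) (auto simp: abs_mult intro!: mult_mono)
    finally show ?thesis .
  qed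
  have bG: "\<bar>G x\<bar> \<le> real (card I) * (b * 2)" for x
  proof -
    have "\<bar>G x\<bar> \<le> (\<Sum>i\<in>I. \<bar>\<xi> i x * ?f (W x - \<eta> i x)\<bar>)" unfolding G_def by (rule sum_abs)
    also have "\<dots> \<le> real (card I) * (b * 2)" using bnd b stein_solution_bounds(1)
      by (intro sum_bounded_above) (auto simp: abs_mult intro!: mult_mono)
    finally show ?thesis .
  qed
  have iW: "integrable M (\<lambda>x. \<bar>W x\<bar>)"
    by (rule integrable_const_bound[of _ "real (card I) * b"]) (use bW in auto)
  have iG: "integrable M G"
    by (rule integrable_const_bound[of _ "real (card I) * (b * 2)"]) (use bG in auto)
  have iV: "integrable M V"
    by (rule integrable_const_bound[of _ "real (card I) * (b * ?a)"]) (use bV in auto)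
  have ih: "integrable M (\<lambda>x. ?h (W x))"
    by (rule integrable_const_bound[of _ 1]) (use range01 in auto)
  have idV: "integrable M (\<lambda>x. stein_deriv (W x) * (1 - V x))"
  proof (rule integrable_const_bound[of _ "2 * (1 + real (card I) * (b * ?a))"])
    have "\<bar>stein_deriv (W x)\<bar> * \<bar>1 - V x\<bar> \<le> 2 * (1 + real (card I) * (b * ?a))" for x
      using bV[of x] by (intro mult_mono abs_stein_deriv_le) auto
    thus "AE x in M. norm (stein_deriv (W x) * (1 - V x)) \<le> 2 * (1 + real (card I) * (b * ?a))"
      by (simp add: abs_mult)
  qed measurable
  have iJ: "integrable M (\<lambda>x. indicator ?J (W x) :: real)"
    by (rule integrable_const_bound[of _ 1]) auto
  \<comment> \<open>Pointwise, the Stein equation turns the left side into minus the sum of the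
    Taylor remainders weighted by \<open>\<xi> i\<close>. The two correction terms are estimated
    separately in expectation.\<close>
  have pw: "\<bar>(?h (W x) - normal_mean ?h) - stein_deriv (W x) * (1 - V x) + G x\<bar>
     \<le> \<kappa> * (2 + 2 * \<bar>W x\<bar> + indicator ?J (W x) / \<alpha>)" for x
  proof -
    let ?R = "\<lambda>i. ?f (W x) - ?f (W x - \<eta> i x) - \<eta> i x * stein_deriv (W x)"
    have "W x * ?f (W x) = (\<Sum>i\<in>I. \<xi> i x * ?f (W x))" by (simp add: W_def sum_distrib_right)
    moreover have "V x * stein_deriv (W x) = (\<Sum>i\<in>I. \<xi> i x * \<eta> i x * stein_deriv (W x))"
      by (simp add: V_def sum_distrib_right)
    ultimately have "(\<Sum>i\<in>I. \<xi> i x * ?R i) = W x * ?f (W x) - G x - V x * stein_deriv (W x)"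
      by (simp only: G_def right_diff_distrib sum_subtractf mult.assoc)
    moreover have "?h (W x) - normal_mean ?h = stein_deriv (W x) - W x * ?f (W x)"
      by (simp add: stein_deriv_def)
    moreover have "s = p - g - v * d \<Longrightarrow> h = d - p \<Longrightarrow> h - d * (1 - v) + g = - s" for s p g v d h :: real
      by (simp add: algebra_simps)
    ultimately have "(?h (W x) - normal_mean ?h) - stein_deriv (W x) * (1 - V x) + G x = - (\<Sum>i\<in>I. \<xi> i x * ?R i)"
      by blast
    hence "\<bar>(?h (W x) - normal_mean ?h) - stein_deriv (W x) * (1 - V x) + G x\<bar>
        = \<bar>\<Sum>i\<in>I. \<xi> i x * ?R i\<bar>" by (simp only: abs_minus_cancel)
    also have "\<dots> \<le> (\<Sum>i\<in>I. \<bar>\<xi> i x * ?R i\<bar>)" by (rule sum_abs)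
    also have "\<dots> \<le> real (card I) * ((b * ?a\<^sup>2) * (2 + 2 * \<bar>W x\<bar> + indicator ?J (W x) / \<alpha>))"
    proof (rule sum_bounded_above)
      fix i assume i: "i \<in> I"
      let ?t = "\<bar>\<eta> i x\<bar>"
      have "\<bar>?R i\<bar> \<le> ?t * (?t * (2 + 2 * \<bar>W x\<bar>) + ?t / \<alpha> * indicator ?J (W x))"
        by (rule stein_taylor) (rule ramp_oscillation[OF \<alpha> _ b\<eta>[OF i]])
      also have "\<dots> = ?t\<^sup>2 * (2 + 2 * \<bar>W x\<bar> + indicator ?J (W x) / \<alpha>)"
        by (simp add: algebra_simps power2_eq_square)
      also have "\<dots> \<le> ?a\<^sup>2 * (2 + 2 * \<bar>W x\<bar> + indicator ?J (W x) / \<alpha>)"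
        using \<alpha> by (intro mult_right_mono power_mono b\<eta> i) (auto simp: add_nonneg_nonneg)
      finally have "\<bar>\<xi> i x\<bar> * \<bar>?R i\<bar> \<le> b * (?a\<^sup>2 * (2 + 2 * \<bar>W x\<bar> + indicator ?J (W x) / \<alpha>))"
        by (intro mult_mono bnd i b) auto
      thus "\<bar>\<xi> i x * ?R i\<bar> \<le> (b * ?a\<^sup>2) * (2 + 2 * \<bar>W x\<bar> + indicator ?J (W x) / \<alpha>)"
        by (simp add: abs_mult mult.assoc)
    qed
    finally show ?thesis by (simp add: \<kappa>_def mult.assoc)
  qed
  have irhs: "integrable M (\<lambda>x. \<kappa> * (2 + 2 * \<bar>W x\<bar> + indicator ?J (W x) / \<alpha>))"
    using iW iJ by simp
  have ilhs: "integrable M (\<lambda>x. (?h (W x) - normal_mean ?h) - stein_deriv (W x) * (1 - V x) + G x)"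
    using ih idV iG by simp
  have "\<bar>expectation (\<lambda>x. (?h (W x) - normal_mean ?h) - stein_deriv (W x) * (1 - V x) + G x)\<bar>
     \<le> expectation (\<lambda>x. \<kappa> * (2 + 2 * \<bar>W x\<bar> + indicator ?J (W x) / \<alpha>))"
    by (rule order_trans[OF integral_abs_bound integral_mono[OF integrable_abs[OF ilhs] irhs]]) (rule pw)
  also have "\<dots> = \<kappa> * (2 + 2 * expectation (\<lambda>x. \<bar>W x\<bar>) + expectation (\<lambda>x. indicator ?J (W x)) / \<alpha>)"
    using iW iJ by (simp add: prob_space)
  also have EJ: "expectation (\<lambda>x. indicator ?J (W x)) = prob {x \<in> space M. W x \<in> ?J}"
  proof -
    have "expectation (\<lambda>x. indicator ?J (W x)) = expectation (indicator {x \<in> space M. W x \<in> ?J})"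
      by (rule Bochner_Integration.integral_cong) (auto simp: indicator_def)
    also have "\<dots> = prob {x \<in> space M. W x \<in> ?J}" by simp
    finally show ?thesis .
  qed
  also have "\<kappa> * (2 + 2 * expectation (\<lambda>x. \<bar>W x\<bar>) + prob {x \<in> space M. W x \<in> ?J} / \<alpha>)
     \<le> \<kappa> * (2 + 2 * w + prob {x \<in> space M. W x \<in> ?J} / \<alpha>)"
    using mom b by (intro mult_left_mono) (auto simp: \<kappa>_def)
  finally have A: "\<bar>expectation (\<lambda>x. (?h (W x) - normal_mean ?h) - stein_deriv (W x) * (1 - V x) + G x)\<bar> \<le> \<dots>" .
  have E: "expectation (\<lambda>x. (?h (W x) - normal_mean ?h) - stein_deriv (W x) * (1 - V x) + G x)
     = expectation (\<lambda>x. ?h (W x)) - normal_mean ?h - expectation (\<lambda>x. stein_deriv (W x) * (1 - V x)) + expectation G"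
    using ih idV iG by (simp add: prob_space)
  have B: "\<bar>expectation (\<lambda>x. stein_deriv (W x) * (1 - V x))\<bar> \<le> 2 * e2"
  proof -
    have "\<bar>expectation (\<lambda>x. stein_deriv (W x) * (1 - V x))\<bar> \<le> expectation (\<lambda>x. \<bar>stein_deriv (W x) * (1 - V x)\<bar>)"
      by (rule integral_abs_bound)
    also have "\<dots> \<le> expectation (\<lambda>x. 2 * \<bar>1 - V x\<bar>)"
      using integrable_abs[OF idV] iV by (intro integral_mono) (auto simp: abs_mult intro!: mult_right_mono abs_stein_deriv_le)
    also have "\<dots> \<le> 2 * e2" using var by (simp add: V_def)
    finally show ?thesis .
  qed
  have C: "\<bar>expectation G\<bar> \<le> real (card I) * (2 * e1)"
  proof -
    have i: "integrable M (\<lambda>x. \<xi> i x * ?f (W x - \<eta> i x))" if "i \<in> I" for i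
    proof (rule integrable_const_bound[of _ "b * 2"])
      show "AE x in M. norm (\<xi> i x * ?f (W x - \<eta> i x)) \<le> b * 2"
        using bnd[OF that] b stein_solution_bounds(1) by (auto simp: abs_mult intro!: mult_mono)
      show "(\<lambda>x. \<xi> i x * ?f (W x - \<eta> i x)) \<in> borel_measurable M"
        using meas[OF that] m\<eta>[OF that] by measurable
    qed
    have "expectation G = (\<Sum>i\<in>I. expectation (\<lambda>x. \<xi> i x * ?f (W x - \<eta> i x)))"
      unfolding G_def using i by (rule Bochner_Integration.integral_sum)
    hence "\<bar>expectation G\<bar> = \<bar>\<Sum>i\<in>I. expectation (\<lambda>x. \<xi> i x * ?f (W x - \<eta> i x))\<bar>" by (simp only:)
    also have "\<dots> \<le> (\<Sum>i\<in>I. \<bar>expectation (\<lambda>x. \<xi> i x * ?f (W x - \<eta> i x))\<bar>)" by (rule sum_abs)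
    also have "\<dots> \<le> real (card I) * (2 * e1)"
    proof (rule sum_bounded_above)
      fix i assume i: "i \<in> I"
      \<comment> \<open>Test functions in \<open>dec\<close> are bounded by 1, the Stein solution by
        2.\<close>
      have "\<bar>expectation (\<lambda>x. \<xi> i x * (?f (W x - \<eta> i x) / 2))\<bar> \<le> e1"
        using stein_solution_bounds(1) by (intro dec[OF i, of "\<lambda>u. ?f u / 2"]) auto
      thus "\<bar>expectation (\<lambda>x. \<xi> i x * ?f (W x - \<eta> i x))\<bar> \<le> 2 * e1" by simp
    qed
    finally show ?thesis .
  qed
  show ?thesis using A B C unfolding E by linarith
qed

theorem berry_esseen_local_dependence:
  fixes \<xi> :: "'i \<Rightarrow> 'a \<Rightarrow> real" and N :: "'i \<Rightarrow> 'i set" and I :: "'i set" and b :: real and D :: nat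
  defines "W \<equiv> (\<lambda>x. \<Sum>i\<in>I. \<xi> i x)" and "\<eta> \<equiv> (\<lambda>i x. \<Sum>j\<in>N i. \<xi> j x)"
  assumes fin: "finite I" and N: "\<And>i. i \<in> I \<Longrightarrow> N i \<subseteq> I" and card: "\<And>i. i \<in> I \<Longrightarrow> card (N i) \<le> D"
    and meas: "\<And>i. i \<in> I \<Longrightarrow> \<xi> i \<in> borel_measurable M"
    and bnd: "\<And>i x. i \<in> I \<Longrightarrow> \<bar>\<xi> i x\<bar> \<le> b" and b: "0 < b" and D: "1 \<le> D"
    and dec: "\<And>i g. i \<in> I \<Longrightarrow> g \<in> borel_measurable borel \<Longrightarrow> (\<And>w. \<bar>g w\<bar> \<le> 1) \<Longrightarrow>
        \<bar>expectation (\<lambda>x. \<xi> i x * g (W x - \<eta> i x))\<bar> \<le> e1"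
    and var: "expectation (\<lambda>x. \<bar>1 - (\<Sum>i\<in>I. \<xi> i x * \<eta> i x)\<bar>) \<le> e2"
    and mom: "expectation (\<lambda>x. \<bar>W x\<bar>) \<le> w"
  shows "\<bar>prob {x \<in> space M. W x \<le> z} - cdf std_normal_distribution z\<bar>
    \<le> 16 * (real (card I) * b ^ 3 * (real D)\<^sup>2 * (1 + w) + b * real D + real (card I) * e1 + e2)"
proof -
  define F where "F z = prob {x \<in> space M. W x \<le> z}" for z
  let ?\<Phi> = "cdf std_normal_distribution"
  define \<kappa> where "\<kappa> = real (card I) * (b * (b * real D)\<^sup>2)"
  define \<alpha> where "\<alpha> = 4 * \<kappa> + b" \<comment> \<open>so that the term \<open>2 * \<delta> * \<kappa> / \<alpha>\<close> below is absorbed on the left\<close>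
  let ?a = "b * real D"
  let ?E0 = "2 * real (card I) * e1 + 2 * e2 + \<kappa> * (2 + 2 * w)"
  have \<kappa>: "0 \<le> \<kappa>" using b by (simp add: \<kappa>_def)
  have \<alpha>: "\<alpha> > 0" using b \<kappa> by (simp add: \<alpha>_def)
  have q: "\<kappa> / \<alpha> \<le> 1 / 4" using b \<kappa> by (simp add: \<alpha>_def field_simps)
  have mW [measurable]: "W \<in> borel_measurable M" unfolding W_def using meas by measurable
  interpret N: prob_space std_normal_distribution
    by (rule prob_space_normal_density) simp
  have \<Phi>: "0 \<le> ?\<Phi> z" "?\<Phi> z \<le> 1" for z by (auto simp: cdf_def N.prob_le_1)
  have b1: "\<bar>F z - ?\<Phi> z\<bar> \<le> 1" for z
    using \<Phi>[of z] prob_le_1[of "{x \<in> space M. W x \<le> z}"]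
      measure_nonneg[of M "{x \<in> space M. W x \<le> z}"] unfolding F_def by linarith
  \<comment> \<open>Finite, since every deviation is at most 1; only so can the final inequality,
    with \<open>\<delta> / 2\<close> on its right, be solved for \<open>\<delta>\<close>.\<close>
  define \<delta> where "\<delta> = (SUP z. \<bar>F z - ?\<Phi> z\<bar>)"
  have bdd: "bdd_above (range (\<lambda>z. \<bar>F z - ?\<Phi> z\<bar>))" using b1 by (auto intro!: bdd_aboveI2)
  have \<delta>: "\<bar>F z - ?\<Phi> z\<bar> \<le> \<delta>" for z unfolding \<delta>_def by (rule cSUP_upper[OF _ bdd]) simp
  have step: "\<bar>expectation (\<lambda>x. ramp z \<alpha> (W x)) - normal_mean (ramp z \<alpha>)\<bar>
      \<le> ?E0 + (2 * \<kappa> + ?a / 2 + \<delta> / 2)" for z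
  proof -
    \<comment> \<open>The left end is moved by a further \<open>\<alpha>\<close>: subtracting
      \<open>F\<close> at the original left end would lose an atom of \<open>W\<close>
      there.\<close>
    have "prob {x \<in> space M. W x \<in> {z - ?a .. z + \<alpha> + ?a}}
        \<le> prob ({x \<in> space M. W x \<le> z + \<alpha> + ?a} - {x \<in> space M. W x \<le> z - ?a - \<alpha>})"
      using \<alpha> by (intro finite_measure_mono) auto
    also have "\<dots> = F (z + \<alpha> + ?a) - F (z - ?a - \<alpha>)" unfolding F_def
      using \<alpha> b by (intro finite_measure_Diff) (auto intro: order_trans)
    also have "\<dots> \<le> ?\<Phi> (z + \<alpha> + ?a) - ?\<Phi> (z - ?a - \<alpha>) + 2 * \<delta>"
      using \<delta>[of "z + \<alpha> + ?a"] \<delta>[of "z - ?a - \<alpha>"] by linarith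
    also have "\<dots> \<le> 2 * \<alpha> + 2 * ?a + 2 * \<delta>"
      using cdf_std_normal_lipschitz[of "z - ?a - \<alpha>" "z + \<alpha> + ?a"] \<alpha> b by simp
    finally have "\<kappa> * (prob {x \<in> space M. W x \<in> {z - ?a .. z + \<alpha> + ?a}} / \<alpha>) \<le> \<kappa> * ((2 * \<alpha> + 2 * ?a + 2 * \<delta>) / \<alpha>)"
      using \<kappa> \<alpha> by (intro mult_left_mono divide_right_mono) auto
    also have "\<dots> = 2 * \<kappa> + (\<kappa> / \<alpha>) * (2 * ?a + 2 * \<delta>)" using \<alpha> by (simp add: field_simps)
    also have "\<dots> \<le> 2 * \<kappa> + (1 / 4) * (2 * ?a + 2 * \<delta>)"
      using q b \<delta>[of 0] by (intro add_left_mono mult_right_mono) auto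
    also have "\<dots> = 2 * \<kappa> + ?a / 2 + \<delta> / 2" by (simp add: field_simps)
    finally have "\<kappa> * (prob {x \<in> space M. W x \<in> {z - ?a .. z + \<alpha> + ?a}} / \<alpha>) \<le> 2 * \<kappa> + ?a / 2 + \<delta> / 2" .
    moreover have "\<bar>expectation (\<lambda>x. ramp z \<alpha> (W x)) - normal_mean (ramp z \<alpha>)\<bar>
      \<le> 2 * real (card I) * e1 + 2 * e2
      + \<kappa> * (2 + 2 * w + prob {x \<in> space M. W x \<in> {z - ?a .. z + \<alpha> + ?a}} / \<alpha>)"
      unfolding \<kappa>_def W_def
      by (rule stein_one_step[OF fin N card meas bnd less_imp_le[OF b] dec[unfolded W_def \<eta>_def] var[unfolded \<eta>_def] mom[unfolded W_def] \<alpha>]) auto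
    ultimately show ?thesis by (simp add: distrib_left)
  qed
  have ih: "integrable M (\<lambda>x. ramp z \<alpha> (W x))" for z
  proof -
    interpret stein_test "ramp z \<alpha>" by (rule stein_test_ramp[OF \<alpha>])
    show ?thesis using borel_measurable_continuous_onI[OF cont]
      by (intro integrable_const_bound[of _ 1]) (auto simp: range01)
  qed
  have iI: "integrable M (indicator {x \<in> space M. W x \<le> z} :: 'a \<Rightarrow> real)" for z
    by (rule integrable_const_bound[of _ 1]) auto
  have FI: "F z = expectation (indicator {x \<in> space M. W x \<le> z})" for z by (simp add: F_def)
  have up: "F z \<le> expectation (\<lambda>x. ramp z \<alpha> (W x))" for z
  proof -
    interpret stein_test "ramp z \<alpha>" by (rule stein_test_ramp[OF \<alpha>])
    show ?thesis unfolding FI using ih iI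
      by (intro integral_mono) (auto simp: indicator_def ramp_left[OF \<alpha>] range01)
  qed
  have lo: "expectation (\<lambda>x. ramp (z - \<alpha>) \<alpha> (W x)) \<le> F z" for z
  proof -
    interpret stein_test "ramp (z - \<alpha>) \<alpha>" by (rule stein_test_ramp[OF \<alpha>])
    show ?thesis unfolding FI using ih iI
      by (intro integral_mono) (auto simp: indicator_def ramp_right[OF \<alpha>] range01)
  qed
  \<comment> \<open>The ramps starting at \<open>z\<close> and at \<open>z - \<alpha>\<close> lie
    above and below the indicator of \<open>{..z}\<close>; shifting the threshold by
    \<open>\<alpha>\<close> changes the normal distribution function by at most
    \<open>\<alpha>\<close>.\<close>
  have main: "\<bar>F z - ?\<Phi> z\<bar> \<le> \<alpha> + ?E0 + (2 * \<kappa> + ?a / 2 + \<delta> / 2)" for z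
  proof -
    have "F z \<le> ?\<Phi> z + \<alpha> + ?E0 + (2 * \<kappa> + ?a / 2 + \<delta> / 2)"
      using up[of z] step[of z] normal_mean_ramp(2)[OF \<alpha>, of z] cdf_std_normal_lipschitz[of z "z + \<alpha>"] \<alpha>
      by linarith
    moreover have "?\<Phi> z - \<alpha> - ?E0 - (2 * \<kappa> + ?a / 2 + \<delta> / 2) \<le> F z"
      using lo[of z] step[of "z - \<alpha>"] normal_mean_ramp(1)[OF \<alpha>, of "z - \<alpha>"] cdf_std_normal_lipschitz[of "z - \<alpha>" z] \<alpha>
      by linarith
    ultimately show ?thesis by linarith
  qed
  have "\<delta> \<le> \<alpha> + ?E0 + (2 * \<kappa> + ?a / 2 + \<delta> / 2)" unfolding \<delta>_def
    by (rule cSUP_least) (use main in \<open>auto simp: \<delta>_def\<close>)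
  moreover have "d \<le> s + e + (k + c + d / 2) \<Longrightarrow> d \<le> 2 * (s + e + k + c)" for d s e k c :: real
    by simp
  ultimately have "\<delta> \<le> 2 * (\<alpha> + ?E0 + 2 * \<kappa> + ?a / 2)" by blast
  also have "\<dots> \<le> 16 * (\<kappa> * (1 + w) + ?a + real (card I) * e1 + e2)"
  proof -
    \<comment> \<open>Each of \<open>w\<close>, \<open>e1\<close> and \<open>e2\<close> bounds a
      nonnegative quantity; for \<open>e1\<close>, with \<open>I\<close> nonempty, the zero test
      function shows this.\<close>
    have w: "0 \<le> w" using mom by (rule order_trans[rotated]) (simp add: integral_nonneg)
    have f1: "?a \<ge> b" using b D by simp
    have f2: "0 \<le> \<kappa> * w" using \<kappa> w by simp
    have f3: "0 \<le> e2" using var by (rule order_trans[rotated]) (simp add: integral_nonneg)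
    have f4: "0 \<le> real (card I) * e1"
    proof (cases "I = {}")
      case False
      then obtain i where "i \<in> I" by blast
      from dec[OF this, of "\<lambda>_. 0"] have "0 \<le> e1" by simp
      thus ?thesis by simp
    qed simp
    have gen: "a \<ge> b \<Longrightarrow> 0 \<le> k * w \<Longrightarrow> 0 \<le> e2 \<Longrightarrow> 0 \<le> e \<Longrightarrow> 0 \<le> b \<Longrightarrow> 0 \<le> k \<Longrightarrow>
       2 * (4 * k + b + (2 * e + 2 * e2 + k * (2 + 2 * w)) + 2 * k + a / 2) \<le> 16 * (k * (1 + w) + a + e + e2)"
      for a k e :: real by (simp add: algebra_simps)
    show ?thesis unfolding \<alpha>_def mult.assoc
      by (rule gen[OF f1 f2 f3 f4 less_imp_le[OF b] \<kappa>])
  qed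
  also have "\<kappa> = real (card I) * b ^ 3 * (real D)\<^sup>2"
    by (simp add: \<kappa>_def power_mult_distrib power2_eq_square power3_eq_cube)
  finally show ?thesis using \<delta>[of z] unfolding F_def by linarith
qed

end

section \<open>Lattice geometry\<close>

text \<open>Sup-norm proximity. Its balls are boxes of known size, and it is implied by proximity in
  the graph, so separation in this sense suffices for spatial mixing.\<close>

definition near :: "nat \<Rightarrow> int ^ 'd::finite \<Rightarrow> int ^ 'd \<Rightarrow> bool" where
  "near r i j \<longleftrightarrow> (\<forall>l. \<bar>i $ l - j $ l\<bar> \<le> int r)"

lemma near_refl [simp]: "near r i i"
  by (simp add: near_def)

lemma near_sym: "near r i j \<longleftrightarrow> near r j i"
  by (simp add: near_def abs_minus_commute)

lemma near_mono: "near r i j \<Longrightarrow> r \<le> s \<Longrightarrow> near s i j"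
  by (auto simp: near_def intro: order_trans)

lemma near_trans: "near r i j \<Longrightarrow> near s j k \<Longrightarrow> near (r + s) i k"
proof -
  assume a: "near r i j" "near s j k"
  have "\<bar>i $ l - k $ l\<bar> \<le> int (r + s)" for l
    using a[unfolded near_def, rule_format, of l] by linarith
  thus ?thesis by (simp add: near_def)
qed

lemma near_translate: "near r (k + i) (k + j) \<longleftrightarrow> near r i j"
  by (simp add: near_def)

lemma card_vec_box:
  fixes A :: "'d::finite \<Rightarrow> int set"
  assumes "\<And>l. finite (A l)"
  shows "finite {i :: int ^ 'd. \<forall>l. i $ l \<in> A l}"
    and "card {i :: int ^ 'd. \<forall>l. i $ l \<in> A l} = (\<Prod>l\<in>UNIV. card (A l))"
proof -
  have "bij_betw vec_nth {i :: int ^ 'd. \<forall>l. i $ l \<in> A l} (PiE UNIV A)"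
  proof (rule bij_betw_imageI)
    show "inj_on vec_nth {i :: int ^ 'd. \<forall>l. i $ l \<in> A l}" by (auto simp: inj_on_def vec_eq_iff)
    show "vec_nth ` {i :: int ^ 'd. \<forall>l. i $ l \<in> A l} = PiE UNIV A"
    proof (intro equalityI subsetI)
      fix f assume "f \<in> PiE UNIV A"
      thus "f \<in> vec_nth ` {i :: int ^ 'd. \<forall>l. i $ l \<in> A l}"
        by (intro image_eqI[of _ _ "vec_lambda f"]) auto
    qed auto
  qed
  from bij_betw_finite[OF this] bij_betw_same_card[OF this]
  show "finite {i :: int ^ 'd. \<forall>l. i $ l \<in> A l}"
    and "card {i :: int ^ 'd. \<forall>l. i $ l \<in> A l} = (\<Prod>l\<in>UNIV. card (A l))"
    using assms by (auto simp: card_PiE intro: finite_PiE)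
qed

lemma near_ball:
  fixes i :: "int ^ 'd::finite"
  shows finite_near: "finite {j. near r i j}" and card_near: "card {j. near r i j} = (2 * r + 1) ^ CARD('d)"
proof -
  have "\<bar>i $ l - j $ l\<bar> \<le> int r \<longleftrightarrow> j $ l \<in> {i $ l - int r .. i $ l + int r}" for j l
    by auto
  hence eq: "{j. near r i j} = {j. \<forall>l. j $ l \<in> {i $ l - int r .. i $ l + int r}}"
    by (simp only: near_def)
  show "finite {j. near r i j}" unfolding eq by (rule card_vec_box) simp
  show "card {j. near r i j} = (2 * r + 1) ^ CARD('d)" unfolding eq
    by (subst card_vec_box) (auto simp: nat_add_distrib nat_mult_distrib)
qed

section \<open>Graph distance compared with the sup norm\<close>

lemma lattice_adj_imp_near: "lattice_adj i j \<Longrightarrow> near 1 i j"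
  by (auto simp: lattice_adj_def near_def axis_def)

lemma lattice_path_imp_near: "(lattice_adj ^^ n) i j \<Longrightarrow> near n i j"
proof (induction n arbitrary: j)
  case (Suc n)
  then obtain k where "(lattice_adj ^^ n) i k" "lattice_adj k j" by auto
  with near_trans[OF Suc.IH[of k] lattice_adj_imp_near[of k j]] show ?case by simp
qed simp

text \<open>\<open>graph_dist\<close> is a \<open>LEAST\<close>, which says nothing unless some path
  exists. Each step decreases the l1 distance by moving one coordinate towards its target.\<close>

lemma lattice_connected: "\<exists>n. (lattice_adj ^^ n) i (j :: int ^ 'd::finite)"
proof (induction "nat (\<Sum>l\<in>UNIV. \<bar>i $ l - j $ l\<bar>)" arbitrary: i rule: less_induct)
  case less
  show ?case
  proof (cases "i = j")
    case True
    then show ?thesis by (intro exI[of _ 0]) simp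
  next
    case False
    then obtain l where l: "i $ l \<noteq> j $ l" by (auto simp: vec_eq_iff)
    define i' where "i' = (if i $ l < j $ l then i + axis l 1 else i - axis l 1)"
    have adj: "lattice_adj i i'" by (auto simp: i'_def lattice_adj_def)
    have le: "\<bar>i' $ m - j $ m\<bar> \<le> \<bar>i $ m - j $ m\<bar>" for m using l by (auto simp: i'_def axis_def)
    have lt: "\<bar>i' $ l - j $ l\<bar> < \<bar>i $ l - j $ l\<bar>" using l by (auto simp: i'_def axis_def)
    have "(\<Sum>l\<in>UNIV. \<bar>i' $ l - j $ l\<bar>) < (\<Sum>l\<in>UNIV. \<bar>i $ l - j $ l\<bar>)"
      by (rule sum_strict_mono_ex1) (use le lt in auto)
    moreover have "0 \<le> (\<Sum>l\<in>UNIV. \<bar>i' $ l - j $ l\<bar>)" by (rule sum_nonneg) simp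
    ultimately have "nat (\<Sum>l\<in>UNIV. \<bar>i' $ l - j $ l\<bar>) < nat (\<Sum>l\<in>UNIV. \<bar>i $ l - j $ l\<bar>)"
      by (subst nat_less_eq_zless)
    from less[OF this] obtain n where "(lattice_adj ^^ n) i' j" by blast
    with adj have "(lattice_adj ^^ Suc n) i j" by (rule relpowp_Suc_I2)
    thus ?thesis by blast
  qed
qed

lemma near_graph_dist: "near (graph_dist i j) i j"
  unfolding graph_dist_def by (rule lattice_path_imp_near, rule LeastI_ex, rule lattice_connected)

lemma graph_dist_self [simp]: "graph_dist i i = 0"
  unfolding graph_dist_def by (rule Least_eq_0) simp

text \<open>Empty sets are covered: the infimum is then infinite. This is the case of boundary
  conditions that agree.\<close>

lemma set_dist_ge:
  assumes "\<And>i j. i \<in> V \<Longrightarrow> j \<in> W \<Longrightarrow> \<not> near r i j"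
  shows "enat (Suc r) \<le> set_dist V W"
  unfolding set_dist_def
proof (rule INF_greatest, clarify)
  fix i j assume "i \<in> V" "j \<in> W"
  hence "\<not> near r i j" by (rule assms)
  hence "r < graph_dist i j" using near_graph_dist near_mono by (metis not_less)
  thus "enat (Suc r) \<le> enat (graph_dist i j)" by simp
qed

lemma boundary_disjoint: "i \<in> boundary V \<Longrightarrow> i \<notin> V"
proof
  assume "i \<in> boundary V" "i \<in> V"
  hence "set_dist {i} V \<le> enat (graph_dist i i)" unfolding set_dist_def by (intro INF_lower2[of "(i, i)"]) auto
  with \<open>i \<in> boundary V\<close> show False by (simp add: boundary_def one_enat_def)
qed

lemma boundary_near:
  assumes "i \<in> boundary V"
  shows "\<exists>j\<in>V. near 1 i j"
proof (rule ccontr)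
  assume "\<not> (\<exists>j\<in>V. near 1 i j)"
  hence "enat (Suc 1) \<le> set_dist {i} V" by (intro set_dist_ge) auto
  with assms show False by (simp add: boundary_def one_enat_def)
qed

lemma finite_boundary:
  assumes "finite V"
  shows "finite (boundary V)"
proof (rule finite_subset)
  show "boundary V \<subseteq> (\<Union>j\<in>V. {i. near 1 j i})" using boundary_near near_sym by fastforce
  show "finite (\<Union>j\<in>V. {i. near 1 j i})" using assms finite_near by blast
qed

text \<open>The quantifiers range over total functions, hence also over \<open>restrict x U\<close>
  with its value \<open>undefined\<close> off \<open>U\<close>. So a local function can be evaluated
  directly at elements of \<open>U \<rightarrow>\<^sub>E UNIV\<close>.\<close>

definition local_on :: "(('i \<Rightarrow> 'a) \<Rightarrow> 'b) \<Rightarrow> 'i set \<Rightarrow> bool" where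
  "local_on F U \<longleftrightarrow> (\<forall>x y. (\<forall>i\<in>U. x i = y i) \<longrightarrow> F x = F y)"

lemma local_onD: "local_on F U \<Longrightarrow> (\<And>i. i \<in> U \<Longrightarrow> x i = y i) \<Longrightarrow> F x = F y"
  by (simp add: local_on_def)

lemma local_on_mono: "local_on F U \<Longrightarrow> U \<subseteq> V \<Longrightarrow> local_on F V"
  by (auto simp: local_on_def)

lemma local_on_restrict: "local_on F U \<Longrightarrow> U \<subseteq> V \<Longrightarrow> F (restrict x V) = F x"
  by (rule local_onD) auto

section \<open>Local functions and the Markov property\<close>

text \<open>A finite combination of products of one-site indicators. The measure \<open>N\<close> is
  arbitrary because both the configuration measure and the product spaces of the Markov property are
  needed.\<close>

lemma borel_measurable_local:
  fixes F :: "('i \<Rightarrow> 'a::finite) \<Rightarrow> real"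
  assumes "finite U" "local_on F U"
    and coord: "\<And>i. i \<in> U \<Longrightarrow> (\<lambda>x. x i) \<in> measurable N (count_space UNIV)"
  shows "F \<in> borel_measurable N"
proof -
  have fin: "finite (U \<rightarrow>\<^sub>E (UNIV :: 'a set))" using assms(1) by (simp add: finite_PiE)
  have "F x = (\<Sum>\<xi>\<in>U \<rightarrow>\<^sub>E UNIV. F \<xi> * (\<Prod>i\<in>U. of_bool (x i = \<xi> i)))" for x
  proof -
    have "F x = F (restrict x U)" using assms(2) by (simp add: local_on_restrict)
    also have "\<dots> = (\<Sum>\<xi>\<in>U \<rightarrow>\<^sub>E UNIV. if \<xi> = restrict x U then F \<xi> else 0)"
      using fin by simp
    also have "\<dots> = (\<Sum>\<xi>\<in>U \<rightarrow>\<^sub>E UNIV. F \<xi> * (\<Prod>i\<in>U. of_bool (x i = \<xi> i)))"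
    proof (rule sum.cong)
      fix \<xi> assume "\<xi> \<in> U \<rightarrow>\<^sub>E (UNIV :: 'a set)"
      hence "\<xi> = restrict x U \<longleftrightarrow> (\<forall>i\<in>U. x i = \<xi> i)"
        by (auto simp: restrict_def PiE_def extensional_def fun_eq_iff)
      thus "(if \<xi> = restrict x U then F \<xi> else 0) = F \<xi> * (\<Prod>i\<in>U. of_bool (x i = \<xi> i))"
        using assms(1) by auto
    qed simp
    finally show ?thesis .
  qed
  note eq = this
  have "(\<lambda>x. \<Sum>\<xi>\<in>U \<rightarrow>\<^sub>E UNIV. F \<xi> * (\<Prod>i\<in>U. of_bool (x i = \<xi> i))) \<in> borel_measurable N"
  proof (intro borel_measurable_sum borel_measurable_times borel_measurable_prod)
    fix \<xi> i assume "i \<in> U"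
    show "(\<lambda>x. of_bool (x i = \<xi> i) :: real) \<in> borel_measurable N"
      by (rule measurable_compose[OF coord[OF \<open>i \<in> U\<close>]]) simp
  qed simp
  thus ?thesis by (rule measurable_cong[THEN iffD2, OF eq])
qed

lemma measurable_component_discrete:
  "i \<in> V \<Longrightarrow> (\<lambda>x. x i) \<in> measurable (Pi\<^sub>M V (\<lambda>_. borel)) (count_space (UNIV :: 'a::{finite,discrete_topology} set))"
  using measurable_component_singleton[of i V "\<lambda>_. borel :: 'a measure"]
  by (simp add: measurable_cong_sets[OF refl sets_borel_eq_count_space])

lemma (in prob_space) integral_uniform_measure:
  fixes f :: "'a \<Rightarrow> real"
  assumes [measurable]: "f \<in> borel_measurable M" "C \<in> sets M" and "prob C > 0"
  shows "(\<integral>x. f x \<partial>uniform_measure M C) = expectation (\<lambda>x. indicator C x * f x) / prob C"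
proof -
  have "uniform_measure M C = density M (\<lambda>x. ennreal (indicator C x / prob C))"
    unfolding uniform_measure_def emeasure_eq_measure using assms(3) divide_ennreal[of 1 "prob C"]
    by (intro density_cong) (auto simp: indicator_def)
  thus ?thesis by (simp add: integral_density)
qed

section \<open>Cylinders, topological support and shifts\<close>

lemma open_cylinder:
  fixes \<xi> :: "'i \<Rightarrow> 'a::discrete_topology"
  assumes "finite U"
  shows "open {x. \<forall>i\<in>U. x i = \<xi> i}"
  using product_topology_basis'[OF assms, of "\<lambda>i. {\<xi> i}" "\<lambda>i. i"] by (simp add: discrete_topology_class.open_discrete)

lemma cylinder_neighbourhood:
  fixes x :: "'i \<Rightarrow> 'a::discrete_topology"
  assumes "open W" "x \<in> W"
  obtains U where "finite U" "{y. \<forall>i\<in>U. y i = x i} \<subseteq> W"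
proof -
  have "\<exists>X. x \<in> (\<Pi>\<^sub>E i\<in>UNIV. X i) \<and> (\<forall>i. openin euclidean (X i)) \<and> finite {i. X i \<noteq> topspace (euclidean :: 'a topology)}
      \<and> (\<Pi>\<^sub>E i\<in>UNIV. X i) \<subseteq> W"
    using product_topology_open_contains_basis[of "\<lambda>i. euclidean" UNIV W x] assms
    unfolding open_fun_def by simp
  then obtain X where X: "x \<in> (\<Pi>\<^sub>E i\<in>UNIV. X i)" "finite {i. X i \<noteq> (UNIV :: 'a set)}"
    "(\<Pi>\<^sub>E i\<in>UNIV. X i) \<subseteq> W" by auto
  have "{y. \<forall>i\<in>{i. X i \<noteq> UNIV}. y i = x i} \<subseteq> (\<Pi>\<^sub>E i\<in>UNIV. X i)"
  proof (clarsimp simp: PiE_iff)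
    fix y i assume "\<forall>i. X i \<noteq> UNIV \<longrightarrow> y i = x i"
    thus "y i \<in> X i" using X(1) by (cases "X i = UNIV") (auto simp: PiE_iff)
  qed
  with X show ?thesis by (intro that[of "{i. X i \<noteq> UNIV}"]) auto
qed

lemma closed_topological_support: "closed (topological_support M)"
proof -
  have "- topological_support M = \<Union>{U. open U \<and> \<not> emeasure M U > 0}"
    by (auto simp: topological_support_def)
  moreover have "open (\<Union>{U. open U \<and> \<not> emeasure M U > 0})" by (rule open_Union) auto
  ultimately show ?thesis by (simp add: closed_def)
qed

lemma shift_shift: "shift i (shift j x) = shift (i + j) x"
  by (simp add: shift_def fun_eq_iff add_ac)

lemma continuous_on_shift: "continuous_on UNIV (shift i :: ('d::finite, 'a::topological_space) config \<Rightarrow> _)"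
  unfolding shift_def by (intro continuous_on_coordinatewise_then_product continuous_on_product_coordinates)

locale config_prob = prob_space M
  for M :: "(int ^ 'd::finite \<Rightarrow> 'a::{finite,discrete_topology}) measure" +
  assumes sets_M [measurable_cong]: "sets M = sets borel"
begin

lemma space_M [simp]: "space M = UNIV"
  using sets_eq_imp_space_eq[OF sets_M] by simp

lemma prob_UNIV [simp]: "prob UNIV = 1"
  using prob_space by simp

lemma open_sets: "open U \<Longrightarrow> U \<in> sets M"
  by (simp add: sets_M)

lemma coordinate_measurable [measurable]: "(\<lambda>x. x i) \<in> measurable M (count_space UNIV)"
proof -
  have "{x. x i \<in> A} \<in> sets M" for A
  proof -
    have "{x. x i \<in> A} = (\<Union>a\<in>A. {x. \<forall>j\<in>{i}. x j = a})" by auto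
    moreover have "open (\<Union>a\<in>A. {x :: int ^ 'd \<Rightarrow> 'a. \<forall>j\<in>{i}. x j = a})"
      by (intro open_UN ballI open_cylinder) simp
    ultimately show ?thesis by (simp add: open_sets)
  qed
  thus ?thesis by (auto intro!: measurableI simp: vimage_def)
qed

lemma local_measurable: "finite U \<Longrightarrow> local_on (F :: _ \<Rightarrow> real) U \<Longrightarrow> F \<in> borel_measurable M"
  by (rule borel_measurable_local) auto

lemma cylinder_sets: "finite U \<Longrightarrow> {x. restrict x U = \<xi>} \<in> sets M"
proof -
  assume U: "finite U"
  have "local_on (\<lambda>x. of_bool (restrict x U = \<xi>) :: real) U"
    unfolding local_on_def by (metis restrict_ext)
  from local_measurable[OF U this] have "(\<lambda>x. of_bool (restrict x U = \<xi>) :: real) -` {1} \<inter> space M \<in> sets M"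
    by (rule measurable_sets) simp
  moreover have "(\<lambda>x. of_bool (restrict x U = \<xi>) :: real) -` {1} \<inter> space M = {x. restrict x U = \<xi>}"
    by auto
  ultimately show ?thesis by simp
qed

lemma support_sets [measurable]: "topological_support M \<in> sets M"
  using borel_closed[OF closed_topological_support[of M]] sets_M by blast

text \<open>There are only countably many cylinders over finite sets, and every point off the
  support lies in a null one. Hence the complement of the support is covered by countably many null
  sets.\<close>

lemma AE_support: "AE x in M. x \<in> topological_support M"
proof -
  define I where "I = (SIGMA U:{U :: (int ^ 'd) set. finite U}. U \<rightarrow>\<^sub>E (UNIV :: 'a set))"
  define N where "N = {p \<in> I. emeasure M {x. \<forall>i\<in>fst p. x i = snd p i} = 0}"
  have "countable I" unfolding I_def
    by (intro countable_SIGMA countable_PiE countable_Collect_finite) (auto intro: countable_finite)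
  hence cN: "countable N" unfolding N_def by (rule countable_subset[rotated]) auto
  have "AE x in M. \<forall>p\<in>N. \<not> (\<forall>i\<in>fst p. x i = snd p i)"
  proof (subst AE_ball_countable[OF cN], rule ballI)
    fix p assume "p \<in> N"
    hence p: "finite (fst p)" "emeasure M {x. \<forall>i\<in>fst p. x i = snd p i} = 0" by (auto simp: N_def I_def)
    show "AE x in M. \<not> (\<forall>i\<in>fst p. x i = snd p i)"
      by (rule AE_I[of _ _ "{x. \<forall>i\<in>fst p. x i = snd p i}"]) (use p open_cylinder[of "fst p" "snd p"] open_sets in auto)
  qed
  thus ?thesis
  proof (rule eventually_mono)
    fix x assume H: "\<forall>p\<in>N. \<not> (\<forall>i\<in>fst p. x i = snd p i)"
    show "x \<in> topological_support M"
    proof (rule ccontr)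
      assume "x \<notin> topological_support M"
      then obtain W where W: "open W" "x \<in> W" "emeasure M W = 0"
        by (auto simp: topological_support_def)
      obtain U where U: "finite U" "{y. \<forall>i\<in>U. y i = x i} \<subseteq> W"
        using cylinder_neighbourhood[OF W(1,2)] .
      have "emeasure M {y. \<forall>i\<in>U. y i = x i} \<le> emeasure M W"
        using U W open_sets by (intro emeasure_mono) auto
      moreover have "{y. \<forall>i\<in>U. y i = restrict x U i} = {y. \<forall>i\<in>U. y i = x i}" by auto
      ultimately have "(U, restrict x U) \<in> N" using U W by (auto simp: N_def I_def)
      with H show False by force
    qed
  qed
qed

lemma support_nonempty: "topological_support M \<noteq> {}"
proof
  assume "topological_support M = {}"
  with AE_support have "AE x in M. False" by simp
  thus False by (simp add: AE_False)
qed

lemma integrable_bounded: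
  "f \<in> borel_measurable M \<Longrightarrow> (\<And>x. \<bar>f x\<bar> \<le> c) \<Longrightarrow> integrable M (f :: _ \<Rightarrow> real)"
  by (rule integrable_const_bound[of _ c]) auto

lemma shift_measurable [measurable]: "shift i \<in> measurable M M"
  using borel_measurable_continuous_onI[OF continuous_on_shift, of i]
  by (simp add: measurable_cong_sets[OF sets_M sets_M])

text \<open>Spatial mixing is assumed only for boundary conditions seen in the support; this places
  every condition of positive probability among them.\<close>

lemma pos_prob_imp_boundary_config:
  assumes "finite B" "prob {y. restrict y B = \<tau>} > 0"
  shows "\<exists>x\<in>topological_support M. restrict x B = \<tau>"
proof (rule ccontr)
  assume "\<not> ?thesis"
  hence "AE y in M. y \<notin> {y. restrict y B = \<tau>}" using AE_support by auto
  hence "prob {y. restrict y B = \<tau>} = 0" using cylinder_sets[OF assms(1)] by (simp add: prob_eq_0)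
  with assms show False by simp
qed

section \<open>Conditioning on boundary configurations\<close>

lemma expectation_cylinder_sum:
  fixes F :: "_ \<Rightarrow> real"
  assumes V: "finite V" and F: "local_on F V" and G: "integrable M G"
  shows "expectation (\<lambda>x. F x * G x) = (\<Sum>\<eta>\<in>V \<rightarrow>\<^sub>E UNIV. F \<eta> * expectation (\<lambda>x. indicator {x. restrict x V = \<eta>} x * G x))"
proof -
  have fin: "finite (V \<rightarrow>\<^sub>E (UNIV :: 'a set))" using V by (simp add: finite_PiE)
  have "F x * G x = (\<Sum>\<eta>\<in>V \<rightarrow>\<^sub>E UNIV. F \<eta> * (indicator {x. restrict x V = \<eta>} x * G x))" for x
  proof -
    have "(\<Sum>\<eta>\<in>V \<rightarrow>\<^sub>E UNIV. F \<eta> * (indicator {x. restrict x V = \<eta>} x * G x))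
       = (\<Sum>\<eta>\<in>V \<rightarrow>\<^sub>E UNIV. if restrict x V = \<eta> then F \<eta> * G x else 0)"
      by (intro sum.cong) (auto simp: indicator_def)
    also have "\<dots> = F (restrict x V) * G x" using fin by simp
    finally show ?thesis using local_on_restrict[OF F, of V x] by simp
  qed
  moreover have "integrable M (\<lambda>x. F \<eta> * (indicator {x. restrict x V = \<eta>} x * G x))" for \<eta>
    using integrable_mult_indicator[OF cylinder_sets[OF V] G, of \<eta>] by (intro integrable_mult_right) simp
  ultimately show ?thesis by (simp add: Bochner_Integration.integral_sum)
qed

text \<open>The support has full measure, so intersecting the events with it changes no
  probability.\<close>

lemma local_spec_eq:
  assumes V: "finite V" and \<tau>: "prob {x. restrict x (boundary V) = \<tau>} > 0"
  shows "local_spec M V \<tau> \<eta> =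
    expectation (\<lambda>x. indicator {x. restrict x V = \<eta>} x * indicator {x. restrict x (boundary V) = \<tau>} x)
      / prob {x. restrict x (boundary V) = \<tau>}"
proof -
  let ?B = "boundary V"
  note c = cylinder_sets[OF V, of \<eta>] cylinder_sets[OF finite_boundary[OF V], of \<tau>]
  have "prob {x \<in> space M. x \<in> topological_support M \<and> restrict x ?B = \<tau>} = prob {x. restrict x ?B = \<tau>}"
  proof (rule measure_eq_AE)
    have "{x \<in> space M. x \<in> topological_support M \<and> restrict x ?B = \<tau>} = topological_support M \<inter> {x. restrict x ?B = \<tau>}" by auto
    thus "{x \<in> space M. x \<in> topological_support M \<and> restrict x ?B = \<tau>} \<in> sets M" using c by simp
  qed (use AE_support c in auto)
  moreover have "prob {x \<in> space M. (x \<in> topological_support M \<and> restrict x V = \<eta>) \<and> x \<in> topological_support M \<and> restrict x ?B = \<tau>}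
      = prob ({x. restrict x V = \<eta>} \<inter> {x. restrict x ?B = \<tau>})"
  proof (rule measure_eq_AE)
    have "{x \<in> space M. (x \<in> topological_support M \<and> restrict x V = \<eta>) \<and> x \<in> topological_support M \<and> restrict x ?B = \<tau>}
       = topological_support M \<inter> {x. restrict x V = \<eta>} \<inter> {x. restrict x ?B = \<tau>}" by auto
    thus "{x \<in> space M. (x \<in> topological_support M \<and> restrict x V = \<eta>) \<and> x \<in> topological_support M \<and> restrict x ?B = \<tau>} \<in> sets M" using c by simp
  qed (use AE_support c in auto)
  ultimately show ?thesis
    by (simp add: local_spec_def cond_prob_def flip: indicator_inter_arith)
qed

text \<open>Grouping the configurations on \<open>V\<close> by their restriction to \<open>U\<close>
  turns the sum against the marginal into a conditional expectation.\<close>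

lemma local_spec_marginal_expectation:
  fixes F :: "_ \<Rightarrow> real"
  assumes V: "finite V" and UV: "U \<subseteq> V" and F: "local_on F U"
    and \<tau>: "prob {x. restrict x (boundary V) = \<tau>} > 0"
  shows "(\<Sum>\<xi>\<in>U \<rightarrow>\<^sub>E UNIV. F \<xi> * local_spec_marginal M V U \<tau> \<xi>)
    = expectation (\<lambda>x. F x * indicator {x. restrict x (boundary V) = \<tau>} x) / prob {x. restrict x (boundary V) = \<tau>}"
proof -
  let ?B = "boundary V"
  have fin: "finite (V \<rightarrow>\<^sub>E (UNIV :: 'a set))" "finite (U \<rightarrow>\<^sub>E (UNIV :: 'a set))"
    using V finite_subset[OF UV V] by (simp_all add: finite_PiE)
  have "(\<Sum>\<xi>\<in>U \<rightarrow>\<^sub>E UNIV. F \<xi> * local_spec_marginal M V U \<tau> \<xi>)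
      = (\<Sum>\<xi>\<in>U \<rightarrow>\<^sub>E UNIV. \<Sum>\<eta> | \<eta> \<in> V \<rightarrow>\<^sub>E UNIV \<and> restrict \<eta> U = \<xi>. F \<eta> * local_spec M V \<tau> \<eta>)"
    unfolding local_spec_marginal_def sum_distrib_left
    using local_on_restrict[OF F subset_refl] by (intro sum.cong) auto
  also have "\<dots> = (\<Sum>\<eta>\<in>V \<rightarrow>\<^sub>E UNIV. F \<eta> * local_spec M V \<tau> \<eta>)"
    using sum.group[OF fin, of "\<lambda>\<eta>. restrict \<eta> U" "\<lambda>\<eta>. F \<eta> * local_spec M V \<tau> \<eta>"]
    using UV by (simp add: image_subset_iff)
  also have "\<dots> = expectation (\<lambda>x. F x * indicator {x. restrict x ?B = \<tau>} x) / prob {x. restrict x ?B = \<tau>}"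
  proof (subst expectation_cylinder_sum[OF V local_on_mono[OF F UV]])
    show "integrable M (indicat_real {x. restrict x ?B = \<tau>})"
      using cylinder_sets[OF finite_boundary[OF V], of \<tau>] by (intro integrable_bounded[of _ 1]) auto
  qed (auto simp: local_spec_eq[OF V \<tau>] sum_divide_distrib)
  finally show ?thesis .
qed

text \<open>Independence under the conditioned measure with the denominators cleared. Finiteness of
  \<open>W\<close> makes \<open>G\<close> measurable for the product over the infinite set outside
  \<open>V \<union> boundary V\<close>.\<close>

lemma markov_factorization:
  fixes F G :: "_ \<Rightarrow> real"
  assumes mrf: "markov_random_field M" and V: "finite V"
    and U: "U \<subseteq> V" "local_on F U"
    and W: "finite W" "W \<inter> (V \<union> boundary V) = {}" "local_on G W"
    and bF: "\<And>x. \<bar>F x\<bar> \<le> a" and bG: "\<And>x. \<bar>G x\<bar> \<le> b"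
    and \<tau>: "prob {x. restrict x (boundary V) = \<tau>} > 0"
  shows "expectation (\<lambda>x. indicator {x. restrict x (boundary V) = \<tau>} x * (F x * G x))
      * prob {x. restrict x (boundary V) = \<tau>}
    = expectation (\<lambda>x. indicator {x. restrict x (boundary V) = \<tau>} x * F x)
      * expectation (\<lambda>x. indicator {x. restrict x (boundary V) = \<tau>} x * G x)"
proof -
  let ?C = "{x. restrict x (boundary V) = \<tau>}" and ?W = "- (V \<union> boundary V)"
  let ?Q = "uniform_measure M ?C"
  have C [measurable]: "?C \<in> sets M" using cylinder_sets[OF finite_boundary[OF V]] .
  have emC: "emeasure M ?C \<noteq> 0" "emeasure M ?C \<noteq> \<infinity>" using \<tau> by (auto simp: emeasure_eq_measure)
  interpret Q: prob_space ?Q by (rule prob_space_uniform_measure[OF emC])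
  have finU: "finite U" using U V finite_subset by blast
  have [measurable]: "F \<in> borel_measurable M" "G \<in> borel_measurable M"
    using local_measurable finU U W by auto
  have ind: "Q.indep_var (Pi\<^sub>M V (\<lambda>_. borel)) (\<lambda>x. restrict x V) (Pi\<^sub>M ?W (\<lambda>_. borel)) (\<lambda>x. restrict x ?W)"
    using mrf V \<tau> unfolding markov_random_field_def Let_def by simp
  have mF: "F \<in> borel_measurable (Pi\<^sub>M V (\<lambda>_. borel))"
    by (rule borel_measurable_local[OF finU U(2)]) (use U in \<open>auto intro!: measurable_component_discrete\<close>)
  have mG: "G \<in> borel_measurable (Pi\<^sub>M ?W (\<lambda>_. borel))"
    by (rule borel_measurable_local[OF W(1,3)]) (use W in \<open>auto intro!: measurable_component_discrete\<close>)
  have "Q.indep_var borel (F \<circ> (\<lambda>x. restrict x V)) borel (G \<circ> (\<lambda>x. restrict x ?W))"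
    by (rule Q.indep_var_compose[OF ind mF mG])
  moreover have "F \<circ> (\<lambda>x. restrict x V) = F" "G \<circ> (\<lambda>x. restrict x ?W) = G"
  proof -
    have "W \<subseteq> ?W" using W(2) by auto
    thus "F \<circ> (\<lambda>x. restrict x V) = F" "G \<circ> (\<lambda>x. restrict x ?W) = G"
      using local_on_restrict[OF U(2,1)] local_on_restrict[OF W(3), of ?W] unfolding comp_def by blast+
  qed
  ultimately have "Q.indep_var borel F borel G" by simp
  moreover have "integrable ?Q F" "integrable ?Q G"
    by (rule Q.integrable_const_bound[of _ a], use bF in auto, rule Q.integrable_const_bound[of _ b], use bG in auto)
  ultimately have "(\<integral>x. F x * G x \<partial>?Q) = (\<integral>x. F x \<partial>?Q) * (\<integral>x. G x \<partial>?Q)"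
    by (rule Q.indep_var_lebesgue_integral)
  thus ?thesis using \<tau>
    by (simp add: integral_uniform_measure field_simps)
qed

end

section \<open>Decay of covariances\<close>

lemma enat_le_imp_exp_decay: "0 \<le> c \<Longrightarrow> enat k \<le> r \<Longrightarrow> exp_decay c r \<le> exp (- c * real k)"
  by (cases r) (auto simp: exp_decay_def intro: mult_left_mono)

context config_prob
begin

lemma abs_expectation_indicator_le:
  fixes H :: "_ \<Rightarrow> real"
  assumes "A \<in> sets M" "H \<in> borel_measurable M" "\<And>x. \<bar>H x\<bar> \<le> h"
  shows "\<bar>expectation (\<lambda>x. indicator A x * H x)\<bar> \<le> h * prob A"
proof -
  have i: "integrable M (\<lambda>x. indicator A x * H x)"
    using integrable_mult_indicator[OF assms(1) integrable_bounded[OF assms(2,3)]] by simp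
  have "\<bar>expectation (\<lambda>x. indicator A x * H x)\<bar> \<le> expectation (\<lambda>x. \<bar>indicator A x * H x\<bar>)"
    by (rule integral_abs_bound)
  also have "\<dots> \<le> expectation (\<lambda>x. h * indicator A x)"
    using i assms by (intro integral_mono) (auto simp: indicator_def intro!: integrable_mult_right integrable_bounded[of _ 1])
  also have "\<dots> = h * prob A" using assms(1) by simp
  finally show ?thesis .
qed

text \<open>Given the spins on the boundary of a neighbourhood of \<open>U\<close>, the expectation
  of \<open>F * G\<close> factors. Spatial mixing makes the conditional expectation of
  \<open>F\<close> almost the same for all boundary values, so it may be replaced by the
  unconditional one. Of \<open>G\<close> only the bound \<open>b\<close> is used, which is why
  \<open>card W\<close> does not appear.\<close>

lemma exp_mixing:
  assumes mrf: "markov_random_field M" and ssm: "exp_strong_spatial_mixing M"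
  obtains C c where "C > 0" "c > 0"
    "\<And>F G U W a b r. finite U \<Longrightarrow> finite W \<Longrightarrow> local_on F U \<Longrightarrow> local_on G W \<Longrightarrow>
       (\<And>x. \<bar>F x\<bar> \<le> a) \<Longrightarrow> (\<And>x. \<bar>G x\<bar> \<le> b) \<Longrightarrow>
       (\<And>u w. u \<in> U \<Longrightarrow> w \<in> W \<Longrightarrow> \<not> near (Suc r) u w) \<Longrightarrow>
       \<bar>expectation (\<lambda>x. F x * G x) - expectation F * expectation G\<bar>
         \<le> C * a * b * real (card U) * exp (- c * real r)"
proof -
  obtain C c where *: "C > 0 \<and> c > 0 \<and> (\<forall>V U. finite V \<longrightarrow> U \<subseteq> V \<longrightarrow>
      (\<forall>\<tau> \<in> boundary_configs M V. \<forall>\<tau>' \<in> boundary_configs M V.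
        tv_dist (U \<rightarrow>\<^sub>E UNIV) (local_spec_marginal M V U \<tau>) (local_spec_marginal M V U \<tau>')
          \<le> C * real (card U) * exp_decay c (set_dist U (disagreement V \<tau> \<tau>'))))"
    using ssm unfolding exp_strong_spatial_mixing_def by (elim exE)
  hence C: "C > 0" "c > 0" by auto
  note mix = *[THEN conjunct2, THEN conjunct2, rule_format]
  show thesis
  proof (rule that[of "2 * C" c])
    fix F G :: "(int ^ 'd \<Rightarrow> 'a) \<Rightarrow> real" and U W :: "(int ^ 'd) set" and a b :: real and r :: nat
    assume U: "finite U" and W: "finite W" and F: "local_on F U" and G: "local_on G W"
      and a: "\<And>x. \<bar>F x\<bar> \<le> a" and b: "\<And>x. \<bar>G x\<bar> \<le> b"
      and sep: "\<And>u w. u \<in> U \<Longrightarrow> w \<in> W \<Longrightarrow> \<not> near (Suc r) u w"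
    define V where "V = (\<Union>u\<in>U. {j. near r u j})" \<comment> \<open>its boundary separates \<open>U\<close> from \<open>W\<close>\<close>
    let ?B = "boundary V"
    have V: "finite V" and UV: "U \<subseteq> V" using U finite_near by (auto simp: V_def)
    have farB: "\<not> near r u i" if "u \<in> U" "i \<in> ?B" for u i
      using boundary_disjoint[OF that(2)] that(1) by (auto simp: V_def)
    have "w \<notin> V \<union> ?B" if w: "w \<in> W" for w
    proof
      assume "w \<in> V \<union> ?B"
      then obtain u where "u \<in> U" "near (Suc r) u w"
      proof
        assume "w \<in> V"
        then obtain u where "u \<in> U" "near r u w" by (auto simp: V_def)
        thus ?thesis using that near_mono[of r u w "Suc r"] by simp
      next
        assume "w \<in> ?B"
        then obtain j where "j \<in> V" "near 1 w j" using boundary_near by blast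
        then obtain u where "u \<in> U" "near r u j" "near 1 j w" by (auto simp: V_def near_sym)
        thus ?thesis using that near_trans[of r u j 1 w] by simp
      qed
      with sep w show False by blast
    qed
    hence WV: "W \<inter> (V \<union> ?B) = {}" by blast
    define T where "T = (?B \<rightarrow>\<^sub>E (UNIV :: 'a set))"
    define c\<tau> where "c\<tau> \<tau> = {x :: int ^ 'd \<Rightarrow> 'a. restrict x ?B = \<tau>}" for \<tau>
    define p where "p \<tau> = prob (c\<tau> \<tau>)" for \<tau>
    \<comment> \<open>Left unnormalised, so boundary values of probability zero contribute 0; the
      conditional expectation is \<open>e \<tau> H / p \<tau>\<close>.\<close>
    define e where "e \<tau> H = expectation (\<lambda>x. indicator (c\<tau> \<tau>) x * H x)" for \<tau> and H :: "_ \<Rightarrow> real"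
    \<comment> \<open>The factor 2 undoes the \<open>1 / 2\<close> in
      \<open>tv_dist\<close>.\<close>
    define \<epsilon> where "\<epsilon> = 2 * C * a * real (card U) * exp (- c * real r)"
    have B: "finite ?B" by (rule finite_boundary[OF V])
    have T: "finite T" unfolding T_def using B by (simp add: finite_PiE)
    have c\<tau>: "c\<tau> \<tau> \<in> sets M" for \<tau> unfolding c\<tau>_def by (rule cylinder_sets[OF B])
    have mF: "F \<in> borel_measurable M" and mG: "G \<in> borel_measurable M"
      using local_measurable U W F G by blast+
    have a0: "0 \<le> a" and b0: "0 \<le> b" using a[of undefined] b[of undefined] by linarith+
    have FG: "\<bar>F x * G x\<bar> \<le> a * b" for x unfolding abs_mult using a b a0 by (intro mult_mono) auto
    have mFG: "(\<lambda>x. F x * G x) \<in> borel_measurable M" using mF mG by simp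
    have tot: "expectation H = (\<Sum>\<tau>\<in>T. e \<tau> H)" if "H \<in> borel_measurable M" "\<And>x. \<bar>H x\<bar> \<le> h" for H h
      using expectation_cylinder_sum[OF B, of "\<lambda>_. 1" H] integrable_bounded[OF that]
      by (simp add: e_def c\<tau>_def T_def local_on_def)
    have ebd: "\<bar>e \<tau> H\<bar> \<le> h * p \<tau>" if "H \<in> borel_measurable M" "\<And>x. \<bar>H x\<bar> \<le> h" for H h \<tau>
      unfolding e_def p_def by (rule abs_expectation_indicator_le[OF c\<tau> that])
    have p1: "(\<Sum>\<tau>\<in>T. p \<tau>) = 1"
      using tot[of "\<lambda>_. 1" 1] c\<tau> by (simp add: e_def p_def prob_space[unfolded space_M])
    have p0: "0 \<le> p \<tau>" for \<tau> by (simp add: p_def)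
    have osc: "\<bar>e \<tau> F / p \<tau> - e \<tau>' F / p \<tau>'\<bar> \<le> \<epsilon>" if "p \<tau> > 0" "p \<tau>' > 0" for \<tau> \<tau>'
    proof -
      have bc: "\<tau> \<in> boundary_configs M V" "\<tau>' \<in> boundary_configs M V"
        using pos_prob_imp_boundary_config[OF B] that unfolding boundary_configs_def p_def c\<tau>_def by blast+
      have ex: "e \<sigma> F / p \<sigma> = (\<Sum>\<xi>\<in>U \<rightarrow>\<^sub>E UNIV. F \<xi> * local_spec_marginal M V U \<sigma> \<xi>)" if "p \<sigma> > 0" for \<sigma>
        using local_spec_marginal_expectation[OF V UV F, of \<sigma>] that
        by (simp add: e_def p_def c\<tau>_def mult.commute)
      have "\<bar>e \<tau> F / p \<tau> - e \<tau>' F / p \<tau>'\<bar>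
         = \<bar>\<Sum>\<xi>\<in>U \<rightarrow>\<^sub>E UNIV. F \<xi> * (local_spec_marginal M V U \<tau> \<xi> - local_spec_marginal M V U \<tau>' \<xi>)\<bar>"
        by (simp add: ex that sum_subtractf right_diff_distrib)
      also have "\<dots> \<le> (\<Sum>\<xi>\<in>U \<rightarrow>\<^sub>E UNIV. a * \<bar>local_spec_marginal M V U \<tau> \<xi> - local_spec_marginal M V U \<tau>' \<xi>\<bar>)"
        by (rule order_trans[OF sum_abs sum_mono]) (auto simp: abs_mult intro!: mult_right_mono a)
      also have "\<dots> = 2 * a * tv_dist (U \<rightarrow>\<^sub>E UNIV) (local_spec_marginal M V U \<tau>) (local_spec_marginal M V U \<tau>')"
        by (simp add: tv_dist_def sum_distrib_left)
      also have "\<dots> \<le> 2 * a * (C * real (card U) * exp_decay c (set_dist U (disagreement V \<tau> \<tau>')))"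
        using a0 by (intro mult_left_mono mix V UV bc) auto
      also have "\<dots> \<le> 2 * a * (C * real (card U) * exp (- c * real r))"
      proof (intro mult_left_mono enat_le_imp_exp_decay)
        \<comment> \<open>Boundary sites lie outside \<open>V\<close>, hence at distance at least
          \<open>r + 1\<close> from \<open>U\<close>; one unit is given away.\<close>
        have "enat r \<le> enat (Suc r)" by simp
        also have "\<dots> \<le> set_dist U (disagreement V \<tau> \<tau>')"
          by (rule set_dist_ge) (auto simp: disagreement_def farB)
        finally show "enat r \<le> set_dist U (disagreement V \<tau> \<tau>')" .
      qed (use C a0 in auto)
      also have "\<dots> = \<epsilon>" by (simp add: \<epsilon>_def)
      finally show ?thesis .
    qed
    have \<epsilon>0: "0 \<le> \<epsilon>" using a0 C by (simp add: \<epsilon>_def)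
    have summand: "\<bar>e \<tau> (\<lambda>x. F x * G x) - expectation F * e \<tau> G\<bar> \<le> \<epsilon> * b * p \<tau>" for \<tau>
    proof (cases "p \<tau> > 0")
      case False
      hence "p \<tau> = 0" using p0[of \<tau>] by simp
      thus ?thesis using ebd[OF mG b, of \<tau>] ebd[OF mFG FG, of \<tau>] by simp
    next
      case True
      have fac: "e \<tau> (\<lambda>x. F x * G x) = e \<tau> F / p \<tau> * e \<tau> G"
        using markov_factorization[OF mrf V UV F W WV G a b, of \<tau>] True
        by (simp add: e_def p_def c\<tau>_def field_simps)
      \<comment> \<open>The expectation of \<open>F\<close> is the average of its conditional
        expectations with weights \<open>p\<close>, so it differs from each of them by at most their
        oscillation.\<close>
      have "e \<tau> F / p \<tau> - expectation F = (\<Sum>\<tau>'\<in>T. p \<tau>' * (e \<tau> F / p \<tau>) - e \<tau>' F)"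
        by (simp add: tot[OF mF a] sum_subtractf p1 flip: sum_distrib_right sum_divide_distrib)
      hence "\<bar>e \<tau> F / p \<tau> - expectation F\<bar> = \<bar>\<Sum>\<tau>'\<in>T. p \<tau>' * (e \<tau> F / p \<tau>) - e \<tau>' F\<bar>"
        by (simp only:)
      also have "\<dots> \<le> (\<Sum>\<tau>'\<in>T. \<epsilon> * p \<tau>')"
      proof (rule order_trans[OF sum_abs sum_mono])
        fix \<tau>'
        show "\<bar>p \<tau>' * (e \<tau> F / p \<tau>) - e \<tau>' F\<bar> \<le> \<epsilon> * p \<tau>'"
        proof (cases "p \<tau>' > 0")
          case False
          hence "p \<tau>' = 0" using p0[of \<tau>'] by simp
          thus ?thesis using ebd[OF mF a, of \<tau>'] by simp
        next
          case p': True
          have "p \<tau>' * (e \<tau> F / p \<tau>) - e \<tau>' F = (e \<tau> F / p \<tau> - e \<tau>' F / p \<tau>') * p \<tau>'"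
            using p' by (simp add: field_simps)
          thus ?thesis using osc[OF True p'] p' by (simp add: abs_mult mult_right_mono)
        qed
      qed
      also have "\<dots> = \<epsilon>" by (simp add: p1 flip: sum_distrib_left)
      finally have d: "\<bar>e \<tau> F / p \<tau> - expectation F\<bar> \<le> \<epsilon>" .
      have "\<bar>(e \<tau> F / p \<tau> - expectation F) * e \<tau> G\<bar> \<le> \<epsilon> * (b * p \<tau>)"
        unfolding abs_mult by (intro mult_mono d ebd[OF mG b] \<epsilon>0) auto
      thus ?thesis by (simp add: fac left_diff_distrib mult.assoc)
    qed
    have "expectation (\<lambda>x. F x * G x) - expectation F * expectation G
       = (\<Sum>\<tau>\<in>T. e \<tau> (\<lambda>x. F x * G x) - expectation F * e \<tau> G)"
      by (simp only: tot[OF mFG FG] tot[OF mG b] sum_subtractf sum_distrib_left)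
    hence "\<bar>expectation (\<lambda>x. F x * G x) - expectation F * expectation G\<bar>
       = \<bar>\<Sum>\<tau>\<in>T. e \<tau> (\<lambda>x. F x * G x) - expectation F * e \<tau> G\<bar>" by (simp only:)
    also have "\<dots> \<le> (\<Sum>\<tau>\<in>T. \<epsilon> * b * p \<tau>)"
      by (rule order_trans[OF sum_abs sum_mono]) (rule summand)
    also have "\<dots> = \<epsilon> * b" by (simp add: p1 flip: sum_distrib_left)
    finally show "\<bar>expectation (\<lambda>x. F x * G x) - expectation F * expectation G\<bar>
         \<le> 2 * C * a * b * real (card U) * exp (- c * real r)"
      by (simp add: \<epsilon>_def mult_ac)
  qed (use C in auto)
qed

end

section \<open>Summation over boxes\<close>

text \<open>A single term of the exponential series. Since \<open>t\<close> is free, a power can be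
  paid for by an exponential of arbitrarily small rate.\<close>

lemma power_le_exp:
  fixes x t :: real
  assumes "0 < t" "0 \<le> x"
  shows "x ^ n \<le> fact n / t ^ n * exp (t * x)"
proof -
  have "(t * x) ^ n / fact n \<le> (\<Sum>k. (t * x) ^ k / fact k)"
    using sum_le_suminf[of "\<lambda>k. (t * x) ^ k / fact k" "{n}"] exp_converges[of "t * x"] assms
    by (simp add: sums_iff divide_inverse mult.commute)
  also have "\<dots> = exp (t * x)" by (simp add: exp_def divide_inverse mult.commute)
  finally show ?thesis using assms by (simp add: power_mult_distrib field_simps)
qed

lemma poly_times_geometric_bound:
  fixes q :: real
  assumes q: "0 < q" "q < 1"
  obtains A where "A > 0" "\<And>m. real (2 * m + 1) ^ p * q ^ m \<le> A * sqrt q ^ m"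
proof -
  \<comment> \<open>Chosen so that \<open>exp (2 * t) * q = sqrt q\<close>: half of the geometric
    decay absorbs the polynomial.\<close>
  define t where "t = - ln q / 4"
  have t: "t > 0" using q by (simp add: t_def)
  show thesis
  proof (rule that[of "fact p / t ^ p * exp t"])
    fix m
    have "real (2 * m + 1) ^ p \<le> fact p / t ^ p * exp (t * real (2 * m + 1))"
      by (rule power_le_exp[OF t]) simp
    also have "\<dots> = fact p / t ^ p * exp t * exp (real m * (2 * t))"
      by (simp add: exp_add [symmetric] algebra_simps)
    also have "exp (real m * (2 * t)) = exp (2 * t) ^ m" by (rule exp_of_nat_mult)
    finally have "real (2 * m + 1) ^ p * q ^ m \<le> fact p / t ^ p * exp t * exp (2 * t) ^ m * q ^ m"
      using q by (intro mult_right_mono) auto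
    also have "\<dots> = fact p / t ^ p * exp t * (exp (2 * t) * q) ^ m" by (simp add: power_mult_distrib)
    also have "exp (2 * t) * q = sqrt q"
    proof -
      have "exp (2 * t) * q = exp (2 * t + ln q)" using q by (simp add: exp_add)
      also have "\<dots> = exp (ln q / 2)" by (simp add: t_def)
      also have "\<dots> = sqrt q"
        using q by (simp add: sqrt_def root_powr_inverse powr_def)
      finally show ?thesis .
    qed
    finally show "real (2 * m + 1) ^ p * q ^ m \<le> fact p / t ^ p * exp t * sqrt q ^ m" .
  qed (use t in auto)
qed

lemma sum_infsum_swap:
  fixes f :: "'i \<Rightarrow> 'b \<Rightarrow> real"
  assumes "finite I" "\<And>i. i \<in> I \<Longrightarrow> f i summable_on A"
  shows "(\<lambda>x. \<Sum>i\<in>I. f i x) summable_on A" "infsum (\<lambda>x. \<Sum>i\<in>I. f i x) A = (\<Sum>i\<in>I. infsum (f i) A)"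
  using assms by (induction I rule: finite_induct) (auto simp: summable_on_add infsum_add)

section \<open>Lattice sums and boundary effects of boxes\<close>

definition supn :: "int ^ 'd::finite \<Rightarrow> nat" where
  "supn k = (MAX l. nat \<bar>k $ l\<bar>)"

lemma component_le_supn: "\<bar>k $ l\<bar> \<le> int (supn k)"
proof -
  have "nat \<bar>k $ l\<bar> \<le> supn k" unfolding supn_def by (rule Max_ge) auto
  thus ?thesis by simp
qed

lemma near_iff_supn: "near r i j \<longleftrightarrow> supn (j - i) \<le> r"
proof -
  have "supn (j - i) \<le> r \<longleftrightarrow> (\<forall>l. nat \<bar>(j - i) $ l\<bar> \<le> r)" unfolding supn_def by simp
  thus ?thesis by (simp add: near_def nat_le_iff abs_minus_commute)
qed

text \<open>Summation over shells: at most \<open>(2 * s + 1) ^ d\<close> sites have sup norm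
  \<open>s\<close>, and the weight adds one more power.\<close>

lemma summable_on_geometric_supn:
  fixes z :: real
  assumes "0 < z" "z < 1"
  shows "(\<lambda>k :: int ^ 'd::finite. real (2 * supn k + 1) * z ^ supn k) summable_on UNIV"
proof (rule nonneg_bdd_above_summable_on)
  let ?g = "\<lambda>s. real (2 * s + 1) * z ^ s" and ?d = "CARD('d)"
  obtain A where A: "A > 0" "\<And>m. real (2 * m + 1) ^ Suc ?d * z ^ m \<le> A * sqrt z ^ m"
    using poly_times_geometric_bound[OF assms] by blast
  have r: "0 < sqrt z" "sqrt z < 1" using assms by auto
  show "bdd_above (sum (\<lambda>k :: int ^ 'd. ?g (supn k)) ` {F. F \<subseteq> UNIV \<and> finite F})"
  proof (rule bdd_aboveI2)
    fix F :: "(int ^ 'd) set" assume "F \<in> {F. F \<subseteq> UNIV \<and> finite F}"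
    hence F: "finite F" by simp
    have "(\<Sum>k\<in>F. ?g (supn k)) = (\<Sum>s\<in>supn ` F. \<Sum>k\<in>{k \<in> F. supn k = s}. ?g (supn k))"
      by (rule sum.image_gen[OF F])
    also have "\<dots> \<le> (\<Sum>s\<in>supn ` F. A * sqrt z ^ s)"
    proof (rule sum_mono)
      fix s
      have "(\<Sum>k\<in>{k \<in> F. supn k = s}. ?g (supn k)) = real (card {k \<in> F. supn k = s}) * ?g s" by simp
      also have "\<dots> \<le> real ((2 * s + 1) ^ ?d) * ?g s"
      proof (intro mult_right_mono of_nat_mono)
        have "card {k \<in> F. supn k = s} \<le> card {k :: int ^ 'd. near s 0 k}"
          by (rule card_mono[OF finite_near]) (auto simp: near_iff_supn)
        thus "card {k \<in> F. supn k = s} \<le> (2 * s + 1) ^ ?d" by (simp only: card_near)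
      qed (use assms in auto)
      also have "\<dots> = real (2 * s + 1) ^ Suc ?d * z ^ s" by (simp only: of_nat_power power_Suc mult_ac)
      also have "\<dots> \<le> A * sqrt z ^ s" by (rule A)
      finally show "(\<Sum>k\<in>{k \<in> F. supn k = s}. ?g (supn k)) \<le> A * sqrt z ^ s" .
    qed
    also have "\<dots> \<le> (\<Sum>s. A * sqrt z ^ s)"
      by (rule sum_le_suminf) (use F A r in \<open>auto intro!: summable_mult summable_geometric\<close>)
    finally show "(\<Sum>k\<in>F. ?g (supn k)) \<le> (\<Sum>s. A * sqrt z ^ s)" .
  qed
qed (use assms in auto)

lemma Gamma_box_eq: "Gamma_box n = {i :: int ^ 'd::finite. \<forall>l. i $ l \<in> {0..<int n}}"
  by (auto simp: Gamma_box_def)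

lemma finite_Gamma_box [simp]: "finite (Gamma_box n :: (int ^ 'd::finite) set)"
  unfolding Gamma_box_eq by (rule card_vec_box) simp

lemma card_Gamma_box: "card (Gamma_box n :: (int ^ 'd::finite) set) = n ^ CARD('d)"
  unfolding Gamma_box_eq by (subst card_vec_box) auto

text \<open>Some coordinate \<open>l\<close> must leave its interval. This confines
  \<open>i $ l\<close> to at most \<open>\<bar>k $ l\<bar>\<close> values at one end, while the
  other coordinates remain free.\<close>

lemma card_Gamma_box_exit:
  fixes k :: "int ^ 'd::finite"
  shows "card {i \<in> Gamma_box n. i + k \<notin> Gamma_box n} \<le> CARD('d) * supn k * n ^ (CARD('d) - 1)"
proof -
  define E where "E l = {i :: int ^ 'd. \<forall>m. i $ m \<in> (if m = l then {a \<in> {0..<int n}. a + k $ l \<notin> {0..<int n}} else {0..<int n})}" for l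
  have finA: "finite (if m = l then {a \<in> {0..<int n}. a + k $ l \<notin> {0..<int n}} else {0..<int n})" for m l
    by (rule finite_subset[of _ "{0..<int n}"]) auto
  have fin: "finite (E l)" for l unfolding E_def by (rule card_vec_box[OF finA])
  have "{i \<in> Gamma_box n. i + k \<notin> Gamma_box n} \<subseteq> (\<Union>l. E l)"
  proof
    fix i assume i: "i \<in> {i \<in> Gamma_box n. i + k \<notin> Gamma_box n}"
    then obtain l where "i $ l + k $ l \<notin> {0..<int n}" by (auto simp: Gamma_box_eq)
    with i have "i \<in> E l" by (auto simp: E_def Gamma_box_eq)
    thus "i \<in> (\<Union>l. E l)" by blast
  qed
  hence "card {i \<in> Gamma_box n. i + k \<notin> Gamma_box n} \<le> card (\<Union>l. E l)"
    by (intro card_mono finite_UN_I) (auto simp: fin)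
  also have "\<dots> \<le> (\<Sum>l\<in>UNIV. card (E l))" by (rule card_UN_le) simp
  also have "\<dots> \<le> (\<Sum>l\<in>(UNIV :: 'd set). supn k * n ^ (CARD('d) - 1))"
  proof (rule sum_mono)
    fix l
    let ?A = "{a \<in> {0..<int n}. a + k $ l \<notin> {0..<int n}}"
    have "card (E l) = (\<Prod>m\<in>UNIV. card (if m = l then ?A else {0..<int n}))"
      unfolding E_def by (rule card_vec_box[OF finA])
    also have "\<dots> = card ?A * (\<Prod>m\<in>UNIV - {l}. card (if m = l then ?A else {0..<int n}))"
      by (subst prod.remove[of _ l]) auto
    also have "(\<Prod>m\<in>UNIV - {l}. card (if m = l then ?A else {0..<int n})) = (\<Prod>m\<in>UNIV - {l}. n)"
      by (rule prod.cong) auto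
    also have "\<dots> = n ^ (CARD('d) - 1)" by (simp add: card_Diff_singleton)
    also have "card ?A \<le> supn k"
    proof -
      have "?A \<subseteq> (if 0 \<le> k $ l then {int n - k $ l ..< int n} else {0 ..< - k $ l})" by auto
      hence "card ?A \<le> card (if 0 \<le> k $ l then {int n - k $ l ..< int n} else {0 ..< - k $ l})"
        by (intro card_mono) auto
      also have "\<dots> = nat \<bar>k $ l\<bar>" by simp
      also have "\<dots> \<le> supn k" using component_le_supn[of k l] by simp
      finally show ?thesis .
    qed
    finally show "card (E l) \<le> supn k * n ^ (CARD('d) - 1)" by simp
  qed
  also have "\<dots> = CARD('d) * supn k * n ^ (CARD('d) - 1)" by simp
  finally show ?thesis .
qed

text \<open>Of the full series at each site of the box, only the displacements leaving the box are
  lost, and there are few exits for each displacement. The weight \<open>2 * supn k + 1\<close>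
  dominates both 1, for absolute summability, and \<open>supn k\<close>, for the number of
  exits.\<close>

lemma box_variance:
  fixes c :: "int ^ 'd::finite \<Rightarrow> real"
  assumes sc: "(\<lambda>k. real (2 * supn k + 1) * \<bar>c k\<bar>) summable_on UNIV"
  defines "L \<equiv> (\<Sum>\<^sub>\<infinity>k. real (2 * supn k + 1) * \<bar>c k\<bar>)"
  shows "c summable_on UNIV"
    and "n \<ge> 1 \<Longrightarrow> \<bar>real (n ^ CARD('d)) * (\<Sum>\<^sub>\<infinity>k. c k) - (\<Sum>i\<in>Gamma_box n. \<Sum>j\<in>Gamma_box n. c (j - i))\<bar>
      \<le> real CARD('d) * L * real (n ^ (CARD('d) - 1))"
proof -
  let ?d = "CARD('d)"
  let ?\<Gamma> = "Gamma_box n :: (int ^ 'd) set"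
  have ac: "(\<lambda>k. \<bar>c k\<bar>) summable_on UNIV"
  proof (rule summable_on_comparison_test[OF sc])
    show "\<bar>c k\<bar> \<le> real (2 * supn k + 1) * \<bar>c k\<bar>" for k
      using mult_right_mono[of 1 "real (2 * supn k + 1)" "\<bar>c k\<bar>"] by simp
  qed auto
  show c: "c summable_on UNIV" by (rule abs_summable_summable) (use ac in simp)
  have sub: "(\<lambda>k. \<bar>c k\<bar> * of_bool (P k)) summable_on UNIV" for P
    by (rule summable_on_comparison_test[OF ac]) auto
  have subc: "(\<lambda>k. c k * of_bool (P k)) summable_on UNIV" for P
    by (rule abs_summable_summable) (use sub[of P] in \<open>simp add: abs_mult\<close>)
  have 1: "\<bar>(\<Sum>\<^sub>\<infinity>k. c k) - (\<Sum>j\<in>?\<Gamma>. c (j - i))\<bar> \<le> (\<Sum>\<^sub>\<infinity>k. \<bar>c k\<bar> * of_bool (i + k \<notin> ?\<Gamma>))" for i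
  proof -
    let ?S = "(\<lambda>j. j - i) ` ?\<Gamma>"
    have S: "k \<in> ?S \<longleftrightarrow> i + k \<in> ?\<Gamma>" for k
      by (auto simp: image_iff) (metis add_diff_cancel_left')
    have "(\<Sum>\<^sub>\<infinity>k. c k) = (\<Sum>\<^sub>\<infinity>k. c k * of_bool (i + k \<in> ?\<Gamma>) + c k * of_bool (i + k \<notin> ?\<Gamma>))"
      by (rule infsum_cong) auto
    also have "\<dots> = (\<Sum>\<^sub>\<infinity>k. c k * of_bool (i + k \<in> ?\<Gamma>)) + (\<Sum>\<^sub>\<infinity>k. c k * of_bool (i + k \<notin> ?\<Gamma>))"
      by (rule infsum_add[OF subc subc])
    also have "(\<Sum>\<^sub>\<infinity>k. c k * of_bool (i + k \<in> ?\<Gamma>)) = infsum c ?S"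
      by (rule infsum_cong_neutral) (auto simp: S)
    also have "\<dots> = (\<Sum>j\<in>?\<Gamma>. c (j - i))"
      by (simp add: sum.reindex inj_on_def)
    finally have "\<bar>(\<Sum>\<^sub>\<infinity>k. c k) - (\<Sum>j\<in>?\<Gamma>. c (j - i))\<bar> = norm (\<Sum>\<^sub>\<infinity>k. c k * of_bool (i + k \<notin> ?\<Gamma>))"
      by simp
    also have "\<dots> \<le> (\<Sum>\<^sub>\<infinity>k. norm (c k * of_bool (i + k \<notin> ?\<Gamma>)))"
      by (rule norm_infsum_bound) (use sub in \<open>simp add: abs_mult\<close>)
    finally show ?thesis by (simp add: abs_mult)
  qed
  assume n: "n \<ge> 1"
  have "\<bar>real (n ^ ?d) * (\<Sum>\<^sub>\<infinity>k. c k) - (\<Sum>i\<in>?\<Gamma>. \<Sum>j\<in>?\<Gamma>. c (j - i))\<bar>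
      = \<bar>\<Sum>i\<in>?\<Gamma>. (\<Sum>\<^sub>\<infinity>k. c k) - (\<Sum>j\<in>?\<Gamma>. c (j - i))\<bar>"
    by (simp add: sum_subtractf card_Gamma_box)
  also have "\<dots> \<le> (\<Sum>i\<in>?\<Gamma>. \<Sum>\<^sub>\<infinity>k. \<bar>c k\<bar> * of_bool (i + k \<notin> ?\<Gamma>))"
    by (rule order_trans[OF sum_abs sum_mono[OF 1]])
  \<comment> \<open>Interchanging the sums replaces the loss at each site by a count of exiting
    sites for each displacement \<open>k\<close>.\<close>
  also have "\<dots> = (\<Sum>\<^sub>\<infinity>k. \<Sum>i\<in>?\<Gamma>. \<bar>c k\<bar> * of_bool (i + k \<notin> ?\<Gamma>))"
    by (rule sum_infsum_swap(2)[symmetric]) (auto simp: sub)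
  also have "\<dots> \<le> (\<Sum>\<^sub>\<infinity>k. real ?d * real (n ^ (?d - 1)) * (real (2 * supn k + 1) * \<bar>c k\<bar>))"
  proof (rule infsum_mono)
    show "(\<lambda>k. \<Sum>i\<in>?\<Gamma>. \<bar>c k\<bar> * of_bool (i + k \<notin> ?\<Gamma>)) summable_on UNIV"
      by (rule sum_infsum_swap(1)) (auto simp: sub)
    show "(\<lambda>k. real ?d * real (n ^ (?d - 1)) * (real (2 * supn k + 1) * \<bar>c k\<bar>)) summable_on UNIV"
      by (rule summable_on_cmult_right[OF sc])
    fix k
    have "(\<Sum>i\<in>?\<Gamma>. \<bar>c k\<bar> * of_bool (i + k \<notin> ?\<Gamma>)) = \<bar>c k\<bar> * real (card {i \<in> ?\<Gamma>. i + k \<notin> ?\<Gamma>})"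
      by (simp add: of_bool_def sum.If_cases Int_def flip: sum_distrib_left)
    also have "\<dots> \<le> \<bar>c k\<bar> * real (?d * supn k * n ^ (?d - 1))"
      by (intro mult_left_mono of_nat_mono card_Gamma_box_exit) auto
    also have "\<dots> = real ?d * real (n ^ (?d - 1)) * (real (supn k) * \<bar>c k\<bar>)" by simp
    also have "\<dots> \<le> real ?d * real (n ^ (?d - 1)) * (real (2 * supn k + 1) * \<bar>c k\<bar>)"
      by (intro mult_left_mono mult_right_mono) auto
    finally show "(\<Sum>i\<in>?\<Gamma>. \<bar>c k\<bar> * of_bool (i + k \<notin> ?\<Gamma>)) \<le> \<dots>" .
  qed
  also have "\<dots> = real ?d * L * real (n ^ (?d - 1))"
    unfolding L_def by (subst infsum_cmult_right[OF sc]) simp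
  finally show "\<bar>real (n ^ ?d) * (\<Sum>\<^sub>\<infinity>k. c k) - (\<Sum>i\<in>?\<Gamma>. \<Sum>j\<in>?\<Gamma>. c (j - i))\<bar> \<le> real ?d * L * real (n ^ (?d - 1))" .
qed

section \<open>Correlations of an observable\<close>

context prob_space
begin

lemma expectation_diff_le:
  fixes f g :: "'a \<Rightarrow> real"
  assumes "integrable M f" "integrable M g" "AE x in M. \<bar>f x - g x\<bar> \<le> c"
  shows "\<bar>expectation f - expectation g\<bar> \<le> c"
proof -
  have "\<bar>expectation f - expectation g\<bar> = \<bar>expectation (\<lambda>x. f x - g x)\<bar>" using assms by simp
  also have "\<dots> \<le> expectation (\<lambda>x. \<bar>f x - g x\<bar>)" by (rule integral_abs_bound)
  also have "\<dots> \<le> expectation (\<lambda>x. c)" using assms by (intro integral_mono_AE) auto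
  finally show ?thesis by (simp add: prob_space)
qed

text \<open>The variance of \<open>\<bar>Y - E Y\<bar>\<close> is nonnegative, so the mean absolute
  deviation is at most the standard deviation.\<close>

lemma abs_deviation_le:
  fixes Y :: "'a \<Rightarrow> real"
  assumes Y: "Y \<in> borel_measurable M" "\<And>x. \<bar>Y x\<bar> \<le> c" and V: "expectation (\<lambda>x. (Y x - expectation Y)\<^sup>2) \<le> V"
  shows "expectation (\<lambda>x. \<bar>e - Y x\<bar>) \<le> \<bar>e - expectation Y\<bar> + sqrt V"
proof -
  have iY: "integrable M Y" using Y by (intro integrable_const_bound[of _ c]) auto
  let ?Z = "\<lambda>x. \<bar>Y x - expectation Y\<bar>"
  have iZ: "integrable M ?Z" using iY by auto
  have iZ2: "integrable M (\<lambda>x. (?Z x)\<^sup>2)"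
  proof (rule integrable_const_bound[of _ "(c + \<bar>expectation Y\<bar>)\<^sup>2"])
    have "?Z x \<le> c + \<bar>expectation Y\<bar>" for x using Y(2)[of x] by linarith
    hence "(?Z x)\<^sup>2 \<le> (c + \<bar>expectation Y\<bar>)\<^sup>2" for x by (intro power_mono) auto
    thus "AE x in M. norm ((?Z x)\<^sup>2) \<le> (c + \<bar>expectation Y\<bar>)\<^sup>2" by simp
  qed (use Y in measurable)
  have "(expectation ?Z)\<^sup>2 \<le> expectation (\<lambda>x. (?Z x)\<^sup>2)"
    using variance_positive[of ?Z] variance_eq[OF iZ iZ2] by linarith
  also have "\<dots> \<le> V" using V by simp
  finally have "expectation ?Z \<le> sqrt V" by (rule real_le_rsqrt)
  moreover have "expectation (\<lambda>x. \<bar>e - Y x\<bar>) \<le> expectation (\<lambda>x. \<bar>e - expectation Y\<bar> + ?Z x)"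
    using iY by (intro integral_mono) (auto intro!: Bochner_Integration.integrable_add Bochner_Integration.integrable_diff integrable_abs)
  ultimately show ?thesis using iZ by (simp add: prob_space)
qed

lemma variance_sum:
  fixes Y :: "'i \<Rightarrow> 'a \<Rightarrow> real"
  assumes "finite I" and Y: "\<And>i. i \<in> I \<Longrightarrow> Y i \<in> borel_measurable M" "\<And>i x. i \<in> I \<Longrightarrow> \<bar>Y i x\<bar> \<le> y"
  shows "expectation (\<lambda>x. ((\<Sum>i\<in>I. Y i x) - expectation (\<lambda>x. \<Sum>i\<in>I. Y i x))\<^sup>2)
    = (\<Sum>i\<in>I. \<Sum>j\<in>I. expectation (\<lambda>x. Y i x * Y j x) - expectation (Y i) * expectation (Y j))"
proof -
  have iY: "integrable M (Y i)" if "i \<in> I" for i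
    using Y that by (intro integrable_const_bound[of _ y]) auto
  have iYY: "integrable M (\<lambda>x. Y i x * Y j x)" if "i \<in> I" "j \<in> I" for i j
  proof (rule integrable_const_bound[of _ "y * y"])
    have "\<bar>Y i x * Y j x\<bar> \<le> y * y" for x
      unfolding abs_mult using Y(2)[OF that(1), of x] Y(2)[OF that(2), of x] by (intro mult_mono) auto
    thus "AE x in M. norm (Y i x * Y j x) \<le> y * y" by simp
  qed (use Y that in auto)
  let ?S = "\<lambda>x. \<Sum>i\<in>I. Y i x"
  have iS: "integrable M ?S" using iY by auto
  have S2: "(?S x)\<^sup>2 = (\<Sum>i\<in>I. \<Sum>j\<in>I. Y i x * Y j x)" for x
    by (simp add: power2_eq_square sum_product)
  have iS2: "integrable M (\<lambda>x. (?S x)\<^sup>2)" unfolding S2 using iYY by auto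
  have "expectation (\<lambda>x. (?S x)\<^sup>2) = (\<Sum>i\<in>I. \<Sum>j\<in>I. expectation (\<lambda>x. Y i x * Y j x))"
    unfolding S2 using iYY by (simp add: Bochner_Integration.integral_sum)
  moreover have "(expectation ?S)\<^sup>2 = (\<Sum>i\<in>I. \<Sum>j\<in>I. expectation (Y i) * expectation (Y j))"
    using iY by (simp add: Bochner_Integration.integral_sum power2_eq_square sum_product)
  ultimately show ?thesis using variance_eq[OF iS iS2] by (simp add: sum_subtractf)
qed

end

lemma local_on_sum: "(\<And>i. i \<in> I \<Longrightarrow> local_on (f i) U) \<Longrightarrow> local_on (\<lambda>x. \<Sum>i\<in>I. f i x) U"
  unfolding local_on_def by (meson sum.cong)

lemma centred_box_eq: "centred_box m = {j. near m 0 j}"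
  by (auto simp: centred_box_def near_def abs_le_iff) (metis minus_le_iff)+

text \<open>
  The functions \<open>a m\<close> are local approximations of the observable \<open>v\<close>; the rate \<open>q\<close> dominates both the
  mixing rate and the approximation rate coming from the Hoelder condition.
\<close>

locale mixing_observable = config_prob M
  for M :: "(int ^ 'd::finite \<Rightarrow> 'a::{finite,discrete_topology}) measure" +
  fixes v :: "(int ^ 'd \<Rightarrow> 'a) \<Rightarrow> real" and a :: "nat \<Rightarrow> (int ^ 'd \<Rightarrow> 'a) \<Rightarrow> real" and B C K q :: real
  assumes mix: "finite U \<Longrightarrow> finite W \<Longrightarrow> local_on F U \<Longrightarrow> local_on G W \<Longrightarrow>
       (\<And>x. \<bar>F x\<bar> \<le> f) \<Longrightarrow> (\<And>x. \<bar>G x\<bar> \<le> g) \<Longrightarrow>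
       (\<And>u w. u \<in> U \<Longrightarrow> w \<in> W \<Longrightarrow> \<not> near (Suc r) u w) \<Longrightarrow>
       \<bar>expectation (\<lambda>x. F x * G x) - expectation F * expectation G\<bar> \<le> C * f * g * real (card U) * q ^ r"
    and q: "0 < q" "q < 1" and B: "B > 0" and C: "C \<ge> 0" and K: "K \<ge> 0"
    and inv: "distr M M (shift i) = M"
    and v_meas [measurable]: "v \<in> borel_measurable M" and v_bound: "\<bar>v x\<bar> \<le> B" and v_mean: "expectation v = 0"
    and a_local: "local_on (a m) (centred_box m)" and a_bound: "\<bar>a m x\<bar> \<le> B"
    and approx: "AE x in M. \<bar>v x - a m x\<bar> \<le> K * q ^ m"
begin

lemma expectation_shift:
  "(f :: _ \<Rightarrow> real) \<in> borel_measurable M \<Longrightarrow> expectation (\<lambda>x. f (shift i x)) = expectation f"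
  using integral_distr[of "shift i" M M f] by (simp add: inv)

lemma AE_shift: "AE x in M. P x \<Longrightarrow> AE x in M. P (shift i x)"
  by (rule AE_distrD[OF shift_measurable, of P i, unfolded inv])

lemma a_shift_local: "local_on (\<lambda>x. a m (shift i x)) {j. near m i j}"
proof -
  have "near m 0 j \<Longrightarrow> near m i (i + j)" for j using near_translate[of m i 0 j] by simp
  thus ?thesis using a_local[of m] unfolding local_on_def centred_box_eq by (simp add: shift_def)
qed

lemma a_meas [measurable]: "a m \<in> borel_measurable M"
  using local_measurable a_local centred_box_eq finite_near by metis

definition cor :: "int ^ 'd \<Rightarrow> real" where
  "cor k = expectation (\<lambda>x. v x * v (shift k x))"

lemma mult_bound: "\<bar>s\<bar> \<le> B \<Longrightarrow> \<bar>t\<bar> \<le> B \<Longrightarrow> \<bar>s * t\<bar> \<le> B * B"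
  unfolding abs_mult using B by (intro mult_mono) auto

lemma a_mean: "\<bar>expectation (a m)\<bar> \<le> K * q ^ m"
  using expectation_diff_le[OF integrable_bounded[OF v_meas v_bound] integrable_bounded[OF a_meas a_bound] approx]
  by (simp add: v_mean)

text \<open>By stationarity \<open>cor (j - i)\<close> is the correlation of the observables at
  \<open>i\<close> and \<open>j\<close>. The two factors are replaced one after the other, at a cost
  of \<open>B * K * q ^ m\<close> each.\<close>

lemma pair_correlation:
  "\<bar>expectation (\<lambda>x. a m (shift i x) * a m (shift j x)) - cor (j - i)\<bar> \<le> 2 * B * K * q ^ m"
proof -
  have "cor (j - i) = expectation (\<lambda>x. v (shift i x) * v (shift (j - i) (shift i x)))"
    unfolding cor_def by (rule expectation_shift[symmetric]) measurable
  hence c: "cor (j - i) = expectation (\<lambda>x. v (shift i x) * v (shift j x))" by (simp add: shift_shift)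
  show ?thesis unfolding c
  proof (rule expectation_diff_le)
    show "integrable M (\<lambda>x. a m (shift i x) * a m (shift j x))"
      by (rule integrable_bounded[of _ "B * B"]) (measurable, intro mult_bound a_bound)
    show "integrable M (\<lambda>x. v (shift i x) * v (shift j x))"
      by (rule integrable_bounded[of _ "B * B"]) (measurable, intro mult_bound v_bound)
    show "AE x in M. \<bar>a m (shift i x) * a m (shift j x) - v (shift i x) * v (shift j x)\<bar> \<le> 2 * B * K * q ^ m"
      using AE_shift[OF approx[of m], of i] AE_shift[OF approx[of m], of j]
    proof eventually_elim
      case (elim x)
      have "a m (shift i x) * a m (shift j x) - v (shift i x) * v (shift j x)
        = - (a m (shift i x) * (v (shift j x) - a m (shift j x)) + (v (shift i x) - a m (shift i x)) * v (shift j x))"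
        by (simp add: algebra_simps)
      moreover have "\<bar>a m (shift i x) * (v (shift j x) - a m (shift j x))\<bar> \<le> B * (K * q ^ m)"
        unfolding abs_mult using B by (intro mult_mono a_bound elim) auto
      moreover have "\<bar>(v (shift i x) - a m (shift i x)) * v (shift j x)\<bar> \<le> (K * q ^ m) * B"
        unfolding abs_mult using B K q by (intro mult_mono v_bound elim) auto
      ultimately show ?case by (simp add: mult_ac)
    qed
  qed
qed

text \<open>Two balls of radius \<open>m\<close> and a gap of \<open>m + 1\<close> add up to
  \<open>3 * m + 1\<close>. The coefficient 3 consists of 2 from the replacement of both factors and
  1 from the product of the means, as \<open>a m\<close> need not be centred.\<close>

lemma cor_decay:
  assumes "\<not> near (3 * m + 1) i j"
  shows "\<bar>cor (j - i)\<bar> \<le> (C * B * B + 3 * B * K) * real ((2 * m + 1) ^ CARD('d)) * q ^ m"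
proof -
  let ?p = "real ((2 * m + 1) ^ CARD('d))"
  have p: "1 \<le> ?p" using of_nat_mono[OF one_le_power[of "2 * m + 1" "CARD('d)"], where 'a=real] by simp
  have "\<bar>expectation (\<lambda>x. a m (shift i x) * a m (shift j x))
      - expectation (\<lambda>x. a m (shift i x)) * expectation (\<lambda>x. a m (shift j x))\<bar>
    \<le> C * B * B * real (card {k. near m i k}) * q ^ m"
  proof (rule mix[OF finite_near finite_near a_shift_local a_shift_local a_bound a_bound])
    fix u w assume "u \<in> {k. near m i k}" "w \<in> {k. near m j k}"
    hence u: "near m i u" and w: "near m w j" by (auto simp: near_sym)
    show "\<not> near (Suc m) u w"
    proof
      assume "near (Suc m) u w"
      from near_trans[OF near_trans[OF u this] w] have "near (3 * m + 1) i j"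
        by (rule near_mono) simp
      with assms show False by simp
    qed
  qed
  hence 1: "\<bar>expectation (\<lambda>x. a m (shift i x) * a m (shift j x)) - expectation (a m) * expectation (a m)\<bar>
    \<le> C * B * B * ?p * q ^ m"
    by (simp add: expectation_shift[OF a_meas] card_near)
  have 2: "\<bar>expectation (a m) * expectation (a m)\<bar> \<le> B * (K * q ^ m)"
  proof -
    have "\<bar>expectation (a m) - expectation (\<lambda>_. 0)\<bar> \<le> B"
      by (rule expectation_diff_le[OF integrable_bounded[OF a_meas a_bound]]) (use a_bound in auto)
    thus ?thesis unfolding abs_mult using B by (intro mult_mono a_mean) auto
  qed
  have "\<bar>s - t\<bar> \<le> x \<Longrightarrow> \<bar>t\<bar> \<le> y \<Longrightarrow> \<bar>s - u\<bar> \<le> 2 * y \<Longrightarrow> \<bar>u\<bar> \<le> x + 3 * y" for s t u x y :: real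
    by linarith
  from this[OF 1 2, of "cor (j - i)"] pair_correlation[of m i j]
  have "\<bar>cor (j - i)\<bar> \<le> C * B * B * ?p * q ^ m + 3 * (B * K * q ^ m)"
    by (simp only: mult.assoc)
  also have "\<dots> \<le> C * B * B * ?p * q ^ m + 3 * (B * K * q ^ m) * ?p"
    using p B K q mult_left_mono[OF p, of "3 * (B * K * q ^ m)"] by simp
  also have "\<dots> = (C * B * B + 3 * B * K) * ?p * q ^ m" by (simp add: algebra_simps)
  finally show ?thesis .
qed

lemma cor_geometric:
  obtains A z where "0 < A" "0 < z" "z < 1" "\<And>k. \<bar>cor k\<bar> \<le> A * z ^ supn k"
proof -
  obtain A' where A': "A' > 0" "\<And>m. real (2 * m + 1) ^ CARD('d) * q ^ m \<le> A' * sqrt q ^ m"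
    using poly_times_geometric_bound[OF q] by blast
  define A1 where "A1 = C * B * B + 3 * B * K"
  have A1: "0 \<le> A1" using C B K by (simp add: A1_def)
  \<comment> \<open>Distance about \<open>3 * m\<close> gives decay \<open>sqrt q ^ m\<close> once
    the ball size is absorbed; the cube root expresses this per unit of distance.\<close>
  define z where "z = root 3 (sqrt q)"
  have z: "0 < z" "z < 1" using q by (auto simp: z_def)
  have z3: "z ^ 3 = sqrt q" using q by (simp add: z_def)
  have cb: "\<bar>cor k\<bar> \<le> B * B" for k
  proof -
    have i: "integrable M (\<lambda>x. v x * v (shift k x))"
      by (rule integrable_bounded[of _ "B * B"]) (measurable, intro mult_bound v_bound)
    have "\<bar>cor k - expectation (\<lambda>_. 0)\<bar> \<le> B * B" unfolding cor_def
      by (rule expectation_diff_le[OF i]) (auto intro!: AE_I2 mult_bound v_bound)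
    thus ?thesis by simp
  qed
  show thesis
  \<comment> \<open>The division by \<open>z ^ 4\<close> pays for the rounding in
    \<open>supn k \<le> 3 * m + 4\<close>, and for \<open>supn k < 2\<close>, where the trivial
    bound \<open>B * B\<close> is used.\<close>
  proof (rule that[of "(A1 * A' + B * B) / z ^ 4" z])
    show "0 < (A1 * A' + B * B) / z ^ 4" using A1 A' B z by (simp add: add_nonneg_pos)
    fix k :: "int ^ 'd"
    let ?s = "supn k"
    have "\<bar>cor k\<bar> * z ^ 4 \<le> (A1 * A' + B * B) * z ^ ?s"
    proof (cases "?s \<ge> 2")
      case False
      hence "\<bar>cor k\<bar> * z ^ 4 \<le> (B * B) * z ^ ?s"
        using z B cb by (intro mult_mono power_decreasing) auto
      also have "\<dots> \<le> (A1 * A' + B * B) * z ^ ?s" using A1 A' z by (intro mult_right_mono) auto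
      finally show ?thesis .
    next
      case True
      define m where "m = (?s - 2) div 3"
      have m: "3 * m + 1 < ?s" "?s \<le> 3 * m + 4" using True by (auto simp: m_def)
      have "\<bar>cor (k - 0)\<bar> \<le> A1 * real ((2 * m + 1) ^ CARD('d)) * q ^ m"
        unfolding A1_def by (rule cor_decay) (use m in \<open>simp add: near_iff_supn\<close>)
      also have "\<dots> = A1 * (real (2 * m + 1) ^ CARD('d) * q ^ m)" by (simp only: of_nat_power mult.assoc)
      also have "\<dots> \<le> A1 * (A' * sqrt q ^ m)" by (intro mult_left_mono A' A1)
      also have "sqrt q ^ m = z ^ (3 * m)" by (simp only: power_mult z3)
      finally have "\<bar>cor k\<bar> * z ^ 4 \<le> A1 * (A' * z ^ (3 * m)) * z ^ 4" using z by (simp add: mult_right_mono)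
      also have "\<dots> = A1 * A' * z ^ (3 * m + 4)" by (simp only: power_add mult_ac)
      also have "\<dots> \<le> (A1 * A' + B * B) * z ^ ?s"
        using z A1 A' B m by (intro mult_mono power_decreasing) auto
      finally show ?thesis .
    qed
    thus "\<bar>cor k\<bar> \<le> (A1 * A' + B * B) / z ^ 4 * z ^ ?s" using z by (simp add: field_simps)
  qed (use z in auto)
qed

section \<open>The limiting variance\<close>

lemma cor_weighted_summable: "(\<lambda>k. real (2 * supn k + 1) * \<bar>cor k\<bar>) summable_on UNIV"
proof -
  obtain A z where A: "0 < A" "0 < z" "z < 1" "\<And>k. \<bar>cor k\<bar> \<le> A * z ^ supn k"
    using cor_geometric by blast
  have "(\<lambda>k :: int ^ 'd. A * (real (2 * supn k + 1) * z ^ supn k)) summable_on UNIV"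
    by (rule summable_on_cmult_right[OF summable_on_geometric_supn[OF A(2,3)]])
  thus ?thesis
  proof (rule summable_on_comparison_test)
    fix k :: "int ^ 'd"
    have "real (2 * supn k + 1) * \<bar>cor k\<bar> \<le> real (2 * supn k + 1) * (A * z ^ supn k)"
      by (rule mult_left_mono[OF A(4)]) simp
    thus "real (2 * supn k + 1) * \<bar>cor k\<bar> \<le> A * (real (2 * supn k + 1) * z ^ supn k)"
      by (simp only: mult_ac)
  qed simp
qed

definition L :: real where "L = (\<Sum>\<^sub>\<infinity>k. real (2 * supn k + 1) * \<bar>cor k\<bar>)"

lemma L_nonneg: "0 \<le> L"
  unfolding L_def by (rule infsum_nonneg) simp

definition lim_var :: real where "lim_var = (\<Sum>\<^sub>\<infinity>k. cor k)"

lemma cor_summable: "cor summable_on UNIV"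
  by (rule box_variance(1)[OF cor_weighted_summable])

lemma correlation_sum:
  "n \<ge> 1 \<Longrightarrow> \<bar>real (n ^ CARD('d)) * lim_var - (\<Sum>i\<in>Gamma_box n. \<Sum>j\<in>Gamma_box n. cor (j - i))\<bar>
      \<le> real CARD('d) * L * real (n ^ (CARD('d) - 1))"
  unfolding L_def lim_var_def by (rule box_variance(2)[OF cor_weighted_summable])

text \<open>The double sum is the second moment of the sum of the observable over the box.\<close>

lemma correlation_sum_nonneg: "0 \<le> (\<Sum>i\<in>Gamma_box n. \<Sum>j\<in>Gamma_box n. cor (j - i))"
proof -
  have c: "cor (j - i) = expectation (\<lambda>x. v (shift i x) * v (shift j x))" for i j
  proof -
    have "cor (j - i) = expectation (\<lambda>x. v (shift i x) * v (shift (j - i) (shift i x)))"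
      unfolding cor_def by (rule expectation_shift[symmetric]) measurable
    thus ?thesis by (simp add: shift_shift)
  qed
  have i: "integrable M (\<lambda>x. v (shift i x) * v (shift j x))" for i j
    by (rule integrable_bounded[of _ "B * B"]) (measurable, intro mult_bound v_bound)
  have "(\<Sum>i\<in>Gamma_box n. \<Sum>j\<in>Gamma_box n. cor (j - i))
      = expectation (\<lambda>x. (\<Sum>i\<in>Gamma_box n. v (shift i x))\<^sup>2)"
    unfolding power2_eq_square sum_product c using i by (simp add: Bochner_Integration.integral_sum)
  thus ?thesis by simp
qed

text \<open>Nonnegative second moments differ from \<open>n ^ d * lim_var\<close> by order
  \<open>n ^ (d - 1)\<close>, so a negative limit would be contradicted by large
  \<open>n\<close>.\<close>

lemma lim_var_nonneg: "0 \<le> lim_var"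
proof (rule ccontr)
  assume "\<not> 0 \<le> lim_var"
  hence neg: "lim_var < 0" by simp
  obtain n :: nat where n: "real CARD('d) * L / (- lim_var) < real n" using reals_Archimedean2 by blast
  have "0 \<le> real CARD('d) * L / (- lim_var)" using neg L_nonneg by (intro divide_nonneg_pos) auto
  with n have "0 < real n" by linarith
  hence n1: "n \<ge> 1" by simp
  have pw: "real (n ^ CARD('d)) = real n * real (n ^ (CARD('d) - 1))"
    by (metis of_nat_mult power_eq_if zero_less_card_finite less_numeral_extra(3))
  have "- (real (n ^ CARD('d)) * lim_var) \<le> real CARD('d) * L * real (n ^ (CARD('d) - 1))"
    using correlation_sum[OF n1] correlation_sum_nonneg[of n] by linarith
  hence "(- lim_var * real n) * real (n ^ (CARD('d) - 1)) \<le> real CARD('d) * L * real (n ^ (CARD('d) - 1))"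
    unfolding pw by (simp only: mult_ac mult_minus_left)
  hence "- lim_var * real n \<le> real CARD('d) * L"
    by (rule mult_right_le_imp_le) (use n1 in simp)
  moreover have "real CARD('d) * L < real n * (- lim_var)"
    using n neg pos_divide_less_eq[of "- lim_var"] by auto
  ultimately show False by (simp add: mult.commute)
qed

end

section \<open>Rate of normal approximation\<close>

context mixing_observable
begin

lemma card_near_le:
  assumes "2 * r + 1 \<le> k"
  shows "real (card {j :: int ^ 'd. near r i j}) \<le> real (k ^ CARD('d))"
  unfolding card_near using assms by (intro of_nat_mono power_mono) auto

text \<open>Valid for every \<open>l\<close> with \<open>N ^ 2 * q ^ l \<le> 1\<close>; the square
  is there because errors are summed over pairs of sites. \<open>20 * l + 20\<close> exceeds the
  side \<open>18 * l + 7\<close> of the largest ball that occurs, of radius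
  \<open>9 * l + 3\<close>.\<close>

lemma field_berry_esseen:
  assumes pos: "lim_var > 0" and n: "n \<ge> 1" and small: "q ^ l \<le> 1 / (real (n ^ CARD('d)))\<^sup>2"
  defines "D \<equiv> (20 * l + 20) ^ CARD('d)" and "N \<equiv> real (n ^ CARD('d))" and "\<sigma> \<equiv> sqrt lim_var"
  defines "w \<equiv> 1 + (lim_var + real CARD('d) * L + 2 * B * K) / lim_var"
  shows "\<bar>prob {x. (\<Sum>i\<in>Gamma_box n. v (shift i x)) / (\<sigma> * sqrt N) \<le> t} - cdf std_normal_distribution t\<bar>
    \<le> (16 * ((B / \<sigma>) ^ 3 * (1 + w) + B / \<sigma> + (C * B + K) / \<sigma> + (5 * B * K + C * B * B) / lim_var
            + (B / \<sigma>)\<^sup>2 * (2 + C)) + K / \<sigma>) * ((real D)\<^sup>2 / sqrt N)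
      + 16 * (real CARD('d) * L / lim_var) / real n"
proof -
  let ?d = "CARD('d)"
  let ?\<Gamma> = "Gamma_box n :: (int ^ 'd) set"
  \<comment> \<open>The limiting and not the exact standard deviation; the mismatch is charged to
    \<open>e2\<close>.\<close>
  define s where "s = \<sigma> * sqrt N"
  define \<xi> where "\<xi> i x = a l (shift i x) / s" for i x
  \<comment> \<open>Radius \<open>l\<close> for each of the two local functions and a gap of
    \<open>l + 1\<close>.\<close>
  define nb where "nb i = {j \<in> ?\<Gamma>. near (3 * l + 1) i j}" for i
  define W where "W = (\<lambda>x. \<Sum>i\<in>?\<Gamma>. \<xi> i x)"
  define \<eta> where "\<eta> = (\<lambda>i x. \<Sum>j\<in>nb i. \<xi> j x)"
  define \<beta> where "\<beta> = B / s"
  \<comment> \<open>Dominates both \<open>2 * B * K\<close> from \<open>pair_correlation\<close> and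
    the constant of \<open>cor_decay\<close>.\<close>
  define A2 where "A2 = 5 * B * K + C * B * B"
  have \<sigma>: "\<sigma> > 0" "\<sigma>\<^sup>2 = lim_var" using pos by (auto simp: \<sigma>_def)
  have N1: "1 \<le> N" unfolding N_def using of_nat_mono[OF one_le_power[OF n, of ?d], where 'a=real] by simp
  have sN: "sqrt N > 0" "sqrt N * sqrt N = N" "1 \<le> sqrt N" using N1 by auto
  have s: "s > 0" "s\<^sup>2 = lim_var * N" using \<sigma> sN by (auto simp: s_def power2_eq_square algebra_simps) 
  have card\<Gamma>: "real (card ?\<Gamma>) = N" by (simp add: N_def card_Gamma_box)
  have D1: "1 \<le> D" unfolding D_def by (rule one_le_power) simp
  have Dr: "1 \<le> real D" "real D \<le> (real D)\<^sup>2" "1 \<le> (real D)\<^sup>2"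
    using D1 of_nat_mono[OF D1, where 'a=real] by (auto simp: self_le_power)
  have \<beta>: "\<beta> > 0" "\<beta> = B / \<sigma> / sqrt N" using B s by (auto simp: \<beta>_def s_def)
  have q0: "0 \<le> q ^ l" using q by simp
  have NNq: "N\<^sup>2 * q ^ l \<le> 1"
    using mult_left_mono[OF small[folded N_def], of "N\<^sup>2"] N1 by simp
  have Nq: "N * q ^ l \<le> 1"
  proof -
    have "N * q ^ l \<le> N\<^sup>2 * q ^ l" using N1 q0 by (intro mult_right_mono) (auto simp: self_le_power)
    with NNq show ?thesis by linarith
  qed
  have card_D: "real (card {j :: int ^ 'd. near r i j}) \<le> real D" if "2 * r + 1 \<le> 20 * l + 20" for r i
    unfolding D_def by (rule card_near_le[OF that])
  have nb: "nb i \<subseteq> ?\<Gamma>" "finite (nb i)" "card (nb i) \<le> D" for i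
  proof -
    show "nb i \<subseteq> ?\<Gamma>" "finite (nb i)" by (auto simp: nb_def)
    have "card (nb i) \<le> card {j. near (3 * l + 1) i j}"
      by (rule card_mono[OF finite_near]) (auto simp: nb_def)
    thus "card (nb i) \<le> D" using card_D[of "3 * l + 1" i] by simp
  qed
  have m\<xi> [measurable]: "\<xi> i \<in> borel_measurable M" for i unfolding \<xi>_def [abs_def] by measurable
  have b\<xi>: "\<bar>\<xi> i x\<bar> \<le> \<beta>" for i x
    unfolding \<xi>_def \<beta>_def abs_divide using s a_bound by (simp add: divide_right_mono)
  have l\<xi>: "local_on (\<xi> i) {j. near l i j}" for i
    using a_shift_local[of l i] unfolding local_on_def \<xi>_def by metis
  have m\<eta> [measurable]: "\<eta> i \<in> borel_measurable M" for i unfolding \<eta>_def by measurable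
  have b\<eta>: "\<bar>\<eta> i x\<bar> \<le> real D * \<beta>" for i x
  proof -
    have "\<bar>\<eta> i x\<bar> \<le> (\<Sum>j\<in>nb i. \<bar>\<xi> j x\<bar>)" unfolding \<eta>_def by (rule sum_abs)
    also have "\<dots> \<le> real (card (nb i)) * \<beta>" using b\<xi> by (intro sum_bounded_above) auto
    also have "\<dots> \<le> real D * \<beta>" using nb(3)[of i] \<beta>(1) by (intro mult_right_mono) auto
    finally show ?thesis .
  qed
  have mW [measurable]: "W \<in> borel_measurable M" unfolding W_def by measurable
  have E\<xi>\<xi>: "expectation (\<lambda>x. \<xi> i x * \<xi> j x) = expectation (\<lambda>x. a l (shift i x) * a l (shift j x)) / s\<^sup>2" for i j
    by (simp add: \<xi>_def power2_eq_square)
  have i\<xi>\<xi>: "integrable M (\<lambda>x. \<xi> i x * \<xi> j x)" for i j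
  proof (rule integrable_bounded[of _ "\<beta> * \<beta>"])
    show "\<bar>\<xi> i x * \<xi> j x\<bar> \<le> \<beta> * \<beta>" for x unfolding abs_mult using b\<xi> \<beta>(1) by (intro mult_mono) auto
  qed measurable

  \<comment> \<open>The first summand is the covariance bound; the second accounts for the nonzero
    mean of \<open>a l\<close>.\<close>
  define e1 where "e1 = C * \<beta> * 1 * real D * q ^ l + K * q ^ l / s"
  have dec: "\<bar>expectation (\<lambda>x. \<xi> i x * g (W x - \<eta> i x))\<bar> \<le> e1"
    if i: "i \<in> ?\<Gamma>" and g [measurable]: "g \<in> borel_measurable borel" and g1: "\<And>w. \<bar>g w\<bar> \<le> 1" for i g
  proof -
    let ?far = "?\<Gamma> - nb i"
    have W\<eta>: "W x - \<eta> i x = (\<Sum>j\<in>?far. \<xi> j x)" for x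
      unfolding W_def \<eta>_def using nb by (simp add: sum_diff)
    have "local_on (\<lambda>x. \<Sum>j\<in>?far. \<xi> j x) (\<Union>j\<in>?far. {k. near l j k})"
      by (intro local_on_sum local_on_mono[OF l\<xi>]) auto
    hence loc: "local_on (\<lambda>x. g (W x - \<eta> i x)) (\<Union>j\<in>?far. {k. near l j k})"
      unfolding W\<eta> local_on_def by metis
    have "\<bar>expectation (\<lambda>x. \<xi> i x * g (W x - \<eta> i x)) - expectation (\<xi> i) * expectation (\<lambda>x. g (W x - \<eta> i x))\<bar>
       \<le> C * \<beta> * 1 * real (card {j. near l i j}) * q ^ l"
    proof (rule mix[OF finite_near _ l\<xi> loc b\<xi> g1])
      fix u w assume u: "u \<in> {j. near l i j}" and "w \<in> (\<Union>j\<in>?far. {k. near l j k})"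
      then obtain j where j: "j \<in> ?far" "near l j w" by blast
      show "\<not> near (Suc l) u w"
      proof
        assume "near (Suc l) u w"
        moreover have "near l i u" "near l w j" using u j(2) by (simp_all add: near_sym)
        ultimately have "near (l + Suc l + l) i j" by (intro near_trans[OF near_trans])
        hence "near (3 * l + 1) i j" by (rule near_mono) simp
        with j show False by (simp add: nb_def)
      qed
    qed (use finite_near in auto)
    also have "\<dots> \<le> C * \<beta> * 1 * real D * q ^ l"
      using C \<beta>(1) q0 card_D[of l i] by (intro mult_right_mono mult_left_mono mult_nonneg_nonneg) auto
    finally have 1: "\<bar>expectation (\<lambda>x. \<xi> i x * g (W x - \<eta> i x)) - expectation (\<xi> i) * expectation (\<lambda>x. g (W x - \<eta> i x))\<bar>
       \<le> C * \<beta> * 1 * real D * q ^ l" .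
    have "\<bar>expectation (\<lambda>x. g (W x - \<eta> i x)) - expectation (\<lambda>_. 0)\<bar> \<le> 1"
      by (rule expectation_diff_le[OF integrable_bounded[of _ 1]]) (use g1 in auto)
    moreover have "\<bar>expectation (\<xi> i)\<bar> \<le> K * q ^ l / s"
      unfolding \<xi>_def [abs_def] using s a_mean[of l]
      by (simp add: expectation_shift[OF a_meas] abs_divide divide_right_mono)
    ultimately have 2: "\<bar>expectation (\<xi> i) * expectation (\<lambda>x. g (W x - \<eta> i x))\<bar> \<le> K * q ^ l / s * 1"
      unfolding abs_mult using K q0 s by (intro mult_mono) auto
    show ?thesis using 1 2 unfolding e1_def by linarith
  qed

  \<comment> \<open>Pairs that are kept differ from \<open>cor\<close> by the truncation error; for
    those dropped, \<open>cor\<close> itself is small. Hence a sum over neighbouring pairs still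
    reproduces the limiting variance.\<close>
  have pairs: "\<bar>(\<Sum>i\<in>?\<Gamma>. \<Sum>j\<in>?\<Gamma>. if P i j then expectation (\<lambda>x. a l (shift i x) * a l (shift j x)) else 0) - N * lim_var\<bar>
      \<le> N\<^sup>2 * (A2 * real D * q ^ l) + real ?d * L * real (n ^ (?d - 1))"
    if P: "\<And>i j. \<not> P i j \<Longrightarrow> \<not> near (3 * l + 1) i j" for P
  proof -
    let ?e = "\<lambda>i j. if P i j then expectation (\<lambda>x. a l (shift i x) * a l (shift j x)) else 0"
    have pt: "\<bar>?e i j - cor (j - i)\<bar> \<le> A2 * real D * q ^ l" for i j
    proof (cases "P i j")
      case True
      have "\<bar>?e i j - cor (j - i)\<bar> \<le> 2 * B * K * q ^ l" using True pair_correlation[of l i j] by simp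
      also have "\<dots> \<le> A2 * q ^ l" using B K C q0 by (intro mult_right_mono) (auto simp: A2_def)
      also have "\<dots> \<le> A2 * q ^ l * real D"
        using B K C q0 Dr mult_left_mono[OF Dr(1), of "A2 * q ^ l"] by (simp add: A2_def)
      finally show ?thesis by (simp only: mult_ac)
    next
      case False
      have "\<bar>cor (j - i)\<bar> \<le> (C * B * B + 3 * B * K) * real ((2 * l + 1) ^ ?d) * q ^ l"
        by (rule cor_decay[OF P[OF False]])
      also have "\<dots> \<le> A2 * real D * q ^ l"
      proof (intro mult_right_mono mult_mono of_nat_mono)
        show "(2 * l + 1) ^ ?d \<le> D" unfolding D_def by (rule power_mono) auto
      qed (use B K C q0 in \<open>auto simp: A2_def\<close>)
      finally show ?thesis using False by simp
    qed
    have "\<bar>(\<Sum>i\<in>?\<Gamma>. \<Sum>j\<in>?\<Gamma>. ?e i j) - (\<Sum>i\<in>?\<Gamma>. \<Sum>j\<in>?\<Gamma>. cor (j - i))\<bar>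
        = \<bar>\<Sum>i\<in>?\<Gamma>. \<Sum>j\<in>?\<Gamma>. ?e i j - cor (j - i)\<bar>" by (simp only: sum_subtractf)
    also have "\<dots> \<le> (\<Sum>i\<in>?\<Gamma>. \<Sum>j\<in>?\<Gamma>. A2 * real D * q ^ l)"
      by (rule order_trans[OF sum_abs sum_mono], rule order_trans[OF sum_abs sum_mono], rule pt)
    also have "\<dots> = N\<^sup>2 * (A2 * real D * q ^ l)" by (simp add: card\<Gamma> power2_eq_square)
    finally show ?thesis using correlation_sum[OF n] unfolding N_def by linarith
  qed
  have pw: "N = real n * real (n ^ (?d - 1))"
    unfolding N_def by (metis of_nat_mult power_eq_if zero_less_card_finite less_numeral_extra(3))
  \<comment> \<open>Division by \<open>s ^ 2 = lim_var * N\<close> turns the volume of the boundary,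
    \<open>n ^ (d - 1)\<close>, into \<open>1 / n\<close>.\<close>
  have norm_le: "\<bar>E / s\<^sup>2 - 1\<bar> \<le> A2 / lim_var * (real D / N) + real ?d * L / lim_var / real n"
    if "\<bar>E - N * lim_var\<bar> \<le> N\<^sup>2 * (A2 * real D * q ^ l) + real ?d * L * real (n ^ (?d - 1))" for E
  proof -
    have "N\<^sup>2 * (A2 * real D * q ^ l) = A2 * real D * (N\<^sup>2 * q ^ l)" by simp
    also have "\<dots> \<le> A2 * real D * 1" using NNq B K C by (intro mult_left_mono) (auto simp: A2_def)
    finally have "\<bar>E - N * lim_var\<bar> \<le> A2 * real D + real ?d * L * real (n ^ (?d - 1))" using that by simp
    hence "\<bar>E - N * lim_var\<bar> / s\<^sup>2 \<le> (A2 * real D + real ?d * L * real (n ^ (?d - 1))) / s\<^sup>2"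
      by (rule divide_right_mono) simp
    moreover have "\<bar>E - N * lim_var\<bar> / s\<^sup>2 = \<bar>E / s\<^sup>2 - 1\<bar>"
    proof -
      have "E / s\<^sup>2 - 1 = (E - N * lim_var) / s\<^sup>2" using s pos N1 by (simp add: field_simps)
      thus ?thesis by (simp add: abs_divide)
    qed
    moreover have "(A2 * real D + real ?d * L * real (n ^ (?d - 1))) / s\<^sup>2
       = A2 / lim_var * (real D / N) + real ?d * L / lim_var / real n"
    proof -
      have "real ?d * L * real (n ^ (?d - 1)) / (lim_var * N) = real ?d * L / lim_var / real n"
        unfolding pw using n by simp
      thus ?thesis unfolding s by (simp add: add_divide_distrib)
    qed
    ultimately show ?thesis by simp
  qed

  \<comment> \<open>Origin of \<open>w\<close>: the absolute value is at most 1 plus the square, and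
    the second moment of \<open>W\<close> is bounded uniformly in \<open>n\<close>.\<close>
  have mom: "expectation (\<lambda>x. \<bar>W x\<bar>) \<le> w"
  proof -
    have W2: "(W x)\<^sup>2 = (\<Sum>i\<in>?\<Gamma>. \<Sum>j\<in>?\<Gamma>. \<xi> i x * \<xi> j x)" for x
      by (simp add: W_def power2_eq_square sum_product)
    have iW2: "integrable M (\<lambda>x. (W x)\<^sup>2)" unfolding W2 using i\<xi>\<xi> by auto
    have "expectation (\<lambda>x. (W x)\<^sup>2) = (\<Sum>i\<in>?\<Gamma>. \<Sum>j\<in>?\<Gamma>. expectation (\<lambda>x. a l (shift i x) * a l (shift j x))) / s\<^sup>2"
      unfolding W2 using i\<xi>\<xi> by (simp add: Bochner_Integration.integral_sum E\<xi>\<xi> sum_divide_distrib)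
    also have "(\<Sum>i\<in>?\<Gamma>. \<Sum>j\<in>?\<Gamma>. expectation (\<lambda>x. a l (shift i x) * a l (shift j x)))
        \<le> N * (lim_var + real ?d * L + 2 * B * K)"
    proof -
      have "(\<Sum>i\<in>?\<Gamma>. \<Sum>j\<in>?\<Gamma>. expectation (\<lambda>x. a l (shift i x) * a l (shift j x)))
         \<le> (\<Sum>i\<in>?\<Gamma>. \<Sum>j\<in>?\<Gamma>. cor (j - i) + 2 * B * K * q ^ l)"
      proof (intro sum_mono)
        show "expectation (\<lambda>x. a l (shift i x) * a l (shift j x)) \<le> cor (j - i) + 2 * B * K * q ^ l" for i j
          using pair_correlation[of l i j] by linarith
      qed
      also have "\<dots> = (\<Sum>i\<in>?\<Gamma>. \<Sum>j\<in>?\<Gamma>. cor (j - i)) + 2 * B * K * (N\<^sup>2 * q ^ l)"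
        by (simp add: sum.distrib card\<Gamma> power2_eq_square)
      also have "\<dots> \<le> (N * lim_var + real ?d * L * real (n ^ (?d - 1))) + 2 * B * K * 1"
        using correlation_sum[OF n] NNq B K unfolding N_def [symmetric] by (intro add_mono mult_left_mono) auto
      also have "\<dots> \<le> (N * lim_var + real ?d * L * N) + 2 * B * K * N"
      proof (intro add_mono mult_left_mono order_refl)
        show "real (n ^ (?d - 1)) \<le> N" unfolding N_def using n by (intro of_nat_mono power_increasing) auto
      qed (use L_nonneg B K N1 in auto)
      also have "\<dots> = N * (lim_var + real ?d * L + 2 * B * K)" by (simp add: algebra_simps)
      finally show ?thesis .
    qed
    finally have "expectation (\<lambda>x. (W x)\<^sup>2) \<le> N * (lim_var + real ?d * L + 2 * B * K) / s\<^sup>2"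
      by (simp add: divide_right_mono)
    also have "\<dots> = (lim_var + real ?d * L + 2 * B * K) / lim_var" using s N1 by simp
    finally have E2: "expectation (\<lambda>x. (W x)\<^sup>2) \<le> (lim_var + real ?d * L + 2 * B * K) / lim_var" .
    have "expectation (\<lambda>x. \<bar>W x\<bar>) \<le> expectation (\<lambda>x. 1 + (W x)\<^sup>2)"
    proof (rule integral_mono')
      show "\<bar>W x\<bar> \<le> 1 + (W x)\<^sup>2" for x
        using sum_squares_bound[of "\<bar>W x\<bar>" 1] by simp
    qed (use iW2 in auto)
    also have "\<dots> = 1 + expectation (\<lambda>x. (W x)\<^sup>2)" using iW2 by (simp add: prob_space)
    finally show ?thesis using E2 by (simp add: w_def)
  qed

  \<comment> \<open>The summands of the quadratic sum are again local and bounded, so the mixing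
    estimate also controls their covariances and yields concentration of \<open>Q\<close> about its
    mean.\<close>
  define Y where "Y i x = \<xi> i x * \<eta> i x" for i x
  define Q where "Q x = (\<Sum>i\<in>?\<Gamma>. Y i x)" for x
  have mY [measurable]: "Y i \<in> borel_measurable M" for i unfolding Y_def [abs_def] by measurable
  have bY: "\<bar>Y i x\<bar> \<le> \<beta> * (real D * \<beta>)" for i x
    unfolding Y_def abs_mult using b\<xi> b\<eta> \<beta>(1) by (intro mult_mono) auto
  \<comment> \<open>Neighbours reach to \<open>3 * l + 1\<close>, and the function at each of them
    extends \<open>l\<close> further.\<close>
  have lY: "local_on (Y i) {k. near (4 * l + 1) i k}" for i
  proof -
    have "{k. near l i k} \<subseteq> {k. near (4 * l + 1) i k}" by (auto intro: near_mono)
    hence 1: "local_on (\<xi> i) {k. near (4 * l + 1) i k}" by (rule local_on_mono[OF l\<xi>])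
    have "{k. near l j k} \<subseteq> {k. near (4 * l + 1) i k}" if "j \<in> nb i" for j
    proof
      fix k assume "k \<in> {k. near l j k}"
      with that have "near (3 * l + 1) i j" "near l j k" by (auto simp: nb_def)
      hence "near ((3 * l + 1) + l) i k" by (rule near_trans)
      thus "k \<in> {k. near (4 * l + 1) i k}" by (auto intro: near_mono)
    qed
    hence 2: "local_on (\<eta> i) {k. near (4 * l + 1) i k}"
      unfolding \<eta>_def by (intro local_on_sum local_on_mono[OF l\<xi>])
    show ?thesis using 1 2 unfolding local_on_def Y_def by metis
  qed
  define y where "y = \<beta> * (real D * \<beta>)"
  have y0: "0 \<le> y" using \<beta>(1) by (simp add: y_def)
  \<comment> \<open>\<open>9 * l + 3\<close> is two radii \<open>4 * l + 1\<close> plus a gap of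
    \<open>l + 1\<close>. Pairs within this range get the trivial bound, and each site has at most
    \<open>D\<close> of them.\<close>
  have cov: "expectation (\<lambda>x. Y i x * Y j x) - expectation (Y i) * expectation (Y j)
      \<le> (if near (9 * l + 3) i j then 2 * y\<^sup>2 else 0) + C * y\<^sup>2 * real D * q ^ l" for i j
  proof (cases "near (9 * l + 3) i j")
    case True
    have iYY: "integrable M (\<lambda>x. Y i x * Y j x)" and bYY: "\<bar>Y i x * Y j x\<bar> \<le> y * y" for x
    proof -
      show b: "\<bar>Y i x * Y j x\<bar> \<le> y * y" for x
        unfolding abs_mult using bY y0 by (intro mult_mono) (auto simp: y_def)
      show "integrable M (\<lambda>x. Y i x * Y j x)" by (rule integrable_bounded[OF _ b]) measurable
    qed
    have "\<bar>expectation (\<lambda>x. Y i x * Y j x) - expectation (\<lambda>_. 0)\<bar> \<le> y * y"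
      by (rule expectation_diff_le[OF iYY]) (use bYY in auto)
    moreover have EY: "\<bar>expectation (Y k) - expectation (\<lambda>_. 0)\<bar> \<le> y" for k
      by (rule expectation_diff_le[OF integrable_bounded[OF mY bY]]) (use bY in \<open>auto simp: y_def\<close>)
    have "\<bar>expectation (Y i) * expectation (Y j)\<bar> \<le> y * y"
      unfolding abs_mult using EY[of i] EY[of j] y0 by (intro mult_mono) auto
    moreover have "0 \<le> C * y\<^sup>2 * real D * q ^ l" using C q0 by simp
    ultimately show ?thesis using True by (simp add: power2_eq_square)
  next
    case False
    have "\<bar>expectation (\<lambda>x. Y i x * Y j x) - expectation (Y i) * expectation (Y j)\<bar>
      \<le> C * y * y * real (card {k. near (4 * l + 1) i k}) * q ^ l"
    proof (rule mix[OF finite_near finite_near lY lY])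
      fix u w assume "u \<in> {k. near (4 * l + 1) i k}" "w \<in> {k. near (4 * l + 1) j k}"
      hence u: "near (4 * l + 1) i u" and w: "near (4 * l + 1) w j" by (auto simp: near_sym)
      show "\<not> near (Suc l) u w"
      proof
        assume "near (Suc l) u w"
        from near_trans[OF near_trans[OF u this] w] have "near (9 * l + 3) i j"
          by (rule near_mono) simp
        with False show False by simp
      qed
    qed (use bY in \<open>auto simp: y_def\<close>)
    also have "\<dots> \<le> C * y * y * real D * q ^ l"
      using C y0 q0 card_D[of "4 * l + 1" i] by (intro mult_right_mono mult_left_mono mult_nonneg_nonneg) auto
    finally show ?thesis using False by (simp add: power2_eq_square mult.assoc)
  qed
  have VQ: "expectation (\<lambda>x. (Q x - expectation Q)\<^sup>2) \<le> ((B / \<sigma>)\<^sup>2 * (2 + C) * ((real D)\<^sup>2 / sqrt N))\<^sup>2"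
  proof -
    have "expectation (\<lambda>x. (Q x - expectation Q)\<^sup>2)
      = (\<Sum>i\<in>?\<Gamma>. \<Sum>j\<in>?\<Gamma>. expectation (\<lambda>x. Y i x * Y j x) - expectation (Y i) * expectation (Y j))"
      unfolding Q_def by (rule variance_sum[OF _ mY bY]) auto
    also have "\<dots> \<le> (\<Sum>i\<in>?\<Gamma>. \<Sum>j\<in>?\<Gamma>. (if near (9 * l + 3) i j then 2 * y\<^sup>2 else 0) + C * y\<^sup>2 * real D * q ^ l)"
      by (intro sum_mono cov)
    also have "\<dots> \<le> (\<Sum>i\<in>?\<Gamma>. real D * (2 * y\<^sup>2) + N * (C * y\<^sup>2 * real D * q ^ l))"
    proof (rule sum_mono)
      fix i
      have "(\<Sum>j\<in>?\<Gamma>. if near (9 * l + 3) i j then 2 * y\<^sup>2 else 0) = real (card (?\<Gamma> \<inter> {j. near (9 * l + 3) i j})) * (2 * y\<^sup>2)"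
        by (simp add: sum.If_cases)
      also have "\<dots> \<le> real (card {j. near (9 * l + 3) i j}) * (2 * y\<^sup>2)"
        by (intro mult_right_mono of_nat_mono card_mono finite_near) auto
      also have "\<dots> \<le> real D * (2 * y\<^sup>2)" by (intro mult_right_mono card_D) auto
      finally show "(\<Sum>j\<in>?\<Gamma>. (if near (9 * l + 3) i j then 2 * y\<^sup>2 else 0) + C * y\<^sup>2 * real D * q ^ l)
         \<le> real D * (2 * y\<^sup>2) + N * (C * y\<^sup>2 * real D * q ^ l)"
        by (simp add: sum.distrib card\<Gamma>)
    qed
    also have "\<dots> = N * y\<^sup>2 * real D * (2 + C * (N * q ^ l))" by (simp add: card\<Gamma> algebra_simps)
    also have "\<dots> \<le> N * y\<^sup>2 * real D * (2 + C * 1)"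
      using Nq C N1 by (intro mult_left_mono add_left_mono) auto
    also have "N * y\<^sup>2 = ((B / \<sigma>)\<^sup>2)\<^sup>2 * ((real D)\<^sup>2 / N)"
    proof -
      have "\<beta> * \<beta> = (B / \<sigma>)\<^sup>2 / N"
        unfolding \<beta>(2) by (simp only: times_divide_times_eq power2_eq_square sN(2))
      moreover have "y = \<beta> * \<beta> * real D" by (simp add: y_def)
      ultimately have "y = (B / \<sigma>)\<^sup>2 * real D / N" by simp
      thus ?thesis using N1 by (simp add: power2_eq_square mult_ac)
    qed
    \<comment> \<open>The third power of \<open>D\<close> is raised to the fourth and
      \<open>2 + C\<close> to its square, so that the bound becomes a perfect square.\<close>
    also have "((B / \<sigma>)\<^sup>2)\<^sup>2 * ((real D)\<^sup>2 / N) * real D * (2 + C * 1)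
        \<le> ((B / \<sigma>)\<^sup>2)\<^sup>2 * ((real D)\<^sup>2 / N) * (real D)\<^sup>2 * (2 + C)\<^sup>2"
    proof (intro mult_mono)
      show "2 + C * 1 \<le> (2 + C)\<^sup>2" using C self_le_power[of "2 + C" 2] by simp
    qed (use Dr N1 C in auto)
    also have "\<dots> = ((B / \<sigma>)\<^sup>2 * (2 + C) * ((real D)\<^sup>2 / sqrt N))\<^sup>2"
      using N1 by (simp add: power_mult_distrib power_divide power2_eq_square[of "(real D)\<^sup>2"])
    finally show ?thesis .
  qed
  \<comment> \<open>Error of mixing and truncation in the mean of \<open>Q\<close>, boundary effect
    of the box, and standard deviation of \<open>Q\<close>.\<close>
  define e2 where "e2 = A2 / lim_var * (real D / N) + real ?d * L / lim_var / real n
      + (B / \<sigma>)\<^sup>2 * (2 + C) * ((real D)\<^sup>2 / sqrt N)"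
  have var: "expectation (\<lambda>x. \<bar>1 - (\<Sum>i\<in>?\<Gamma>. \<xi> i x * \<eta> i x)\<bar>) \<le> e2"
  proof -
    have bQ: "\<bar>Q x\<bar> \<le> N * y" for x
    proof -
      have "\<bar>Q x\<bar> \<le> (\<Sum>i\<in>?\<Gamma>. \<bar>Y i x\<bar>)" unfolding Q_def by (rule sum_abs)
      also have "\<dots> \<le> real (card ?\<Gamma>) * y" using bY by (intro sum_bounded_above) (auto simp: y_def)
      finally show ?thesis by (simp add: card\<Gamma>)
    qed
    have mQ: "Q \<in> borel_measurable M" unfolding Q_def by measurable
    have "Q x = (\<Sum>i\<in>?\<Gamma>. \<Sum>j\<in>?\<Gamma>. if near (3 * l + 1) i j then \<xi> i x * \<xi> j x else 0)" for x
      by (simp add: Q_def Y_def \<eta>_def nb_def sum_distrib_left sum.If_cases Int_def)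
    hence "expectation Q = expectation (\<lambda>x. \<Sum>i\<in>?\<Gamma>. \<Sum>j\<in>?\<Gamma>. if near (3 * l + 1) i j then \<xi> i x * \<xi> j x else 0)"
      by (rule Bochner_Integration.integral_cong[OF refl])
    also have "\<dots> = (\<Sum>i\<in>?\<Gamma>. \<Sum>j\<in>?\<Gamma>. expectation (\<lambda>x. if near (3 * l + 1) i j then \<xi> i x * \<xi> j x else 0))"
    proof -
      have "integrable M (\<lambda>x. if near (3 * l + 1) i j then \<xi> i x * \<xi> j x else 0)" for i j
        using i\<xi>\<xi> by (cases "near (3 * l + 1) i j") auto
      thus ?thesis by (simp add: Bochner_Integration.integral_sum)
    qed
    also have "\<dots> = (\<Sum>i\<in>?\<Gamma>. \<Sum>j\<in>?\<Gamma>. if near (3 * l + 1) i j then expectation (\<lambda>x. a l (shift i x) * a l (shift j x)) else 0) / s\<^sup>2"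
      unfolding sum_divide_distrib by (intro sum.cong) (auto simp: E\<xi>\<xi>)
    finally have EQ: "expectation Q = \<dots>" .
    have "\<bar>expectation Q - 1\<bar> \<le> A2 / lim_var * (real D / N) + real ?d * L / lim_var / real n"
      unfolding EQ by (rule norm_le, rule pairs)
    moreover have "expectation (\<lambda>x. \<bar>1 - Q x\<bar>) \<le> \<bar>1 - expectation Q\<bar>
        + sqrt (((B / \<sigma>)\<^sup>2 * (2 + C) * ((real D)\<^sup>2 / sqrt N))\<^sup>2)"
      by (rule abs_deviation_le[OF mQ bQ VQ])
    moreover have "sqrt (((B / \<sigma>)\<^sup>2 * (2 + C) * ((real D)\<^sup>2 / sqrt N))\<^sup>2) = (B / \<sigma>)\<^sup>2 * (2 + C) * ((real D)\<^sup>2 / sqrt N)"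
      using C N1 by simp
    ultimately show ?thesis unfolding e2_def Q_def Y_def by linarith
  qed

  have BE: "\<bar>prob {x \<in> space M. W x \<le> z} - cdf std_normal_distribution z\<bar>
    \<le> 16 * (real (card ?\<Gamma>) * \<beta> ^ 3 * (real D)\<^sup>2 * (1 + w) + \<beta> * real D + real (card ?\<Gamma>) * e1 + e2)" for z
    unfolding W_def
    by (rule berry_esseen_local_dependence[OF finite_Gamma_box nb(1) nb(3) m\<xi> b\<xi> \<beta>(1) D1
          dec[unfolded W_def \<eta>_def] var[unfolded \<eta>_def] mom[unfolded W_def]])
  let ?P = "(real D)\<^sup>2 / sqrt N"
  have P: "1 / sqrt N \<le> ?P" "real D / sqrt N \<le> ?P" "real D / N \<le> ?P" "0 \<le> ?P"
  proof -
    show "1 / sqrt N \<le> ?P" "real D / sqrt N \<le> ?P" using Dr N1 by (auto intro!: divide_right_mono)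
    have "sqrt N \<le> N" using sN N1 mult_left_mono[OF sN(3), of "sqrt N"] by simp
    hence "real D / N \<le> real D / sqrt N" using sN by (intro divide_left_mono) auto
    with \<open>real D / sqrt N \<le> ?P\<close> show "real D / N \<le> ?P" by linarith
  qed (use N1 in auto)
  have T1: "real (card ?\<Gamma>) * \<beta> ^ 3 * (real D)\<^sup>2 * (1 + w) = (B / \<sigma>) ^ 3 * (1 + w) * ?P"
  proof -
    have "N * \<beta> ^ 3 = (B / \<sigma>) ^ 3 / sqrt N"
    proof -
      have "sqrt N ^ 3 = N * sqrt N" by (simp only: power3_eq_cube sN(2))
      thus ?thesis unfolding \<beta>(2) power_divide using N1 by simp
    qed
    thus ?thesis by (simp add: card\<Gamma>)
  qed
  have T2: "\<beta> * real D \<le> B / \<sigma> * ?P"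
    using mult_left_mono[OF P(2), of "B / \<sigma>"] B \<sigma> by (simp add: \<beta>(2))
  have T3: "real (card ?\<Gamma>) * e1 \<le> (C * B + K) / \<sigma> * ?P"
  proof -
    have "N * e1 = (C * B * real D + K) / s * (N * q ^ l)"
      by (simp add: e1_def \<beta>_def add_divide_distrib algebra_simps)
    also have "\<dots> \<le> (C * B * real D + K) / s * 1"
      using Nq C B K s by (intro mult_left_mono) auto
    also have "\<dots> \<le> (C * B + K) / \<sigma> * (real D / sqrt N)"
    proof -
      have "C * B * real D + K \<le> (C * B + K) * real D"
        using Dr K mult_left_mono[OF Dr(1) K] by (simp add: algebra_simps)
      hence "(C * B * real D + K) / s \<le> (C * B + K) * real D / s" using s by (intro divide_right_mono) auto
      thus ?thesis by (simp add: s_def)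
    qed
    also have "\<dots> \<le> (C * B + K) / \<sigma> * ?P" using P(2) C B K \<sigma> by (intro mult_left_mono) auto
    finally show ?thesis by (simp add: card\<Gamma>)
  qed
  have T4: "e2 \<le> A2 / lim_var * ?P + real ?d * L / lim_var / real n + (B / \<sigma>)\<^sup>2 * (2 + C) * ?P"
    unfolding e2_def using mult_left_mono[OF P(3), of "A2 / lim_var"] B K C pos by (simp add: A2_def)
  define R where "R = ((B / \<sigma>) ^ 3 * (1 + w) + B / \<sigma> + (C * B + K) / \<sigma> + A2 / lim_var + (B / \<sigma>)\<^sup>2 * (2 + C)) * ?P
      + real ?d * L / lim_var / real n"
  have BE': "\<bar>prob {x. W x \<le> z} - cdf std_normal_distribution z\<bar> \<le> 16 * R" for z
  proof -
    have "real (card ?\<Gamma>) * \<beta> ^ 3 * (real D)\<^sup>2 * (1 + w) + \<beta> * real D + real (card ?\<Gamma>) * e1 + e2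
      \<le> (B / \<sigma>) ^ 3 * (1 + w) * ?P + B / \<sigma> * ?P + (C * B + K) / \<sigma> * ?P
        + (A2 / lim_var * ?P + real ?d * L / lim_var / real n + (B / \<sigma>)\<^sup>2 * (2 + C) * ?P)"
      by (intro add_mono T1[THEN eq_refl] T2 T3 T4)
    also have "\<dots> = R" unfolding R_def distrib_right by (simp only: add_ac)
    finally show ?thesis using BE[of z] by simp
  qed
  define S where "S x = (\<Sum>i\<in>?\<Gamma>. v (shift i x)) / s" for x
  \<comment> \<open>Replacing \<open>v\<close> by \<open>a l\<close> at all sites moves the
    normalised sum by at most \<open>K / s\<close>, almost surely, because
    \<open>N * q ^ l \<le> 1\<close>. The shift in the threshold is then absorbed by the Lipschitz
    bound for the normal distribution function.\<close>
  define \<delta> where "\<delta> = K / \<sigma> * ?P"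
  have mS [measurable]: "S \<in> borel_measurable M" unfolding S_def [abs_def] by measurable
  have SW: "AE x in M. \<bar>S x - W x\<bar> \<le> \<delta>"
  proof -
    have "AE x in M. \<forall>i\<in>?\<Gamma>. \<bar>v (shift i x) - a l (shift i x)\<bar> \<le> K * q ^ l"
      by (rule AE_finite_allI) (auto intro!: AE_shift[OF approx])
    thus ?thesis
    proof eventually_elim
      case (elim x)
      have "\<bar>\<Sum>i\<in>?\<Gamma>. v (shift i x) - a l (shift i x)\<bar> \<le> (\<Sum>i\<in>?\<Gamma>. K * q ^ l)"
        by (rule order_trans[OF sum_abs sum_mono]) (use elim in auto)
      also have "\<dots> = K * (N * q ^ l)" by (simp add: card\<Gamma>)
      also have "\<dots> \<le> K * 1" by (intro mult_left_mono Nq K)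
      finally have "\<bar>\<Sum>i\<in>?\<Gamma>. v (shift i x) - a l (shift i x)\<bar> / s \<le> K / s"
        using s by (simp add: divide_right_mono)
      moreover have "S x - W x = (\<Sum>i\<in>?\<Gamma>. v (shift i x) - a l (shift i x)) / s"
        by (simp add: S_def W_def \<xi>_def sum_subtractf diff_divide_distrib flip: sum_divide_distrib)
      ultimately have "\<bar>S x - W x\<bar> \<le> K / s" using s by (simp add: abs_divide)
      also have "\<dots> = K / \<sigma> * (1 / sqrt N)" by (simp add: s_def)
      also have "\<dots> \<le> \<delta>" unfolding \<delta>_def using P(1) K \<sigma> by (intro mult_left_mono) auto
      finally show ?case .
    qed
  qed
  have \<delta>0: "0 \<le> \<delta>" unfolding \<delta>_def
    by (rule mult_nonneg_nonneg[OF divide_nonneg_pos[OF K \<sigma>(1)] P(4)])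
  have up: "prob {x. S x \<le> t} \<le> prob {x. W x \<le> t + \<delta>}"
    by (rule finite_measure_mono_AE) (use SW in \<open>auto elim!: eventually_mono\<close>)
  have lo: "prob {x. W x \<le> t - \<delta>} \<le> prob {x. S x \<le> t}"
    by (rule finite_measure_mono_AE) (use SW in \<open>auto elim!: eventually_mono\<close>)
  have "\<bar>prob {x. S x \<le> t} - cdf std_normal_distribution t\<bar> \<le> 16 * R + \<delta>"
    using up lo BE'[of "t + \<delta>"] BE'[of "t - \<delta>"] cdf_std_normal_lipschitz[of t "t + \<delta>"]
      cdf_std_normal_lipschitz[of "t - \<delta>" t] \<delta>0 by linarith
  also have "16 * R + \<delta> = (16 * ((B / \<sigma>) ^ 3 * (1 + w) + B / \<sigma> + (C * B + K) / \<sigma> + A2 / lim_var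
            + (B / \<sigma>)\<^sup>2 * (2 + C)) + K / \<sigma>) * ?P + 16 * (real CARD('d) * L / lim_var) / real n"
  proof -
    have "16 * (z * p + u / k) + m * p = (16 * z + m) * p + 16 * u / k" for z p u k m :: real
      by (simp add: algebra_simps)
    thus ?thesis unfolding R_def \<delta>_def .
  qed
  finally show ?thesis by (simp only: S_def s_def A2_def)
qed

end

text \<open>It remains to choose \<open>l\<close> of order \<open>ln n\<close>: large enough for the
  mixing errors, yet so small that the ball size \<open>D\<close> is polylogarithmic and its square
  is at most a multiple of \<open>n powr \<epsilon>\<close>.\<close>

lemma (in mixing_observable) field_rate:
  assumes pos: "lim_var > 0" and \<epsilon>: "\<epsilon> > 0"
  shows "\<exists>C1>0. \<forall>n\<ge>1. \<forall>t.
    \<bar>prob {x. (\<Sum>i\<in>Gamma_box n. v (shift i x)) / real n powr (real CARD('d) / 2) \<le> t}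
        - cdf std_normal_distribution (t / sqrt lim_var)\<bar>
      \<le> C1 * max (real n powr (- real CARD('d) / 2 + \<epsilon>)) (1 / real n)"
proof -
  let ?d = "CARD('d)"
  let ?\<sigma> = "sqrt lim_var"
  define w where "w = 1 + (lim_var + real ?d * L + 2 * B * K) / lim_var"
  define R1 where "R1 = 16 * ((B / ?\<sigma>) ^ 3 * (1 + w) + B / ?\<sigma> + (C * B + K) / ?\<sigma> + (5 * B * K + C * B * B) / lim_var
            + (B / ?\<sigma>)\<^sup>2 * (2 + C)) + K / ?\<sigma>"
  define R2 where "R2 = 16 * (real ?d * L / lim_var)"
  define b where "b = - ln q"
  \<comment> \<open>Then \<open>\<kappa> * ln n \<le> l\<close> gives
    \<open>q ^ l \<le> exp (- 2 * d * ln n)\<close>, which is \<open>1 / N ^ 2\<close>.\<close>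
  define \<kappa> where "\<kappa> = 2 * real ?d / b"
  \<comment> \<open>The rate at which \<open>power_le_exp\<close> spends exactly
    \<open>\<epsilon>\<close>:
    \<open>u * (20 * \<kappa> * ln n) = \<epsilon> * ln n\<close>.\<close>
  define u where "u = \<epsilon> / (20 * \<kappa>)"
  \<comment> \<open>In the exponent, 40 is the offset 20 in \<open>D\<close> plus 20 for rounding
    \<open>l\<close> up.\<close>
  define A where "A = fact (2 * ?d) / u ^ (2 * ?d) * exp (40 * u)"
  have b: "b > 0" using q by (simp add: b_def)
  have \<kappa>: "\<kappa> > 0" using b by (simp add: \<kappa>_def)
  have u: "u > 0" using \<kappa> \<epsilon> by (simp add: u_def)
  have A: "A > 0" using u by (simp add: A_def)
  \<comment> \<open>The summand 1 keeps the constant positive.\<close>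
  have main: "\<bar>prob {x. (\<Sum>i\<in>Gamma_box n. v (shift i x)) / real n powr (real ?d / 2) \<le> t}
        - cdf std_normal_distribution (t / ?\<sigma>)\<bar>
      \<le> (\<bar>R1\<bar> * A + \<bar>R2\<bar> + 1) * max (real n powr (- real ?d / 2 + \<epsilon>)) (1 / real n)"
    if n: "n \<ge> 1" for n :: nat and t
  proof -
    define l where "l = nat \<lceil>\<kappa> * ln (real n)\<rceil>"
    let ?N = "real (n ^ ?d)" and ?D = "(20 * l + 20) ^ ?d"
    have n0: "real n > 0" using n by simp
    have ln0: "0 \<le> ln (real n)" using n by simp
    have l1: "\<kappa> * ln (real n) \<le> real l" unfolding l_def by linarith
    have l2: "real l \<le> \<kappa> * ln (real n) + 1" unfolding l_def using \<kappa> ln0 by (simp add: of_nat_nat ceiling_le_iff)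
    have Npw: "?N = real n powr real ?d" using n0 by (simp add: powr_realpow)
    have sqrtN: "sqrt ?N = real n powr (real ?d / 2)"
      unfolding Npw using n0 by (simp add: powr_half_sqrt [symmetric] powr_powr)
    have small: "q ^ l \<le> 1 / ?N\<^sup>2"
    proof -
      have "q ^ l = exp (real l * ln q)" using q by (simp add: exp_of_nat_mult)
      also have "\<dots> \<le> exp (- (2 * real ?d * ln (real n)))"
      proof -
        have "2 * real ?d * ln (real n) = b * (\<kappa> * ln (real n))" using b by (simp add: \<kappa>_def)
        also have "\<dots> \<le> b * real l" using l1 b by (intro mult_left_mono) auto
        finally show ?thesis by (simp add: b_def mult.commute)
      qed
      also have "\<dots> = 1 / (exp (real ?d * ln (real n)) * exp (real ?d * ln (real n)))"
        by (simp add: exp_minus divide_inverse flip: exp_add)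
      also have "exp (real ?d * ln (real n)) = ?N" unfolding Npw powr_def using n0 by simp
      finally show ?thesis by (simp add: power2_eq_square)
    qed
    have D2: "(real ?D)\<^sup>2 \<le> A * real n powr \<epsilon>"
    proof -
      let ?x = "20 * \<kappa> * ln (real n) + 40"
      have "(real ?D)\<^sup>2 = real (20 * l + 20) ^ (2 * ?d)"
        by (simp only: of_nat_power power_mult[symmetric] mult.commute)
      also have "\<dots> \<le> ?x ^ (2 * ?d)" by (rule power_mono) (use l2 in auto)
      also have "\<dots> \<le> fact (2 * ?d) / u ^ (2 * ?d) * exp (u * ?x)"
        by (rule power_le_exp[OF u]) (use \<kappa> ln0 in auto)
      also have "u * ?x = 40 * u + \<epsilon> * ln (real n)" using \<kappa> by (simp add: u_def field_simps)
      also have "fact (2 * ?d) / u ^ (2 * ?d) * exp (40 * u + \<epsilon> * ln (real n)) = A * real n powr \<epsilon>"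
        using n0 by (simp add: A_def exp_add powr_def)
      finally show ?thesis .
    qed
    have "(real ?D)\<^sup>2 / sqrt ?N \<le> A * real n powr \<epsilon> / sqrt ?N"
      using n0 by (intro divide_right_mono D2) auto
    also have "\<dots> = A * real n powr (- real ?d / 2 + \<epsilon>)"
    proof -
      have "- real ?d / 2 + \<epsilon> = \<epsilon> - real ?d / 2" by simp
      thus ?thesis unfolding sqrtN by (simp only: powr_diff times_divide_eq_right)
    qed
    finally have P: "(real ?D)\<^sup>2 / sqrt ?N \<le> A * real n powr (- real ?d / 2 + \<epsilon>)" .
    have "{x. (\<Sum>i\<in>Gamma_box n. v (shift i x)) / real n powr (real ?d / 2) \<le> t}
        = {x. (\<Sum>i\<in>Gamma_box n. v (shift i x)) / (?\<sigma> * sqrt ?N) \<le> t / ?\<sigma>}"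
    proof -
      have "s / (?\<sigma> * r) \<le> t / ?\<sigma> \<longleftrightarrow> s / r \<le> t" for s r
      proof -
        have "s / (?\<sigma> * r) = (s / r) / ?\<sigma>" by simp
        thus ?thesis using pos by (simp only: divide_le_cancel) simp
      qed
      thus ?thesis unfolding sqrtN by simp
    qed
    hence "\<bar>prob {x. (\<Sum>i\<in>Gamma_box n. v (shift i x)) / real n powr (real ?d / 2) \<le> t}
        - cdf std_normal_distribution (t / ?\<sigma>)\<bar> \<le> R1 * ((real ?D)\<^sup>2 / sqrt ?N) + R2 / real n"
      using field_berry_esseen[OF pos n small, of "t / ?\<sigma>"] by (simp only: R1_def R2_def w_def)
    also have "\<dots> \<le> \<bar>R1\<bar> * (A * real n powr (- real ?d / 2 + \<epsilon>)) + \<bar>R2\<bar> * (1 / real n)"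
    proof (rule add_mono)
      have "R1 * ((real ?D)\<^sup>2 / sqrt ?N) \<le> \<bar>R1\<bar> * ((real ?D)\<^sup>2 / sqrt ?N)" by (intro mult_right_mono) auto
      also have "\<dots> \<le> \<bar>R1\<bar> * (A * real n powr (- real ?d / 2 + \<epsilon>))" by (intro mult_left_mono P) auto
      finally show "R1 * ((real ?D)\<^sup>2 / sqrt ?N) \<le> \<dots>" .
      show "R2 / real n \<le> \<bar>R2\<bar> * (1 / real n)" by (simp add: divide_right_mono)
    qed
    also have "\<dots> \<le> \<bar>R1\<bar> * (A * max (real n powr (- real ?d / 2 + \<epsilon>)) (1 / real n))
        + \<bar>R2\<bar> * max (real n powr (- real ?d / 2 + \<epsilon>)) (1 / real n)
        + max (real n powr (- real ?d / 2 + \<epsilon>)) (1 / real n)"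
      using A n0 by (intro add_increasing2 add_mono mult_left_mono) (auto simp: le_max_iff_disj)
    also have "\<dots> = (\<bar>R1\<bar> * A + \<bar>R2\<bar> + 1) * max (real n powr (- real ?d / 2 + \<epsilon>)) (1 / real n)"
      by (simp only: distrib_right mult.assoc mult_1)
    finally show ?thesis .
  qed
  show ?thesis
    by (rule exI[of _ "\<bar>R1\<bar> * A + \<bar>R2\<bar> + 1"]) (use main A in \<open>auto simp: add_nonneg_pos\<close>)
qed

section \<open>From an observable on the support to a total one\<close>

lemma (in config_prob) shift_support:
  assumes inv: "\<And>i. distr M M (shift i) = M" and x: "x \<in> topological_support M"
  shows "shift i x \<in> topological_support M"
  unfolding topological_support_def
proof (intro CollectI allI impI)
  fix U assume U: "open U" "shift i x \<in> U"
  have "open (shift i -` U :: (int ^ 'd \<Rightarrow> 'a) set)" using open_vimage[OF U(1) continuous_on_shift] .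
  moreover have "x \<in> shift i -` U" using U by simp
  ultimately have "0 < emeasure M (shift i -` U)" using x by (auto simp: topological_support_def)
  also have "emeasure M (shift i -` U) = emeasure (distr M M (shift i)) U"
    by (subst emeasure_distr) (use U open_sets in auto)
  finally show "0 < emeasure M U" by (simp add: inv)
qed

lemma config_dist_le:
  assumes "\<forall>j\<in>centred_box m. x j = y j"
  shows "config_dist x y \<le> (1 / 2) ^ m"
proof -
  have "enat m \<le> first_difference x y" unfolding first_difference_def
  proof (rule Inf_greatest, clarify)
    fix k assume neq: "restrict x (centred_box k) \<noteq> restrict y (centred_box k)"
    have "\<not> k \<le> m"
    proof
      assume "k \<le> m"
      hence "centred_box k \<subseteq> centred_box m" by (auto simp: centred_box_eq intro: near_mono)
      hence "restrict x (centred_box k) = restrict y (centred_box k)"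
        using assms by (intro restrict_ext) auto
      with neq show False by simp
    qed
    thus "enat m \<le> enat k" by simp
  qed
  thus ?thesis unfolding config_dist_def
    by (cases "first_difference x y") (auto intro!: power_decreasing)
qed

theorem corollary2p10:
  fixes M :: "(int ^ 'd::finite \<Rightarrow> 'a::{finite,discrete_topology}) measure"
    and X :: "(int ^ 'd \<Rightarrow> 'a) set"
    and v :: "(int ^ 'd \<Rightarrow> 'a) \<Rightarrow> real"
    and \<sigma>2 :: real
  defines "\<sigma>2 \<equiv> (\<Sum>\<^sub>\<infinity>i. correlation M v i)"
  assumes "prob_space M" and "sets M = sets borel"
    and "shift_invariant M"
    and "markov_random_field M"
    and "X = topological_support M"
    and "exp_strong_spatial_mixing M"
    and "continuous_on X v"
    and "holder_on X v"
    and "(LINT x:X|M. v x) = 0"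
  shows "correlation M v summable_on UNIV \<and> \<sigma>2 \<ge> 0 \<and>
    (\<sigma>2 > 0 \<longrightarrow>
      (\<forall>\<epsilon>. 0 < \<epsilon> \<and> \<epsilon> < real CARD('d) / 2 \<longrightarrow>
        (\<exists>C>0. \<forall>n\<ge>1.
          (SUP t. \<bar>measure M {x \<in> X. (\<Sum>i\<in>Gamma_box n. v (shift i x)) / real n powr (real CARD('d) / 2) \<le> t}
                    - cdf std_normal_distribution (t / sqrt \<sigma>2)\<bar>)
            \<le> C * max (real n powr (- real CARD('d) / 2 + \<epsilon>)) (1 / real n))))"
proof -
  interpret prob_space M by fact
  interpret config_prob M by standard fact
  have XS: "X = topological_support M" by fact
  have inv: "distr M M (shift i) = M" for i using \<open>shift_invariant M\<close> by (simp add: shift_invariant_def)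
  have shiftX: "shift i x \<in> X" if "x \<in> X" for i x using shift_support[OF inv] that by (simp add: XS)
  obtain C c where C: "C > 0" "c > 0" and mix:
    "\<And>F G U W f g r. finite U \<Longrightarrow> finite W \<Longrightarrow> local_on F U \<Longrightarrow> local_on G W \<Longrightarrow>
       (\<And>x. \<bar>F x\<bar> \<le> f) \<Longrightarrow> (\<And>x. \<bar>G x\<bar> \<le> g) \<Longrightarrow>
       (\<And>u w. u \<in> U \<Longrightarrow> w \<in> W \<Longrightarrow> \<not> near (Suc r) u w) \<Longrightarrow>
       \<bar>expectation (\<lambda>x. F x * G x) - expectation F * expectation G\<bar>
         \<le> C * f * g * real (card U) * exp (- c * real r)"
    using exp_mixing[OF \<open>markov_random_field M\<close> \<open>exp_strong_spatial_mixing M\<close>] by blast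
  obtain \<alpha> K where \<alpha>: "\<alpha> > 0" and K: "K \<ge> 0"
    and holder: "\<And>x y. x \<in> X \<Longrightarrow> y \<in> X \<Longrightarrow> \<bar>v x - v y\<bar> \<le> K * config_dist x y powr \<alpha>"
    using \<open>holder_on X v\<close> unfolding holder_on_def by blast
  obtain x0 where x0: "x0 \<in> X" using support_nonempty XS by blast
  define \<theta> where "\<theta> = (1 / 2 :: real) powr \<alpha>"
  \<comment> \<open>\<open>\<theta>\<close> is the approximation rate on boxes, as agreement up to
    radius \<open>m\<close> bounds the distance by \<open>(1 / 2) ^ m\<close>; the slower of the two
    rates serves for both purposes.\<close>
  define q where "q = max \<theta> (exp (- c))"
  \<comment> \<open>All distances are at most 1, so \<open>v\<close> varies by at most
    \<open>K\<close> from the reference point \<open>x0\<close>; the 1 makes the bound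
    positive.\<close>
  define B where "B = \<bar>v x0\<bar> + K + 1"
  \<comment> \<open>Continuity, the Hoelder bound and the mean concern only \<open>X\<close>;
    extension by zero gives a bounded Borel function on all configurations.\<close>
  define v' where "v' x = (if x \<in> X then v x else 0)" for x
  \<comment> \<open>The predicate inside \<open>SOME\<close> sees \<open>x\<close> only on the box,
    so configurations agreeing there get the same representative: this is locality. On
    \<open>X\<close> the representative is close to \<open>x\<close>; patterns not occurring in
    \<open>X\<close> receive the default 0.\<close>
  define a where "a m x = (if \<exists>y\<in>X. \<forall>j\<in>centred_box m. y j = x j
      then v (SOME y. y \<in> X \<and> (\<forall>j\<in>centred_box m. y j = x j)) else 0)" for m x
  have \<theta>: "0 < \<theta>" "\<theta> < 1" using \<alpha> powr_less_mono'[of "1 / 2" 0 \<alpha>] by (auto simp: \<theta>_def)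
  have q: "0 < q" "q < 1" "\<theta> \<le> q" "exp (- c) \<le> q" using \<theta> C by (auto simp: q_def)
  have close: "\<bar>v x - v y\<bar> \<le> K * \<theta> ^ m" if "x \<in> X" "y \<in> X" "\<forall>j\<in>centred_box m. x j = y j" for x y m
  proof -
    have "config_dist x y powr \<alpha> \<le> ((1 / 2) ^ m) powr \<alpha>"
      using config_dist_le[OF that(3)] \<alpha> by (intro powr_mono2) (auto simp: config_dist_def split: enat.split)
    also have "\<dots> = \<theta> ^ m" by (induction m) (simp_all add: \<theta>_def powr_divide)
    finally have "K * config_dist x y powr \<alpha> \<le> K * \<theta> ^ m" using K by (rule mult_left_mono)
    with holder[OF that(1,2)] show ?thesis by linarith
  qed
  have vB: "\<bar>v x\<bar> \<le> B" if "x \<in> X" for x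
  proof -
    have "\<bar>v x - v x0\<bar> \<le> K * \<theta> ^ 0 \<or> \<bar>v x - v x0\<bar> \<le> K * config_dist x x0 powr \<alpha>"
      using holder[OF that x0] by simp
    moreover have "config_dist x x0 powr \<alpha> \<le> 1 powr \<alpha>" using \<alpha>
      by (intro powr_mono2) (auto simp: config_dist_def power_le_one split: enat.split)
    hence "K * config_dist x x0 powr \<alpha> \<le> K * 1" using K by (intro mult_left_mono) auto
    ultimately show ?thesis by (auto simp: B_def)
  qed
  have B: "B > 0" using K by (simp add: B_def)
  have some: "(SOME y. y \<in> X \<and> (\<forall>j\<in>centred_box m. y j = x j)) \<in> X"
    "\<forall>j\<in>centred_box m. (SOME y. y \<in> X \<and> (\<forall>j\<in>centred_box m. y j = x j)) j = x j"
    if "\<exists>y\<in>X. \<forall>j\<in>centred_box m. y j = x j" for m x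
    using someI_ex[of "\<lambda>y. y \<in> X \<and> (\<forall>j\<in>centred_box m. y j = x j)"] that by blast+
  have v'X: "v' x = v x" if "x \<in> X" for x using that by (simp add: v'_def)
  interpret mixing_observable M v' a B C K q
  proof
    fix F G :: "(int ^ 'd \<Rightarrow> 'a) \<Rightarrow> real" and U W :: "(int ^ 'd) set" and f g :: real and r :: nat
    assume *: "finite U" "finite W" "local_on F U" "local_on G W"
      "\<And>x. \<bar>F x\<bar> \<le> f" "\<And>x. \<bar>G x\<bar> \<le> g" "\<And>u w. u \<in> U \<Longrightarrow> w \<in> W \<Longrightarrow> \<not> near (Suc r) u w"
    have "\<bar>expectation (\<lambda>x. F x * G x) - expectation F * expectation G\<bar>
         \<le> C * f * g * real (card U) * exp (- c * real r)" by (rule mix[OF *])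
    also have "exp (- c * real r) = exp (- c) ^ r" by (simp add: exp_of_nat_mult [symmetric] mult.commute)
    also have "C * f * g * real (card U) * exp (- c) ^ r \<le> C * f * g * real (card U) * q ^ r"
    proof (intro mult_left_mono power_mono q mult_nonneg_nonneg)
      show "0 \<le> f" "0 \<le> g" using *(5,6)[of undefined] by linarith+
    qed (use C in auto)
    finally show "\<bar>expectation (\<lambda>x. F x * G x) - expectation F * expectation G\<bar> \<le> C * f * g * real (card U) * q ^ r" .
  next
    \<comment> \<open>The support is closed, hence Borel, so continuity on it alone makes the
      extension by zero measurable.\<close>
    have "(\<lambda>x. indicator X x *\<^sub>R v x) \<in> borel_measurable borel"
      by (rule borel_measurable_continuous_on_indicator)
        (use \<open>continuous_on X v\<close> closed_topological_support XS in \<open>auto intro: borel_closed\<close>)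
    moreover have "(\<lambda>x. indicator X x *\<^sub>R v x) = v'" by (auto simp: v'_def indicator_def)
    ultimately show "v' \<in> borel_measurable M" by (simp add: measurable_cong_sets[OF sets_M refl])
  next
    fix x show "\<bar>v' x\<bar> \<le> B" using vB B by (simp add: v'_def)
  next
    have "(LINT x:X|M. v x) = expectation v'"
      unfolding set_lebesgue_integral_def by (rule Bochner_Integration.integral_cong) (auto simp: v'_def indicator_def)
    thus "expectation v' = 0" using \<open>(LINT x:X|M. v x) = 0\<close> by simp
  next
    fix m show "local_on (a m) (centred_box m)"
    proof (unfold local_on_def, intro allI impI)
      fix x y :: "int ^ 'd \<Rightarrow> 'a" assume "\<forall>i\<in>centred_box m. x i = y i"
      hence "(\<forall>j\<in>centred_box m. z j = x j) \<longleftrightarrow> (\<forall>j\<in>centred_box m. z j = y j)" for z by auto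
      thus "a m x = a m y" by (simp only: a_def)
    qed
  next
    fix m x show "\<bar>a m x\<bar> \<le> B" using vB[OF some(1)] B by (simp add: a_def)
  next
    fix m
    show "AE x in M. \<bar>v' x - a m x\<bar> \<le> K * q ^ m"
      using AE_support
    proof eventually_elim
      case (elim x)
      hence x: "x \<in> X" by (simp add: XS)
      hence ex: "\<exists>y\<in>X. \<forall>j\<in>centred_box m. y j = x j" by blast
      have "\<bar>v x - a m x\<bar> \<le> K * \<theta> ^ m"
        using close[OF x some(1)[OF ex], of m] some(2)[OF ex] ex by (simp add: a_def)
      also have "\<dots> \<le> K * q ^ m" using K \<theta> q by (intro mult_left_mono power_mono) auto
      finally show ?case using x by (simp add: v'X)
    qed
  qed (use q B C K inv in auto)
  \<comment> \<open>Shifts preserve the support, so \<open>v\<close> and \<open>v'\<close> agree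
    along whole orbits of points of \<open>X\<close>.\<close>
  have cor: "correlation M v = cor"
  proof
    fix k
    show "correlation M v k = cor k"
      unfolding correlation_def cor_def set_lebesgue_integral_def XS[symmetric]
      by (rule Bochner_Integration.integral_cong) (auto simp: v'_def shiftX)
  qed
  have \<sigma>2: "\<sigma>2 = lim_var" by (simp add: \<sigma>2_def lim_var_def cor)
  have prob_eq: "prob {x \<in> X. (\<Sum>i\<in>Gamma_box n. v (shift i x)) / r \<le> t}
      = prob {x. (\<Sum>i\<in>Gamma_box n. v' (shift i x)) / r \<le> t}" for n r t
  proof (rule measure_eq_AE)
    have m: "{x \<in> space M. (\<Sum>i\<in>Gamma_box n. v' (shift i x)) / r \<le> t} \<in> sets M" by measurable
    thus "{x. (\<Sum>i\<in>Gamma_box n. v' (shift i x)) / r \<le> t} \<in> sets M" by simp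
    have "{x \<in> X. (\<Sum>i\<in>Gamma_box n. v (shift i x)) / r \<le> t} = X \<inter> {x \<in> space M. (\<Sum>i\<in>Gamma_box n. v' (shift i x)) / r \<le> t}"
      by (auto simp: v'X shiftX)
    thus "{x \<in> X. (\<Sum>i\<in>Gamma_box n. v (shift i x)) / r \<le> t} \<in> sets M"
      using m support_sets XS by simp
    show "AE x in M. (x \<in> {x \<in> X. (\<Sum>i\<in>Gamma_box n. v (shift i x)) / r \<le> t})
        = (x \<in> {x. (\<Sum>i\<in>Gamma_box n. v' (shift i x)) / r \<le> t})"
      using AE_support by eventually_elim (auto simp: v'X shiftX XS[symmetric])
  qed
  show ?thesis
  proof (intro conjI impI allI)
    show "correlation M v summable_on UNIV" unfolding cor by (rule cor_summable)
    show "\<sigma>2 \<ge> 0" unfolding \<sigma>2 by (rule lim_var_nonneg)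
    fix \<epsilon> :: real assume "\<sigma>2 > 0" "0 < \<epsilon> \<and> \<epsilon> < real CARD('d) / 2"
    then obtain C1 where C1: "C1 > 0" "\<And>n t. n \<ge> 1 \<Longrightarrow>
      \<bar>prob {x. (\<Sum>i\<in>Gamma_box n. v' (shift i x)) / real n powr (real CARD('d) / 2) \<le> t}
        - cdf std_normal_distribution (t / sqrt \<sigma>2)\<bar>
      \<le> C1 * max (real n powr (- real CARD('d) / 2 + \<epsilon>)) (1 / real n)"
      using field_rate[of \<epsilon>] unfolding \<sigma>2 by blast
    show "\<exists>C>0. \<forall>n\<ge>1.
          (SUP t. \<bar>measure M {x \<in> X. (\<Sum>i\<in>Gamma_box n. v (shift i x)) / real n powr (real CARD('d) / 2) \<le> t}
                    - cdf std_normal_distribution (t / sqrt \<sigma>2)\<bar>)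
            \<le> C * max (real n powr (- real CARD('d) / 2 + \<epsilon>)) (1 / real n)"
    proof (intro exI[of _ C1] conjI allI impI C1(1) cSUP_least)
      fix n :: nat and t :: real assume "1 \<le> n"
      thus "\<bar>measure M {x \<in> X. (\<Sum>i\<in>Gamma_box n. v (shift i x)) / real n powr (real CARD('d) / 2) \<le> t}
          - cdf std_normal_distribution (t / sqrt \<sigma>2)\<bar>
        \<le> C1 * max (real n powr (- real CARD('d) / 2 + \<epsilon>)) (1 / real n)"
        unfolding prob_eq by (rule C1(2))
    qed simp
  qed
qed

end
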